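(* Let $T$ be a complete first-order theory which is $\lambda$-stable and not superstable, where $\lambda\geq|T|$. Let $\mu_1,\mu_2$ be infinite regular cardinals with $\mu_1<\kappa_r(T)$ and $\mu_1<\mu_2<\lambda^+$. Then the $(\lambda,\mu_1)$-limit model and the $(\lambda,\mu_2)$-limit model of $T$ are not isomorphic.
   Context: Models of $T$ are ordered by elementary substructure $\preccurlyeq$. For models $M_0\preccurlyeq M$ of size $\lambda$, $M$ is universal over $M_0$ if every model $N\succcurlyeq M_0$ of $T$ of size $\lambda$ embeds elementarily into $M$ over $M_0$. For a limit ordinal $\delta<\lambda^+$, a $(\lambda,\delta)$-limit model is $M_\delta$ for some elementary chain $\langle M_i:i\le\delta\rangle$ of models of size $\lambda$, continuous at limits, with $M_{i+1}$ universal over $M_i$ for all $i<\delta$. $\kappa(T)$ is the least cardinal $\kappa$ such that for every $\subseteq$-increasing sequence of sets $\langle A_i:i<\kappa\rangle$ and every type $p$ (of finite length) over $\bigcup_{i<\kappa}A_i$, $p$ does not fork (in the usual first-order sense) over some $A_i$; $\kappa(T)=\infty$ if there is none. $\kappa_r(T)$ is the least regular cardinal $\ge\kappa(T)$. $T$ is superstable iff $\kappa(T)=\aleph_0$. *)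

theory Defs
  imports Main
begin

unbundle cardinal_syntax

section \<open>First-order logic\<close>

record ('f, 'r) lang =
  Funs :: "'f set"
  Rels :: "'r set"
  farity :: "'f \<Rightarrow> nat"
  rarity :: "'r \<Rightarrow> nat"

datatype 'f tm = Var nat | App 'f "'f tm list"

datatype ('f, 'r) fm =
    Equal "'f tm" "'f tm"
  | Pred 'r "'f tm list"
  | Neg "('f, 'r) fm"
  | And "('f, 'r) fm" "('f, 'r) fm"
  | Exists nat "('f, 'r) fm"

fun wf_tm :: "('f, 'r) lang \<Rightarrow> 'f tm \<Rightarrow> bool" where
  "wf_tm L (Var x) \<longleftrightarrow> True"
| "wf_tm L (App f ts) \<longleftrightarrow> f \<in> Funs L \<and> length ts = farity L f \<and> (\<forall>t \<in> set ts. wf_tm L t)"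

fun wf_fm :: "('f, 'r) lang \<Rightarrow> ('f, 'r) fm \<Rightarrow> bool" where
  "wf_fm L (Equal s t) \<longleftrightarrow> wf_tm L s \<and> wf_tm L t"
| "wf_fm L (Pred r ts) \<longleftrightarrow> r \<in> Rels L \<and> length ts = rarity L r \<and> (\<forall>t \<in> set ts. wf_tm L t)"
| "wf_fm L (Neg \<phi>) \<longleftrightarrow> wf_fm L \<phi>"
| "wf_fm L (And \<phi> \<psi>) \<longleftrightarrow> wf_fm L \<phi> \<and> wf_fm L \<psi>"
| "wf_fm L (Exists x \<phi>) \<longleftrightarrow> wf_fm L \<phi>"

fun fv_tm :: "'f tm \<Rightarrow> nat set" where
  "fv_tm (Var x) = {x}"
| "fv_tm (App f ts) = (\<Union>t \<in> set ts. fv_tm t)"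

fun fv :: "('f, 'r) fm \<Rightarrow> nat set" where
  "fv (Equal s t) = fv_tm s \<union> fv_tm t"
| "fv (Pred r ts) = (\<Union>t \<in> set ts. fv_tm t)"
| "fv (Neg \<phi>) = fv \<phi>"
| "fv (And \<phi> \<psi>) = fv \<phi> \<union> fv \<psi>"
| "fv (Exists x \<phi>) = fv \<phi> - {x}"

definition formulas :: "('f, 'r) lang \<Rightarrow> nat \<Rightarrow> ('f, 'r) fm set" where
  "formulas L n = {\<phi>. wf_fm L \<phi> \<and> fv \<phi> \<subseteq> {..<n}}"

abbreviation sentences :: "('f, 'r) lang \<Rightarrow> ('f, 'r) fm set" where
  "sentences L \<equiv> formulas L 0"

record ('f, 'r, 'm) struct =
  Dom :: "'m set"
  Fun :: "'f \<Rightarrow> 'm list \<Rightarrow> 'm"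
  Rel :: "'r \<Rightarrow> 'm list \<Rightarrow> bool"

definition is_struct :: "('f, 'r) lang \<Rightarrow> ('f, 'r, 'm) struct \<Rightarrow> bool" where
  "is_struct L M \<longleftrightarrow> Dom M \<noteq> {} \<and>
     (\<forall>f \<in> Funs L. \<forall>xs \<in> lists (Dom M). length xs = farity L f \<longrightarrow> Fun M f xs \<in> Dom M)"

fun eval_tm :: "('f, 'r, 'm) struct \<Rightarrow> (nat \<Rightarrow> 'm) \<Rightarrow> 'f tm \<Rightarrow> 'm" where
  "eval_tm M e (Var x) = e x"
| "eval_tm M e (App f ts) = Fun M f (map (eval_tm M e) ts)"

fun sat :: "('f, 'r, 'm) struct \<Rightarrow> (nat \<Rightarrow> 'm) \<Rightarrow> ('f, 'r) fm \<Rightarrow> bool" where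
  "sat M e (Equal s t) \<longleftrightarrow> eval_tm M e s = eval_tm M e t"
| "sat M e (Pred r ts) \<longleftrightarrow> Rel M r (map (eval_tm M e) ts)"
| "sat M e (Neg \<phi>) \<longleftrightarrow> \<not> sat M e \<phi>"
| "sat M e (And \<phi> \<psi>) \<longleftrightarrow> sat M e \<phi> \<and> sat M e \<psi>"
| "sat M e (Exists x \<phi>) \<longleftrightarrow> (\<exists>a \<in> Dom M. sat M (e(x := a)) \<phi>)"

definition tuples :: "('f, 'r, 'm) struct \<Rightarrow> nat \<Rightarrow> 'm list set" where
  "tuples M n = {a. set a \<subseteq> Dom M \<and> length a = n}"

text \<open>Only used for formulas with free variables below the length of the tuple.\<close>
abbreviation sat_tuple :: "('f, 'r, 'm) struct \<Rightarrow> 'm list \<Rightarrow> ('f, 'r) fm \<Rightarrow> bool" where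
  "sat_tuple M a \<phi> \<equiv> sat M ((!) a) \<phi>"

definition model :: "('f, 'r) lang \<Rightarrow> ('f, 'r) fm set \<Rightarrow> ('f, 'r, 'm) struct \<Rightarrow> bool" where
  "model L T M \<longleftrightarrow> is_struct L M \<and> (\<forall>\<phi> \<in> T. sat_tuple M [] \<phi>)"

definition model_of_size ::
  "('f, 'r) lang \<Rightarrow> ('f, 'r) fm set \<Rightarrow> 'l rel \<Rightarrow> ('f, 'r, 'm) struct \<Rightarrow> bool" where
  "model_of_size L T lam M \<longleftrightarrow> model L T M \<and> |Dom M| =o lam"

text \<open>
  Models are structures whose domain is a subset of a type \<open>'m\<close>, the universe. Notions that
  quantify over all models of a theory therefore depend on \<open>'m\<close>; it is passed as an argument of
  type \<open>'m itself\<close> where it is not determined otherwise. They have their intended meaning as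
  soon as \<open>'m\<close> has more elements than the cardinals under consideration.
\<close>

definition complete_theory ::
  "'m itself \<Rightarrow> ('f, 'r) lang \<Rightarrow> ('f, 'r) fm set \<Rightarrow> bool" where
  "complete_theory U L T \<longleftrightarrow> T \<subseteq> sentences L \<and>
     (\<exists>M :: ('f, 'r, 'm) struct. model L T M) \<and>
     (\<forall>\<phi> \<in> sentences L.
        (\<forall>M :: ('f, 'r, 'm) struct. model L T M \<longrightarrow> sat_tuple M [] \<phi>) \<or>
        (\<forall>M :: ('f, 'r, 'm) struct. model L T M \<longrightarrow> sat_tuple M [] (Neg \<phi>)))"

text \<open>As usual, \<open>|T|\<close> is the number of formulas of the language of \<open>T\<close>, i.e. \<open>|L| + \<aleph>\<^sub>0\<close>,
  whichever axioms present \<open>T\<close>.\<close>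
definition theory_card :: "('f, 'r) lang \<Rightarrow> ('f, 'r) fm rel" where
  "theory_card L = |{\<phi>. wf_fm L \<phi>}|"

section \<open>Elementary maps\<close>

definition elem_emb ::
  "('f, 'r) lang \<Rightarrow> ('m \<Rightarrow> 'n) \<Rightarrow> ('f, 'r, 'm) struct \<Rightarrow> ('f, 'r, 'n) struct \<Rightarrow> bool" where
  "elem_emb L h M N \<longleftrightarrow> is_struct L M \<and> is_struct L N \<and> h ` Dom M \<subseteq> Dom N \<and>
     (\<forall>\<phi> e. wf_fm L \<phi> \<longrightarrow> range e \<subseteq> Dom M \<longrightarrow> (sat M e \<phi> \<longleftrightarrow> sat N (h \<circ> e) \<phi>))"

definition elem_sub ::
  "('f, 'r) lang \<Rightarrow> ('f, 'r, 'm) struct \<Rightarrow> ('f, 'r, 'm) struct \<Rightarrow> bool" where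
  "elem_sub L M N \<longleftrightarrow> elem_emb L id M N"

definition isomorphic ::
  "('f, 'r) lang \<Rightarrow> ('f, 'r, 'm) struct \<Rightarrow> ('f, 'r, 'n) struct \<Rightarrow> bool" where
  "isomorphic L M N \<longleftrightarrow> (\<exists>h. bij_betw h (Dom M) (Dom N) \<and>
     (\<forall>f \<in> Funs L. \<forall>xs \<in> tuples M (farity L f). h (Fun M f xs) = Fun N f (map h xs)) \<and>
     (\<forall>r \<in> Rels L. \<forall>xs \<in> tuples M (rarity L r). Rel M r xs \<longleftrightarrow> Rel N r (map h xs)))"

section \<open>Types\<close>

text \<open>\<open>with_params L A\<close> is the language \<open>L(A)\<close>, with a new constant \<open>Inr a\<close> for each
  \<open>a \<in> A\<close>; in \<open>expand M h\<close> that constant denotes \<open>h a\<close>.\<close>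

definition with_params :: "('f, 'r) lang \<Rightarrow> 'p set \<Rightarrow> ('f + 'p, 'r) lang" where
  "with_params L A = \<lparr>Funs = Funs L <+> A, Rels = Rels L,
     farity = case_sum (farity L) (\<lambda>_. 0), rarity = rarity L\<rparr>"

definition expand :: "('f, 'r, 'm) struct \<Rightarrow> ('p \<Rightarrow> 'm) \<Rightarrow> ('f + 'p, 'r, 'm) struct" where
  "expand M h = \<lparr>Dom = Dom M, Fun = case_sum (Fun M) (\<lambda>a _. h a), Rel = Rel M\<rparr>"

text \<open>\<open>types L M A n\<close> is the set of complete \<open>n\<close>-types over \<open>A \<subseteq> M\<close>.\<close>
definition types ::
  "('f, 'r) lang \<Rightarrow> ('f, 'r, 'm) struct \<Rightarrow> 'm set \<Rightarrow> nat \<Rightarrow> ('f + 'm, 'r) fm set set" where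
  "types L M A n = {p. p \<subseteq> formulas (with_params L A) n \<and>
     (\<forall>q \<subseteq> p. finite q \<longrightarrow> (\<exists>a \<in> tuples M n. \<forall>\<phi> \<in> q. sat_tuple (expand M id) a \<phi>)) \<and>
     (\<forall>\<phi> \<in> formulas (with_params L A) n. \<phi> \<in> p \<or> Neg \<phi> \<in> p)}"

definition type_of ::
  "('f, 'r) lang \<Rightarrow> ('f, 'r, 'm) struct \<Rightarrow> 'm set \<Rightarrow> 'm list \<Rightarrow> ('f + 'm, 'r) fm set" where
  "type_of L M A a =
     {\<phi> \<in> formulas (with_params L A) (length a). sat_tuple (expand M id) a \<phi>}"

definition stable_in ::
  "'m itself \<Rightarrow> ('f, 'r) lang \<Rightarrow> ('f, 'r) fm set \<Rightarrow> 'l rel \<Rightarrow> bool" where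
  "stable_in U L T lam \<longleftrightarrow> (\<forall>(M :: ('f, 'r, 'm) struct) A n.
     model L T M \<longrightarrow> A \<subseteq> Dom M \<longrightarrow> |A| \<le>o lam \<longrightarrow> |types L M A n| \<le>o lam)"

section \<open>Forking and \<open>\<kappa>(T)\<close>\<close>

text \<open>
  In \<open>divides L N A n \<phi> b\<close> the formula is \<open>\<phi>(x, b)\<close> with \<open>x\<close> the variables below \<open>n\<close>, the
  tuple \<open>b\<close> being assigned to the variables from \<open>n\<close> on. The sequence witnessing
  dividing is required to lie in \<open>N\<close>.
\<close>
definition divides ::
  "('f, 'r) lang \<Rightarrow> ('f, 'r, 'm) struct \<Rightarrow> 'm set \<Rightarrow> nat \<Rightarrow> ('f, 'r) fm \<Rightarrow> 'm list \<Rightarrow> bool" where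
  "divides L N A n \<phi> b \<longleftrightarrow> (\<exists>k (c :: nat \<Rightarrow> 'm list).
     (\<forall>i. c i \<in> tuples N (length b) \<and> type_of L N A (c i) = type_of L N A b) \<and>
     (\<forall>K. finite K \<and> card K = k \<longrightarrow>
        \<not> (\<exists>a \<in> tuples N n. \<forall>i \<in> K. sat_tuple N (a @ c i) \<phi>)))"

text \<open>
  \<open>p\<close> is a type over a subset of \<open>M\<close>, and \<open>A \<subseteq> M\<close>. It forks over \<open>A\<close> if it implies a finite
  disjunction of formulas \<open>\<phi>(x, b)\<close> dividing over \<open>A\<close>. The parameters \<open>b\<close> and the sequences
  witnessing dividing may come from any elementary extension \<open>f : M \<rightarrow> N\<close>, in place of
  a monster model; the implication is modulo the elementary diagram of \<open>N\<close>, hence by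
  compactness by a finite part of \<open>p\<close>.
\<close>
definition forks ::
  "('f, 'r) lang \<Rightarrow> ('f, 'r, 'm) struct \<Rightarrow> nat \<Rightarrow> ('f + 'm, 'r) fm set \<Rightarrow> 'm set \<Rightarrow> bool" where
  "forks L M n p A \<longleftrightarrow> (\<exists>(N :: ('f, 'r, 'm) struct) f D q.
     elem_emb L f M N \<and>
     finite D \<and>
     (\<forall>(\<phi>, b) \<in> D. \<phi> \<in> formulas L (n + length b) \<and> set b \<subseteq> Dom N \<and>
        divides L N (f ` A) n \<phi> b) \<and>
     finite q \<and> q \<subseteq> p \<and>
     (\<forall>a \<in> tuples N n. (\<forall>\<psi> \<in> q. sat_tuple (expand N f) a \<psi>) \<longrightarrow>
        (\<exists>(\<phi>, b) \<in> D. sat_tuple N (a @ b) \<phi>)))"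

text \<open>The condition on \<open>\<kappa>\<close> in the definition of \<open>\<kappa>(T)\<close>; as \<open>\<kappa>\<close> is an initial ordinal, a
  sequence of length \<open>\<kappa>\<close> is indexed by \<open>Field \<kappa>\<close>.\<close>
definition local_character ::
  "'m itself \<Rightarrow> ('f, 'r) lang \<Rightarrow> ('f, 'r) fm set \<Rightarrow> 'k rel \<Rightarrow> bool" where
  "local_character U L T \<kappa> \<longleftrightarrow> (\<forall>(M :: ('f, 'r, 'm) struct) A n p.
     model L T M \<longrightarrow> (\<forall>i \<in> Field \<kappa>. A i \<subseteq> Dom M) \<longrightarrow> relChain \<kappa> A \<longrightarrow>
     p \<in> types L M (\<Union>i \<in> Field \<kappa>. A i) n \<longrightarrow> (\<exists>i \<in> Field \<kappa>. \<not> forks L M n p (A i)))"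

definition is_least_card :: "('k rel \<Rightarrow> bool) \<Rightarrow> 'k rel \<Rightarrow> bool" where
  "is_least_card P \<kappa> \<longleftrightarrow> Cinfinite \<kappa> \<and> P \<kappa> \<and> (\<forall>\<kappa>'. Cinfinite \<kappa>' \<and> P \<kappa>' \<longrightarrow> \<kappa> \<le>o \<kappa>')"

text \<open>The least infinite cardinal satisfying \<open>P\<close>; \<open>None\<close> stands for \<open>\<infinity>\<close>.\<close>
definition least_card :: "('k rel \<Rightarrow> bool) \<Rightarrow> 'k rel option" where
  "least_card P =
     (if \<exists>\<kappa>. is_least_card P \<kappa> then Some (SOME \<kappa>. is_least_card P \<kappa>) else None)"

text \<open>
  \<open>\<kappa>(T)\<close> ranges over infinite cardinals: at a finite \<open>\<kappa> > 0\<close> the condition only says that types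
  do not fork over their domain, which is true in every stable theory. The values are cardinals
  on subsets of the universe; a \<open>lam\<close>-stable theory with \<open>|T| \<le> lam\<close> has
  \<open>\<kappa>(T) \<le> lam\<close>, so nothing is lost there.
\<close>
definition kappa :: "('f, 'r) lang \<Rightarrow> ('f, 'r) fm set \<Rightarrow> 'm rel option" where
  "kappa L T = least_card (local_character TYPE('m) L T)"

definition kappa_r :: "('f, 'r) lang \<Rightarrow> ('f, 'r) fm set \<Rightarrow> 'm rel option" where
  "kappa_r L T = (case kappa L T of None \<Rightarrow> None
     | Some (\<kappa> :: 'm rel) \<Rightarrow> least_card (\<lambda>\<kappa>'. regularCard \<kappa>' \<and> \<kappa> \<le>o \<kappa>'))"

definition card_below :: "'a rel \<Rightarrow> 'k rel option \<Rightarrow> bool" where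
  "card_below \<mu> x \<longleftrightarrow> (case x of None \<Rightarrow> True | Some \<kappa> \<Rightarrow> \<mu> <o \<kappa>)"

definition superstable :: "'m itself \<Rightarrow> ('f, 'r) lang \<Rightarrow> ('f, 'r) fm set \<Rightarrow> bool" where
  "superstable U L T \<longleftrightarrow> (\<exists>\<kappa> :: 'm rel. kappa L T = Some \<kappa> \<and> \<kappa> =o natLeq)"

section \<open>Limit models\<close>

definition universal_over ::
  "('f, 'r) lang \<Rightarrow> ('f, 'r) fm set \<Rightarrow> 'l rel \<Rightarrow>
     ('f, 'r, 'm) struct \<Rightarrow> ('f, 'r, 'm) struct \<Rightarrow> bool" where
  "universal_over L T lam M M0 \<longleftrightarrow>
     model_of_size L T lam M0 \<and> model_of_size L T lam M \<and> elem_sub L M0 M \<and>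
     (\<forall>N :: ('f, 'r, 'm) struct. model_of_size L T lam N \<longrightarrow> elem_sub L M0 N \<longrightarrow>
        (\<exists>h. elem_emb L h N M \<and> (\<forall>a \<in> Dom M0. h a = a)))"

definition limit_ordinal :: "'d rel \<Rightarrow> bool" where
  "limit_ordinal \<delta> \<longleftrightarrow> Well_order \<delta> \<and> Field \<delta> \<noteq> {} \<and> (\<forall>i \<in> Field \<delta>. aboveS \<delta> i \<noteq> {})"

text \<open>
  An ordinal is given by a well-order \<open>\<delta>\<close>. The elements of \<open>Field \<delta>\<close> are the \<open>i < \<delta>\<close>; the
  ordinal below \<open>i\<close> is \<open>\<delta>\<close> restricted to \<open>underS \<delta> i\<close>, and \<open>wo_rel.suc \<delta> {i}\<close>
  is \<open>i + 1\<close>. The last model \<open>M\<^sub>\<delta>\<close> of the chain is the argument \<open>N\<close>.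
\<close>
definition limit_model ::
  "('f, 'r) lang \<Rightarrow> ('f, 'r) fm set \<Rightarrow> 'l rel \<Rightarrow> 'd rel \<Rightarrow> ('f, 'r, 'm) struct \<Rightarrow> bool" where
  "limit_model L T lam \<delta> N \<longleftrightarrow> limit_ordinal \<delta> \<and> \<delta> <o cardSuc lam \<and>
     (\<exists>M :: 'd \<Rightarrow> ('f, 'r, 'm) struct.
        (\<forall>i \<in> Field \<delta>. model_of_size L T lam (M i)) \<and> model_of_size L T lam N \<and>
        (\<forall>(i, j) \<in> \<delta>. elem_sub L (M i) (M j)) \<and> (\<forall>i \<in> Field \<delta>. elem_sub L (M i) N) \<and>
        (\<forall>i \<in> Field \<delta>. limit_ordinal (Restr \<delta> (underS \<delta> i)) \<longrightarrow>
           Dom (M i) = (\<Union>j \<in> underS \<delta> i. Dom (M j))) \<and>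
        Dom N = (\<Union>i \<in> Field \<delta>. Dom (M i)) \<and>
        (\<forall>i \<in> Field \<delta>. universal_over L T lam (M (wo_rel.suc \<delta> {i})) (M i)))"

end

theory Submission
  imports Defs
begin

text \<open>
  Let \<open>p\<close> fork over every member of an increasing sequence \<open>A\<^sub>i\<close>, \<open>i < \<mu>\<^sub>1\<close>. Choose finite parts
  \<open>\<phi>\<^sub>i(x, b\<^sub>i)\<close> of \<open>p\<close> that fork over the set of all \<open>b\<^sub>j\<close>, \<open>j < i\<close>, and copy the \<open>b\<^sub>i\<close> into a resolution
  \<open>M\<^sub>i\<close> of the \<open>\<mu>\<^sub>1\<close>-limit model in such a way that \<open>\<phi>\<^sub>i(x, b\<^sub>i)\<close> has no realization in \<open>M\<^sub>i\<close>. The copy of \<open>p\<close>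
  is then a type over \<open>\<mu>\<^sub>1\<close> parameters omitted by the \<open>\<mu>\<^sub>1\<close>-limit model, whereas the \<open>\<mu>\<^sub>2\<close>-limit
  model realizes all such types, as \<open>\<mu>\<^sub>1\<close> parameters lie in one member of its resolution.

  By compactness and universality of \<open>M\<^sub>i\<^sub>+\<^sub>1\<close> over \<open>M\<^sub>i\<close> a copy of \<open>b\<^sub>i\<close> is only obstructed by finitely many
  tuples that realize \<open>\<phi>\<^sub>i(x, b)\<close> for all \<open>b\<close> satisfying some formula of the type of \<open>b\<^sub>i\<close>. This would make
  a consistent formula over the base (satisfied by the concatenation of those tuples) fork over the
  base. That is impossible by an argument with Shelah's rank: a consistent formula
  covered by finitely many \<open>\<psi>\<^sub>l(x, d\<^sub>l)\<close> has the same rank as one of the pieces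
  \<open>\<psi>\<^sub>l(x, d\<^sub>l)\<close> cuts out, and if \<open>\<psi>\<^sub>l(x, d\<^sub>l)\<close> divides over the base, then infinitely many conjugates of that
  piece force the rank up. The rank is finite since the theory is stable. So neither symmetry
  nor extension of nonforking is needed.
\<close>

section \<open>Substitution and definable relations\<close>

text \<open>Two constraints shape the details. All models live in one type \<open>'m\<close>, only
  known to be larger than \<open>lam\<close>, and universality accepts only extensions of size
  \<open>lam\<close>. A full ultrapower may be too big for both, so compactness is proved with a
  Skolem hull of at most \<open>lam\<close> sequences inside the power, placed in \<open>'m\<close>
  so that it literally extends the given model. The model witnessing a fork, by contrast, has no
  size bound; stability in \<open>lam\<close> reaches it as finiteness of the rank of each formula,
  which is first-order and so passes between all models of \<open>T\<close>. The rank is handled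
  through trees instead of ordinals. Only the finitely many formulas witnessing one fork occur as
  labels, and for fixed labels and fixed branching a tree is a finite configuration whose existence
  is a formula in the parameters. Its truth is therefore shared by all conjugates of a dividing
  parameter. Regularity of \<open>\<mu>1\<close> enters in the recursion: the fewer than
  \<open>\<mu>1\<close> parameters chosen so far lie in one \<open>A \<sigma>\<close>, and as
  \<open>p\<close> forks over \<open>A \<sigma>\<close>, the next finite part of \<open>p\<close>
  can be taken to fork over a set that contains them.\<close>

lemma eval_tm_cong: "(\<And>v. v \<in> fv_tm t \<Longrightarrow> e v = e' v) \<Longrightarrow> eval_tm M e t = eval_tm M e' t"
proof (induction t)
  case (App f ts)
  have "map (eval_tm M e) ts = map (eval_tm M e') ts"
    using App by (intro map_cong refl) (metis UN_I fv_tm.simps(2))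
  then show ?case by (simp only: eval_tm.simps)
qed simp

lemma sat_cong: "(\<And>v. v \<in> fv \<phi> \<Longrightarrow> e v = e' v) \<Longrightarrow> sat M e \<phi> \<longleftrightarrow> sat M e' \<phi>"
proof (induction \<phi> arbitrary: e e')
  case (Equal s t)
  have "eval_tm M e s = eval_tm M e' s" "eval_tm M e t = eval_tm M e' t"
    by (rule eval_tm_cong, rule Equal, simp)+
  then show ?case by simp
next
  case (Pred r ts)
  then have "map (eval_tm M e) ts = map (eval_tm M e') ts"
    by (intro map_cong refl eval_tm_cong) auto
  then show ?case by (simp only: sat.simps)
next
  case (Exists x \<phi>)
  have "sat M (e(x := a)) \<phi> \<longleftrightarrow> sat M (e'(x := a)) \<phi>" for a
    using Exists.prems by (intro Exists.IH) auto
  then show ?case by simp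
next
  case (And \<phi> \<psi>)
  show ?case using And.IH[of e e'] And.prems by auto
next
  case (Neg \<phi>)
  show ?case using Neg.IH[of e e'] Neg.prems by auto
qed

lemma finite_fv_tm: "finite (fv_tm t)"
  by (induction t) auto

lemma finite_fv: "finite (fv \<phi>)"
  by (induction \<phi>) (auto simp: finite_fv_tm)

lemma eval_tm_in_Dom:
  "is_struct L M \<Longrightarrow> wf_tm L t \<Longrightarrow> (\<And>v. v \<in> fv_tm t \<Longrightarrow> e v \<in> Dom M) \<Longrightarrow> eval_tm M e t \<in> Dom M"
proof (induction t)
  case (App f ts)
  have "map (eval_tm M e) ts \<in> lists (Dom M)" using App by (auto simp: in_lists_conv_set)
  moreover have "f \<in> Funs L" "length (map (eval_tm M e) ts) = farity L f" using App.prems by auto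
  ultimately have "Fun M f (map (eval_tm M e) ts) \<in> Dom M"
    using App.prems(1) unfolding is_struct_def by blast
  then show ?case by simp
qed simp

definition fresh :: "nat set \<Rightarrow> nat" where "fresh A = (SOME z. z \<notin> A)"

lemma fresh_notin: "finite A \<Longrightarrow> fresh A \<notin> A"
  unfolding fresh_def by (rule someI_ex) (rule ex_new_if_finite[OF infinite_UNIV_nat])

lemma finite_set1_tm: "finite (set_tm t)"
  by (induction t) auto

lemma finite_set1_fm: "finite (set1_fm \<phi>)"
  by (induction \<phi>) (auto simp: finite_set1_tm)

text \<open>Simultaneous substitution of terms for variables and for constants: \<open>kf\<close> maps a function
  symbol either to a function symbol or, if it is a constant to be eliminated, to a term.\<close>

fun tr_tm :: "('g \<Rightarrow> 'f + 'f tm) \<Rightarrow> (nat \<Rightarrow> 'f tm) \<Rightarrow> 'g tm \<Rightarrow> 'f tm" where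
  "tr_tm kf s (Var v) = s v"
| "tr_tm kf s (App g ts) = (case kf g of Inl f \<Rightarrow> App f (map (tr_tm kf s) ts) | Inr t \<Rightarrow> t)"

text \<open>Bound variables are renamed off this set. The variables of the terms put for constants
  belong to it too, since a quantifier above such a constant could capture them.\<close>

definition tr_fv :: "('g \<Rightarrow> 'f + 'f tm) \<Rightarrow> (nat \<Rightarrow> 'f tm) \<Rightarrow> 'g set \<Rightarrow> nat set \<Rightarrow> nat set" where
  "tr_fv kf s G V = (\<Union>v\<in>V. fv_tm (s v)) \<union> (\<Union>g\<in>G. case kf g of Inl f \<Rightarrow> {} | Inr t \<Rightarrow> fv_tm t)"

lemma tr_fv_mono: "G \<subseteq> G' \<Longrightarrow> V \<subseteq> V' \<Longrightarrow> tr_fv kf s G V \<subseteq> tr_fv kf s G' V'"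
  unfolding tr_fv_def by blast

lemma finite_tr_fv: "finite G \<Longrightarrow> finite V \<Longrightarrow> finite (tr_fv kf s G V)"
  unfolding tr_fv_def by (auto simp: finite_fv_tm split: sum.split)

fun tr :: "('g \<Rightarrow> 'f + 'f tm) \<Rightarrow> (nat \<Rightarrow> 'f tm) \<Rightarrow> ('g, 'r) fm \<Rightarrow> ('f, 'r) fm" where
  "tr kf s (Equal t u) = Equal (tr_tm kf s t) (tr_tm kf s u)"
| "tr kf s (Pred r ts) = Pred r (map (tr_tm kf s) ts)"
| "tr kf s (Neg \<phi>) = Neg (tr kf s \<phi>)"
| "tr kf s (And \<phi> \<psi>) = And (tr kf s \<phi>) (tr kf s \<psi>)"
| "tr kf s (Exists x \<phi>) = (let z = fresh (tr_fv kf s (set1_fm \<phi>) (fv \<phi> - {x}))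
     in Exists z (tr kf (s(x := Var z)) \<phi>))"

lemma eval_tr_tm:
  assumes "\<And>g. g \<in> set_tm t \<Longrightarrow>
    (case kf g of Inl f \<Rightarrow> Fun N' g = Fun N f | Inr u \<Rightarrow> \<forall>xs. Fun N' g xs = eval_tm N e u)"
  shows "eval_tm N e (tr_tm kf s t) = eval_tm N' (\<lambda>v. eval_tm N e (s v)) t"
  using assms
proof (induction t)
  case (App g ts)
  have "map (eval_tm N e) (map (tr_tm kf s) ts) = map (eval_tm N' (\<lambda>v. eval_tm N e (s v))) ts"
    using App by auto
  then show ?case using App.prems[of g] by (cases "kf g") (simp_all del: map_map)
qed simp

lemma fv_tr_tm: "fv_tm (tr_tm kf s t) \<subseteq> tr_fv kf s (set_tm t) (fv_tm t)"
proof (induction t)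
  case (App g ts)
  have "fv_tm (tr_tm kf s t) \<subseteq> tr_fv kf s (set_tm (App g ts)) (fv_tm (App g ts))" if "t \<in> set ts" for t
    using App.IH[OF that] that by (rule_tac order_trans[OF _ tr_fv_mono]) auto
  then have *: "(\<Union>t\<in>set ts. fv_tm (tr_tm kf s t)) \<subseteq> tr_fv kf s (set_tm (App g ts)) (fv_tm (App g ts))"
    by blast
  show ?case
  proof (cases "kf g")
    case (Inr t)
    then show ?thesis by (auto simp: tr_fv_def)
  qed (use * in simp)
qed (simp add: tr_fv_def)

lemma fv_tr: "fv (tr kf s \<phi>) \<subseteq> tr_fv kf s (set1_fm \<phi>) (fv \<phi>)"
proof (induction \<phi> arbitrary: s)
  case (Equal t u)
  have "fv_tm (tr_tm kf s t) \<subseteq> tr_fv kf s (set1_fm (Equal t u)) (fv (Equal t u))"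
    "fv_tm (tr_tm kf s u) \<subseteq> tr_fv kf s (set1_fm (Equal t u)) (fv (Equal t u))"
    by (rule order_trans[OF fv_tr_tm tr_fv_mono]; auto)+
  then show ?case by auto
next
  case (Pred r ts)
  have "fv_tm (tr_tm kf s t) \<subseteq> tr_fv kf s (set1_fm (Pred r ts)) (fv (Pred r ts))" if "t \<in> set ts" for t
    using that by (intro order_trans[OF fv_tr_tm tr_fv_mono]) auto
  then show ?case by auto
next
  case (And \<phi> \<psi>)
  have "fv (tr kf s \<phi>) \<subseteq> tr_fv kf s (set1_fm (And \<phi> \<psi>)) (fv (And \<phi> \<psi>))"
    by (rule order_trans[OF And.IH(1)[of s] tr_fv_mono]) auto
  moreover have "fv (tr kf s \<psi>) \<subseteq> tr_fv kf s (set1_fm (And \<phi> \<psi>)) (fv (And \<phi> \<psi>))"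
    by (rule order_trans[OF And.IH(2)[of s] tr_fv_mono]) auto
  ultimately show ?case by auto
next
  case (Exists x \<phi>)
  define V where "V = tr_fv kf s (set1_fm \<phi>) (fv \<phi> - {x})"
  define z where "z = fresh V"
  have "fv (tr kf (s(x := Var z)) \<phi>) \<subseteq> tr_fv kf (s(x := Var z)) (set1_fm \<phi>) (fv \<phi>)"
    by (rule Exists.IH)
  also have "\<dots> \<subseteq> insert z V"
    unfolding V_def tr_fv_def by (auto split: if_splits)
  finally show ?case by (simp only: tr.simps Let_def V_def[symmetric] z_def[symmetric]) (auto simp: V_def)
qed simp

text \<open>The substitution lemma. An eliminated constant denotes the value of its term under
  \<open>e\<close>, so the hypothesis on \<open>kf\<close> has to survive the update
  \<open>e(z := a)\<close> at a quantifier; the choice of \<open>z\<close> ensures this.\<close>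

lemma sat_tr:
  assumes "Dom N' = Dom N" "Rel N' = Rel N"
    and "\<And>g. g \<in> set1_fm \<phi> \<Longrightarrow>
      (case kf g of Inl f \<Rightarrow> Fun N' g = Fun N f | Inr u \<Rightarrow> \<forall>xs. Fun N' g xs = eval_tm N e u)"
  shows "sat N e (tr kf s \<phi>) \<longleftrightarrow> sat N' (\<lambda>v. eval_tm N e (s v)) \<phi>"
  using assms(3)
proof (induction \<phi> arbitrary: e s)
  case (Equal t u)
  have "eval_tm N e (tr_tm kf s t) = eval_tm N' (\<lambda>v. eval_tm N e (s v)) t"
    "eval_tm N e (tr_tm kf s u) = eval_tm N' (\<lambda>v. eval_tm N e (s v)) u"
    by (rule eval_tr_tm, rule Equal, simp)+
  then show ?case by simp
next
  case (Pred r ts)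
  have "eval_tm N e (tr_tm kf s t) = eval_tm N' (\<lambda>v. eval_tm N e (s v)) t" if "t \<in> set ts" for t
    by (rule eval_tr_tm, rule Pred) (use that in auto)
  then have "map (eval_tm N e) (map (tr_tm kf s) ts) = map (eval_tm N' (\<lambda>v. eval_tm N e (s v))) ts"
    by simp
  then show ?case by (simp only: tr.simps sat.simps assms(2))
next
  case (And \<phi> \<psi>)
  show ?case using And.IH[of e s] And.prems by auto
next
  case (Neg \<phi>)
  show ?case using Neg.IH[of e s] Neg.prems by auto
next
  case (Exists x \<phi>)
  define V where "V = tr_fv kf s (set1_fm \<phi>) (fv \<phi> - {x})"
  define z where "z = fresh V"
  have z: "z \<notin> V" unfolding z_def V_def by (intro fresh_notin finite_tr_fv finite_set1_fm) (simp add: finite_fv)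
  have *: "sat N (e(z := a)) (tr kf (s(x := Var z)) \<phi>) \<longleftrightarrow> sat N' ((\<lambda>v. eval_tm N e (s v))(x := a)) \<phi>" for a
  proof -
    have "sat N (e(z := a)) (tr kf (s(x := Var z)) \<phi>)
       \<longleftrightarrow> sat N' (\<lambda>v. eval_tm N (e(z := a)) ((s(x := Var z)) v)) \<phi>"
    proof (rule Exists.IH)
      fix g assume g: "g \<in> set1_fm \<phi>"
      show "case kf g of Inl f \<Rightarrow> Fun N' g = Fun N f
        | Inr u \<Rightarrow> \<forall>xs. Fun N' g xs = eval_tm N (e(z := a)) u"
      proof (cases "kf g")
        case (Inr u)
        have "z \<notin> fv_tm u" using z g Inr unfolding V_def tr_fv_def by force
        then have "eval_tm N (e(z := a)) u = eval_tm N e u" by (intro eval_tm_cong) auto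
        then show ?thesis using Exists.prems[of g] g Inr by simp
      qed (use Exists.prems[of g] g in simp)
    qed
    also have "\<dots> \<longleftrightarrow> sat N' ((\<lambda>v. eval_tm N e (s v))(x := a)) \<phi>"
    proof (rule sat_cong)
      fix v assume v: "v \<in> fv \<phi>"
      show "eval_tm N (e(z := a)) ((s(x := Var z)) v) = ((\<lambda>v. eval_tm N e (s v))(x := a)) v"
      proof (cases "v = x")
        case False
        then have "z \<notin> fv_tm (s v)" using z v unfolding V_def tr_fv_def by blast
        then show ?thesis using False by (auto intro!: eval_tm_cong)
      qed simp
    qed
    finally show ?thesis .
  qed
  show ?case using * assms(1) by (simp add: Let_def V_def[symmetric] z_def[symmetric])
qed

lemma wf_tr_tm:
  assumes "\<And>g. g \<in> Funs L' \<Longrightarrow> case kf g of Inl f \<Rightarrow> f \<in> Funs L \<and> farity L f = farity L' g | Inr t \<Rightarrow> wf_tm L t"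
    and "\<And>v. wf_tm L (s v)" and "wf_tm L' t"
  shows "wf_tm L (tr_tm kf s t)"
  using assms(3)
proof (induction t)
  case (App g ts)
  then show ?case using assms(1)[of g] by (auto split: sum.splits)
qed (simp add: assms)

lemma wf_tr:
  assumes "\<And>g. g \<in> Funs L' \<Longrightarrow> case kf g of Inl f \<Rightarrow> f \<in> Funs L \<and> farity L f = farity L' g | Inr t \<Rightarrow> wf_tm L t"
    and "\<And>v. wf_tm L (s v)" and "Rels L' = Rels L" "rarity L' = rarity L" and "wf_fm L' \<phi>"
  shows "wf_fm L (tr kf s \<phi>)"
  using assms(2,5)
proof (induction \<phi> arbitrary: s)
  case (Equal t u)
  then show ?case using wf_tr_tm[OF assms(1), of s] by simp
next
  case (Pred r ts)
  then show ?case using wf_tr_tm[OF assms(1), of s] assms(3,4) by simp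
next
  case (Exists x \<phi>)
  show ?case using Exists by (auto simp: Let_def)
qed auto

lemma set1_wf_tm: "wf_tm L t \<Longrightarrow> set_tm t \<subseteq> Funs L"
  by (induction t) auto

lemma set1_wf_fm: "wf_fm L \<phi> \<Longrightarrow> set1_fm \<phi> \<subseteq> Funs L"
proof (induction \<phi>)
  case (Pred r ts)
  then show ?case using set1_wf_tm[of L] by auto
next
  case (Equal t u)
  then show ?case using set1_wf_tm[of L] by auto
qed auto

section \<open>Tuples, and parameters traded between constants and variables\<close>

lemma formulas_sat_cong:
  "\<phi> \<in> formulas L K \<Longrightarrow> (\<And>v. v < K \<Longrightarrow> e v = e' v) \<Longrightarrow> sat M e \<phi> \<longleftrightarrow> sat M e' \<phi>"
  unfolding formulas_def by (intro sat_cong) auto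

lemma tuples_append: "a \<in> tuples M n \<Longrightarrow> b \<in> tuples M m \<Longrightarrow> a @ b \<in> tuples M (n + m)"
  by (auto simp: tuples_def)

lemma tuples_nth: "a \<in> tuples M n \<Longrightarrow> i < n \<Longrightarrow> a ! i \<in> Dom M"
  by (auto simp: tuples_def)

lemma tuples_nonempty: "is_struct L M \<Longrightarrow> \<exists>a. a \<in> tuples M n"
proof -
  assume "is_struct L M"
  then obtain m where "m \<in> Dom M" unfolding is_struct_def by auto
  then have "replicate n m \<in> tuples M n" by (auto simp: tuples_def)
  then show ?thesis by blast
qed

text \<open>Each parameter occurring in \<chi> becomes a variable numbered from \<open>n\<close> on.
  The result is uniform in \<open>N\<close> and \<open>h\<close>, because forking reads one and the
  same formula in \<open>expand M id\<close> and in \<open>expand N f\<close>.\<close>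

lemma unparam:
  fixes \<chi> :: "('f + 'p, 'r) fm"
  assumes "\<chi> \<in> formulas (with_params L A) n"
  obtains \<beta> \<phi> where "set \<beta> \<subseteq> A" "\<phi> \<in> formulas L (n + length \<beta>)"
    "\<And>(N :: ('f, 'r, 'm) struct) h a. length a = n \<Longrightarrow>
       sat_tuple (expand N h) a \<chi> \<longleftrightarrow> sat_tuple N (a @ map h \<beta>) \<phi>"
proof -
  have wf: "wf_fm (with_params L A) \<chi>" and fv: "fv \<chi> \<subseteq> {..<n}"
    using assms by (auto simp: formulas_def)
  have "finite {a. Inr a \<in> set1_fm \<chi>}"
    by (rule finite_imageD[of Inr]) (auto intro: finite_subset[OF _ finite_set1_fm[of \<chi>]])
  then obtain \<beta> where \<beta>: "set \<beta> = {a. Inr a \<in> set1_fm \<chi>}" using finite_list by metis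
  define idx where "idx a = (SOME j. j < length \<beta> \<and> \<beta> ! j = a)" for a
  have idx: "idx a < length \<beta> \<and> \<beta> ! idx a = a" if "Inr a \<in> set1_fm \<chi>" for a
    unfolding idx_def by (rule someI_ex) (use that \<beta> in \<open>metis in_set_conv_nth mem_Collect_eq\<close>)
  define kf :: "'f + 'p \<Rightarrow> 'f + 'f tm" where "kf = case_sum Inl (\<lambda>a. Inr (Var (n + idx a)))"
  define \<phi> where "\<phi> = tr kf Var \<chi>"
  show thesis
  proof (rule that)
    show "set \<beta> \<subseteq> A" using \<beta> set1_wf_fm[OF wf] by (auto simp: with_params_def)
    have "wf_fm L \<phi>" unfolding \<phi>_def
      by (rule wf_tr[OF _ _ _ _ wf]) (auto simp: with_params_def kf_def)
    moreover have "fv \<phi> \<subseteq> {..<n + length \<beta>}"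
    proof -
      have "fv \<phi> \<subseteq> tr_fv kf Var (set1_fm \<chi>) (fv \<chi>)" unfolding \<phi>_def by (rule fv_tr)
      also have "\<dots> \<subseteq> {..<n + length \<beta>}"
        using fv idx by (auto simp: tr_fv_def kf_def split: sum.splits)
      finally show ?thesis .
    qed
    ultimately show "\<phi> \<in> formulas L (n + length \<beta>)" by (simp add: formulas_def)
    fix N :: "('f, 'r, 'm) struct" and h and a :: "'m list"
    assume a: "length a = n"
    have "sat_tuple N (a @ map h \<beta>) \<phi> \<longleftrightarrow> sat (expand N h) (\<lambda>v. eval_tm N ((!) (a @ map h \<beta>)) (Var v)) \<chi>"
      unfolding \<phi>_def
    proof (rule sat_tr)
      fix g assume g: "g \<in> set1_fm \<chi>"
      show "case kf g of Inl f \<Rightarrow> Fun (expand N h) g = Fun N f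
        | Inr u \<Rightarrow> \<forall>xs. Fun (expand N h) g xs = eval_tm N ((!) (a @ map h \<beta>)) u"
        using idx g a by (cases g) (auto simp: kf_def expand_def nth_append)
    qed (simp_all add: expand_def)
    also have "\<dots> \<longleftrightarrow> sat_tuple (expand N h) a \<chi>"
      using fv a by (intro sat_cong) (auto simp: nth_append)
    finally show "sat_tuple (expand N h) a \<chi> \<longleftrightarrow> sat_tuple N (a @ map h \<beta>) \<phi>" by simp
  qed
qed

lemma param:
  fixes \<phi> :: "('f, 'r) fm" and A :: "'p set"
  assumes "\<phi> \<in> formulas L (n + length \<beta>)" "set \<beta> \<subseteq> A"
  obtains \<chi> where "\<chi> \<in> formulas (with_params L A) n"
    "\<And>(N :: ('f, 'r, 'm) struct) h a. length a = n \<Longrightarrow>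
       sat_tuple (expand N h) a \<chi> \<longleftrightarrow> sat_tuple N (a @ map h \<beta>) \<phi>"
proof -
  define kf :: "'f \<Rightarrow> ('f + 'p) + ('f + 'p) tm" where "kf f = Inl (Inl f)" for f
  \<comment> \<open>From \<open>n + length \<beta>\<close> on the index into \<open>\<beta>\<close>
    would be out of range, while \<open>wf_tr\<close> asks for a well-formed term at every
    variable.\<close>
  define s :: "nat \<Rightarrow> ('f + 'p) tm" where "s v = (if v < n \<or> v \<ge> n + length \<beta> then Var v else App (Inr (\<beta> ! (v - n))) [])" for v
  define \<chi> where "\<chi> = tr kf s \<phi>"
  have wf: "wf_fm L \<phi>" and fv: "fv \<phi> \<subseteq> {..<n + length \<beta>}"
    using assms by (auto simp: formulas_def)
  show thesis
  proof (rule that)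
    have "wf_tm (with_params L A) (s v)" for v
      using assms(2) by (auto simp: s_def with_params_def)
    then have "wf_fm (with_params L A) \<chi>" unfolding \<chi>_def
      by (intro wf_tr[OF _ _ _ _ wf]) (auto simp: with_params_def kf_def)
    moreover have "fv \<chi> \<subseteq> tr_fv kf s (set1_fm \<phi>) (fv \<phi>)" unfolding \<chi>_def by (rule fv_tr)
    moreover have "\<dots> \<subseteq> {..<n}"
      using fv by (auto simp: tr_fv_def kf_def s_def split: if_splits)
    ultimately show "\<chi> \<in> formulas (with_params L A) n" by (auto simp: formulas_def)
    fix N :: "('f, 'r, 'm) struct" and h and a :: "'m list"
    assume a: "length a = n"
    have "sat_tuple (expand N h) a \<chi> \<longleftrightarrow> sat N (\<lambda>v. eval_tm (expand N h) ((!) a) (s v)) \<phi>"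
      unfolding \<chi>_def by (rule sat_tr) (simp_all add: expand_def kf_def)
    also have "\<dots> \<longleftrightarrow> sat_tuple N (a @ map h \<beta>) \<phi>"
    proof (rule sat_cong)
      fix v assume "v \<in> fv \<phi>"
      then have "v < n + length \<beta>" using fv by auto
      then show "eval_tm (expand N h) ((!) a) (s v) = (a @ map h \<beta>) ! v"
        using a by (auto simp: s_def expand_def nth_append)
    qed
    finally show "sat_tuple (expand N h) a \<chi> \<longleftrightarrow> sat_tuple N (a @ map h \<beta>) \<phi>" .
  qed
qed

section \<open>Definable relations\<close>

text \<open>Relations are taken uniformly over all structures on \<open>'m\<close>. Their closure
  properties replace writing formulas down, and a definable relation is carried along total and
  partial elementary maps and, if it is a sentence, by completeness.\<close>

definition dfn ::
  "('f, 'r) lang \<Rightarrow> nat \<Rightarrow> (('f, 'r, 'm) struct \<Rightarrow> 'm list \<Rightarrow> bool) \<Rightarrow> bool" where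
  "dfn L K R \<longleftrightarrow> (\<exists>\<phi> \<in> formulas L K. \<forall>N. \<forall>a \<in> tuples N K. R N a \<longleftrightarrow> sat_tuple N a \<phi>)"

lemma dfn_cong:
  "dfn L K R \<Longrightarrow> (\<And>N a. a \<in> tuples N K \<Longrightarrow> R' N a \<longleftrightarrow> R N a) \<Longrightarrow> dfn L K R'"
  unfolding dfn_def by fastforce

lemma dfn_formula: "\<phi> \<in> formulas L K \<Longrightarrow> dfn L K (\<lambda>N a. sat_tuple N a \<phi>)"
  unfolding dfn_def by blast

lemma dfn_not: "dfn L K R \<Longrightarrow> dfn L K (\<lambda>N a. \<not> R N a)"
  unfolding dfn_def
proof (elim bexE)
  fix \<phi> assume "\<phi> \<in> formulas L K" "\<forall>N. \<forall>a \<in> tuples N K. R N a \<longleftrightarrow> sat_tuple N a \<phi>"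
  then show "\<exists>\<phi>\<in>formulas L K. \<forall>N. \<forall>a\<in>tuples N K. (\<not> R N a) \<longleftrightarrow> sat_tuple N a \<phi>"
    by (intro bexI[of _ "Neg \<phi>"]) (auto simp: formulas_def)
qed

lemma dfn_conj: "dfn L K R \<Longrightarrow> dfn L K S \<Longrightarrow> dfn L K (\<lambda>N a. R N a \<and> S N a)"
  unfolding dfn_def
proof (elim bexE)
  fix \<phi> \<psi> assume "\<phi> \<in> formulas L K" "\<forall>N. \<forall>a \<in> tuples N K. R N a \<longleftrightarrow> sat_tuple N a \<phi>"
    "\<psi> \<in> formulas L K" "\<forall>N. \<forall>a \<in> tuples N K. S N a \<longleftrightarrow> sat_tuple N a \<psi>"
  then show "\<exists>\<phi>\<in>formulas L K. \<forall>N. \<forall>a\<in>tuples N K. (R N a \<and> S N a) \<longleftrightarrow> sat_tuple N a \<phi>"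
    by (intro bexI[of _ "And \<phi> \<psi>"]) (auto simp: formulas_def)
qed

lemma dfn_imp: "dfn L K R \<Longrightarrow> dfn L K S \<Longrightarrow> dfn L K (\<lambda>N a. R N a \<longrightarrow> S N a)"
  by (rule dfn_cong[OF dfn_not[OF dfn_conj[OF _ dfn_not]]]) auto

lemma dfn_const: "dfn L K (\<lambda>N a. P)"
proof -
  \<comment> \<open>\<open>dfn\<close> also ranges over structures with empty domain, where \<tau>
    fails. So truth is obtained as the negation of a contradiction and not as \<tau> itself.\<close>
  define \<tau> :: "('a, 'b) fm" where "\<tau> = Exists 0 (Equal (Var 0) (Var 0))"
  have "dfn L K (\<lambda>N a. sat_tuple N a \<tau>)"
    by (rule dfn_formula) (auto simp: formulas_def \<tau>_def)
  then have *: "dfn L K (\<lambda>N a. sat_tuple N a \<tau> \<and> \<not> sat_tuple N a \<tau>)" by (intro dfn_conj dfn_not)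
  show ?thesis
  proof (cases P)
    case True
    then show ?thesis using dfn_not[OF *] by simp
  next
    case False
    then show ?thesis using * by simp
  qed
qed

lemma dfn_ball:
  "finite I \<Longrightarrow> (\<And>i. i \<in> I \<Longrightarrow> dfn L K (R i)) \<Longrightarrow> dfn L K (\<lambda>N a. \<forall>i\<in>I. R i N a)"
proof (induction I rule: finite_induct)
  case (insert i I)
  then show ?case using dfn_conj[of L K "R i" "\<lambda>N a. \<forall>i\<in>I. R i N a"] by simp
qed (simp add: dfn_const)

lemma dfn_ex1:
  fixes R :: "('f, 'r, 'm) struct \<Rightarrow> 'm list \<Rightarrow> bool"
  assumes "dfn L (Suc K) R"
  shows "dfn L K (\<lambda>N a. \<exists>x\<in>Dom N. R N (a @ [x]))"
proof -
  obtain \<phi> where \<phi>: "\<phi> \<in> formulas L (Suc K)"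
    "\<And>N a. a \<in> tuples N (Suc K) \<Longrightarrow> R N a \<longleftrightarrow> sat_tuple N a \<phi>"
    using assms unfolding dfn_def by blast
  have "sat N (((!) a)(K := x)) \<phi> \<longleftrightarrow> R N (a @ [x])"
    if "a \<in> tuples N K" "x \<in> Dom N" for N :: "('f, 'r, 'm) struct" and a x
  proof -
    have "a @ [x] \<in> tuples N (Suc K)" using that by (auto simp: tuples_def)
    then show ?thesis using \<phi>(2)[of "a @ [x]" N] that
      by (subst formulas_sat_cong[OF \<phi>(1), of _ "(!) (a @ [x])"])
        (auto simp: nth_append tuples_def less_Suc_eq)
  qed
  moreover have "Exists K \<phi> \<in> formulas L K" using \<phi>(1) by (auto simp: formulas_def)
  ultimately show ?thesis unfolding dfn_def
    by (intro bexI[of _ "Exists K \<phi>"]) auto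
qed

lemma dfn_ex:
  fixes R :: "('f, 'r, 'm) struct \<Rightarrow> 'm list \<Rightarrow> bool"
  shows "dfn L (K + m) R \<Longrightarrow> dfn L K (\<lambda>N a. \<exists>b\<in>tuples N m. R N (a @ b))"
proof (induction m arbitrary: R)
  case 0
  then show ?case by (rule_tac dfn_cong) (auto simp: tuples_def)
next
  case (Suc m)
  have "dfn L K (\<lambda>N a. \<exists>b\<in>tuples N m. \<exists>x\<in>Dom N. R N ((a @ b) @ [x]))"
    by (rule Suc.IH, rule dfn_ex1) (use Suc.prems in simp)
  moreover have "(\<exists>b\<in>tuples N (Suc m). Q b) \<longleftrightarrow> (\<exists>b\<in>tuples N m. \<exists>x\<in>Dom N. Q (b @ [x]))"
    for N :: "('f, 'r, 'm) struct" and Q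
  proof
    assume "\<exists>b\<in>tuples N (Suc m). Q b"
    then obtain b where b: "b \<in> tuples N (Suc m)" "Q b" by blast
    then have "b \<noteq> []" by (auto simp: tuples_def)
    then obtain c x where "b = c @ [x]" by (metis rev_exhaust)
    then show "\<exists>b\<in>tuples N m. \<exists>x\<in>Dom N. Q (b @ [x])" using b by (auto simp: tuples_def)
  next
    assume "\<exists>b\<in>tuples N m. \<exists>x\<in>Dom N. Q (b @ [x])"
    then obtain b x where "b \<in> tuples N m" "x \<in> Dom N" "Q (b @ [x])" by blast
    then show "\<exists>b\<in>tuples N (Suc m). Q b" by (intro bexI[of _ "b @ [x]"]) (auto simp: tuples_def)
  qed
  ultimately show ?case by simp
qed

lemma dfn_all:
  "dfn L (K + m) R \<Longrightarrow> dfn L K (\<lambda>N a. \<forall>b\<in>tuples N m. R N (a @ b))"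
  by (rule dfn_cong[OF dfn_not[OF dfn_ex[OF dfn_not]]]) auto

text \<open>Substituting variables for variables permutes, repeats or drops coordinates. The
  relations below are assembled in this way from pieces of one long tuple.\<close>

lemma dfn_map:
  fixes R :: "('f, 'r, 'm) struct \<Rightarrow> 'm list \<Rightarrow> bool"
  assumes "dfn L K R" "length s = K" "\<And>i. i \<in> set s \<Longrightarrow> i < K'"
  shows "dfn L K' (\<lambda>N a. R N (map ((!) a) s))"
proof -
  obtain \<phi> where \<phi>: "\<phi> \<in> formulas L K"
    "\<And>N a. a \<in> tuples N K \<Longrightarrow> R N a \<longleftrightarrow> sat_tuple N a \<phi>"
    using assms unfolding dfn_def by blast
  define \<psi> where "\<psi> = tr Inl (\<lambda>v. Var (if v < K then s ! v else v)) \<phi>"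
  have "wf_fm L \<psi>" unfolding \<psi>_def by (rule wf_tr[of L]) (use \<phi> in \<open>auto simp: formulas_def\<close>)
  moreover have "fv \<psi> \<subseteq> tr_fv Inl (\<lambda>v. Var (if v < K then s ! v else v)) (set1_fm \<phi>) (fv \<phi>)"
    unfolding \<psi>_def by (rule fv_tr)
  moreover have "\<dots> \<subseteq> {..<K'}" using \<phi>(1) assms by (auto simp: tr_fv_def formulas_def)
  ultimately have "\<psi> \<in> formulas L K'" by (auto simp: formulas_def)
  moreover have "R N (map ((!) a) s) \<longleftrightarrow> sat_tuple N a \<psi>"
    if "a \<in> tuples N K'" for N :: "('f, 'r, 'm) struct" and a
  proof -
    have "map ((!) a) s \<in> tuples N K" using that assms by (auto simp: tuples_def)
    then have "R N (map ((!) a) s) \<longleftrightarrow> sat_tuple N (map ((!) a) s) \<phi>" by (rule \<phi>(2))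
    also have "\<dots> \<longleftrightarrow> sat N (\<lambda>v. eval_tm N ((!) a) (Var (if v < K then s ! v else v))) \<phi>"
      using assms(2) by (intro formulas_sat_cong[OF \<phi>(1)]) auto
    also have "\<dots> \<longleftrightarrow> sat_tuple N a \<psi>" unfolding \<psi>_def by (rule sat_tr[symmetric]) auto
    finally show ?thesis .
  qed
  ultimately show ?thesis unfolding dfn_def by blast
qed

lemma dfn_rearrange:
  assumes "dfn L K R" "length s = K" "\<And>i. i \<in> set s \<Longrightarrow> i < K'"
    "\<And>a. length a = K' \<Longrightarrow> f a = map ((!) a) s"
  shows "dfn L K' (\<lambda>N a. R N (f a))"
  by (rule dfn_cong[OF dfn_map[OF assms(1-3)]]) (auto simp: tuples_def assms(4))

section \<open>Elementary maps\<close>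

lemma elem_emb_sat:
  assumes "elem_emb L f M N" "\<phi> \<in> formulas L K" "a \<in> tuples M K"
  shows "sat_tuple N (map f a) \<phi> \<longleftrightarrow> sat_tuple M a \<phi>"
proof -
  obtain m where m: "m \<in> Dom M" using assms(1) unfolding elem_emb_def is_struct_def by auto
  \<comment> \<open>\<open>elem_emb\<close> speaks of assignments with values in the domain, whereas
    \<open>(!) a\<close> is unspecified beyond the length of \<open>a\<close>; hence the padding by
    \<open>m\<close>.\<close>
  define e where "e v = (if v < K then a ! v else m)" for v
  have "range e \<subseteq> Dom M" using m assms(3) by (auto simp: e_def tuples_def)
  then have *: "sat M e \<phi> \<longleftrightarrow> sat N (f \<circ> e) \<phi>"
    using assms(1,2) unfolding elem_emb_def formulas_def by blast
  have "sat_tuple N (map f a) \<phi> \<longleftrightarrow> sat N (f \<circ> e) \<phi>"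
    using assms(3) by (intro formulas_sat_cong[OF assms(2)]) (auto simp: e_def tuples_def)
  also have "\<dots> \<longleftrightarrow> sat_tuple M a \<phi>" unfolding *[symmetric]
    by (intro formulas_sat_cong[OF assms(2)]) (auto simp: e_def)
  finally show ?thesis .
qed

lemma elem_emb_struct: "elem_emb L f M N \<Longrightarrow> is_struct L M \<and> is_struct L N"
  by (simp add: elem_emb_def)

lemma elem_emb_tuples: "elem_emb L f M N \<Longrightarrow> a \<in> tuples M K \<Longrightarrow> map f a \<in> tuples N K"
  by (auto simp: elem_emb_def tuples_def)

lemma elem_emb_dfn:
  assumes "elem_emb L f M N" "dfn L K R" "a \<in> tuples M K"
  shows "R N (map f a) \<longleftrightarrow> R M a"
proof -
  obtain \<phi> where \<phi>: "\<phi> \<in> formulas L K" "\<And>N a. a \<in> tuples N K \<Longrightarrow> R N a \<longleftrightarrow> sat_tuple N a \<phi>"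
    using assms(2) unfolding dfn_def by blast
  show ?thesis
    using \<phi>(2)[OF assms(3)] \<phi>(2)[OF elem_emb_tuples[OF assms(1,3)]] elem_emb_sat[OF assms(1) \<phi>(1) assms(3)]
    by simp
qed

lemma elem_sub_tuples: "elem_sub L M N \<Longrightarrow> tuples M n \<subseteq> tuples N n"
  by (auto simp: elem_sub_def elem_emb_def tuples_def)

lemma elem_sub_Dom: "elem_sub L M N \<Longrightarrow> Dom M \<subseteq> Dom N"
  by (auto simp: elem_sub_def elem_emb_def)

lemma elem_sub_sat:
  "elem_sub L M N \<Longrightarrow> \<phi> \<in> formulas L K \<Longrightarrow> a \<in> tuples M K \<Longrightarrow> sat_tuple N a \<phi> \<longleftrightarrow> sat_tuple M a \<phi>"
  using elem_emb_sat[of L id M N \<phi> K a] by (simp add: elem_sub_def)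

lemma model_elem_emb:
  assumes "T \<subseteq> sentences L" "model L T M" "elem_emb L f M N"
  shows "model L T N"
proof -
  have "sat_tuple N [] \<phi>" if "\<phi> \<in> T" for \<phi>
    using elem_emb_sat[OF assms(3), of \<phi> 0 "[]"] assms(1,2) that
    by (auto simp: model_def tuples_def)
  then show ?thesis using assms elem_emb_struct[OF assms(3)] by (simp add: model_def)
qed

lemma complete_sat:
  fixes M N :: "('f, 'r, 'm) struct"
  assumes "complete_theory TYPE('m) L T" "model L T M" "model L T N" "\<phi> \<in> sentences L"
  shows "sat_tuple M [] \<phi> \<longleftrightarrow> sat_tuple N [] \<phi>"
  using assms unfolding complete_theory_def by (meson sat.simps(3))

lemma complete_dfn:
  fixes M N :: "('f, 'r, 'm) struct"
  assumes "complete_theory TYPE('m) L T" "model L T M" "model L T N" "dfn L 0 R"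
  shows "R M [] \<longleftrightarrow> R N []"
proof -
  obtain \<phi> where \<phi>: "\<phi> \<in> sentences L" "\<And>(N :: ('f, 'r, 'm) struct) a. a \<in> tuples N 0 \<Longrightarrow> R N a \<longleftrightarrow> sat_tuple N a \<phi>"
    using assms(4) unfolding dfn_def by blast
  show ?thesis using \<phi>(2)[of "[]" M] \<phi>(2)[of "[]" N] complete_sat[OF assms(1-3) \<phi>(1)]
    by (simp add: tuples_def)
qed

section \<open>Partial elementary maps\<close>

text \<open>For \<open>U = {}\<close> this is elementary equivalence of \<open>M\<close> and
  \<open>N\<close>, from which the recursion along the chain starts.\<close>

definition pelem ::
  "('f, 'r) lang \<Rightarrow> ('f, 'r, 'm) struct \<Rightarrow> ('f, 'r, 'n) struct \<Rightarrow> 'm set \<Rightarrow> ('m \<Rightarrow> 'n) \<Rightarrow> bool" where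
  "pelem L M N U g \<longleftrightarrow> U \<subseteq> Dom M \<and> g ` U \<subseteq> Dom N \<and>
     (\<forall>a. set a \<subseteq> U \<longrightarrow> (\<forall>\<phi> \<in> formulas L (length a). sat_tuple N (map g a) \<phi> \<longleftrightarrow> sat_tuple M a \<phi>))"

lemma pelem_dfn:
  assumes "pelem L M N U g" "dfn L K R" "set a \<subseteq> U" "length a = K"
  shows "R N (map g a) \<longleftrightarrow> R M a"
proof -
  obtain \<phi> where \<phi>: "\<phi> \<in> formulas L K" "\<And>N a. a \<in> tuples N K \<Longrightarrow> R N a \<longleftrightarrow> sat_tuple N a \<phi>"
    using assms(2) unfolding dfn_def by blast
  have "a \<in> tuples M K" "map g a \<in> tuples N K" using assms by (auto simp: tuples_def pelem_def)
  then show ?thesis using \<phi> assms unfolding pelem_def by metis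
qed

lemma pelem_subset: "pelem L M N U g \<Longrightarrow> V \<subseteq> U \<Longrightarrow> pelem L M N V g"
  unfolding pelem_def by (meson image_mono order_trans)

lemma pelem_cong: "pelem L M N U g \<Longrightarrow> (\<And>u. u \<in> U \<Longrightarrow> g' u = g u) \<Longrightarrow> pelem L M N U g'"
  unfolding pelem_def
  by (smt (verit, best) image_cong map_idI map_eq_conv subset_iff)

lemma pelem_comp_emb:
  assumes "pelem L M N U g" "elem_emb L f N N'"
  shows "pelem L M N' U (f \<circ> g)"
  unfolding pelem_def
proof (intro conjI allI impI ballI)
  show "U \<subseteq> Dom M" using assms(1) by (simp add: pelem_def)
  show "(f \<circ> g) ` U \<subseteq> Dom N'" using assms by (force simp: pelem_def elem_emb_def)
  fix a \<phi> assume a: "set a \<subseteq> U" and \<phi>: "\<phi> \<in> formulas L (length a)"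
  have "map g a \<in> tuples N (length a)" using assms(1) a by (auto simp: pelem_def tuples_def)
  from elem_emb_sat[OF assms(2) \<phi> this]
  show "sat_tuple N' (map (f \<circ> g) a) \<phi> \<longleftrightarrow> sat_tuple M a \<phi>"
    using assms(1) a \<phi> by (simp add: pelem_def)
qed

lemma pelemI_finite:
  assumes "\<And>F. finite F \<Longrightarrow> F \<subseteq> U \<Longrightarrow> pelem L M N F g"
  shows "pelem L M N U g"
  unfolding pelem_def
proof (intro conjI allI impI ballI subsetI)
  fix u assume "u \<in> U"
  then show "u \<in> Dom M" using assms[of "{u}"] by (auto simp: pelem_def)
next
  fix x assume "x \<in> g ` U"
  then obtain u where "u \<in> U" "x = g u" by blast
  then show "x \<in> Dom N" using assms[of "{u}"] by (auto simp: pelem_def)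
next
  fix a \<phi> assume "set a \<subseteq> U" "\<phi> \<in> formulas L (length a)"
  then show "sat_tuple N (map g a) \<phi> \<longleftrightarrow> sat_tuple M a \<phi>"
    using assms[of "set a"] by (auto simp: pelem_def)
qed

text \<open>The entries of \<open>\<beta>\<close> lie in \<open>B\<close>, so they can be turned
  into constants, and the formula becomes a member of one of the two equal types or of
  neither.\<close>

lemma type_eq_sat:
  fixes N :: "('f, 'r, 'm) struct"
  assumes "type_of L N B c = type_of L N B b" "length c = length b"
    and "\<phi> \<in> formulas L (length b + length \<beta>)" "set \<beta> \<subseteq> B"
  shows "sat_tuple N (c @ \<beta>) \<phi> \<longleftrightarrow> sat_tuple N (b @ \<beta>) \<phi>"
proof -
  obtain \<chi> where \<chi>: "\<chi> \<in> formulas (with_params L B) (length b)"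
    "\<And>(N :: ('f, 'r, 'm) struct) h a. length a = length b \<Longrightarrow>
       sat_tuple (expand N h) a \<chi> \<longleftrightarrow> sat_tuple N (a @ map h \<beta>) \<phi>"
    using param[OF assms(3,4), where 'm = 'm] by metis
  have "\<chi> \<in> type_of L N B c \<longleftrightarrow> \<chi> \<in> type_of L N B b" using assms(1) by simp
  then show ?thesis using \<chi> assms(2) by (simp add: type_of_def)
qed

section \<open>Compactness\<close>

text \<open>Zorn gives a maximal family of predicates with the finite intersection property. If it
  contained neither \<open>P\<close> nor its negation, finite subfamilies would refute both, and
  their union would be inconsistent.\<close>

lemma ultrafilter_exists:
  fixes G :: "('i \<Rightarrow> bool) set"
  assumes fip: "\<And>X. X \<subseteq> G \<Longrightarrow> finite X \<Longrightarrow> \<exists>i. \<forall>P\<in>X. P i"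
  obtains U :: "'i filter" where "U \<noteq> bot" "\<And>P. P \<in> G \<Longrightarrow> eventually P U"
    "\<And>P. eventually P U \<or> eventually (\<lambda>i. \<not> P i) U"
proof -
  define A where "A = {H. G \<subseteq> H \<and> (\<forall>X. X \<subseteq> H \<longrightarrow> finite X \<longrightarrow> (\<exists>i. \<forall>P\<in>X. P i))}"
  have "\<exists>M\<in>A. \<forall>X\<in>A. M \<subseteq> X \<longrightarrow> X = M"
  proof (rule subset_Zorn_nonempty)
    show "A \<noteq> {}" using fip by (auto simp: A_def)
    fix C assume C: "C \<noteq> {}" "subset.chain A C"
    have "\<exists>i. \<forall>P\<in>X. P i" if X: "X \<subseteq> \<Union>C" "finite X" for X
    proof -
      obtain H where "H \<in> C" "X \<subseteq> H"
        by (rule finite_subset_Union_chain[OF X(2,1) C])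
      moreover have "H \<in> A" using C(2) \<open>H \<in> C\<close> unfolding subset_chain_def by auto
      ultimately show ?thesis using X(2) unfolding A_def by simp
    qed
    moreover have "G \<subseteq> \<Union>C"
    proof -
      obtain H where "H \<in> C" using C(1) by auto
      then have "H \<in> A" using C(2) unfolding subset_chain_def by auto
      then show ?thesis using \<open>H \<in> C\<close> unfolding A_def by auto
    qed
    ultimately show "\<Union>C \<in> A" by (auto simp: A_def)
  qed
  then obtain H where H: "H \<in> A" and max: "\<And>X. X \<in> A \<Longrightarrow> H \<subseteq> X \<Longrightarrow> X = H" by auto
  have fipH: "\<exists>i. \<forall>P\<in>X. P i" if "X \<subseteq> H" "finite X" for X
    using H that by (auto simp: A_def)
  have incons: "\<exists>X. X \<subseteq> H \<and> finite X \<and> (\<forall>i. (\<forall>Q\<in>X. Q i) \<longrightarrow> \<not> P i)" if "P \<notin> H" for P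
  proof -
    have "insert P H \<notin> A" using max[of "insert P H"] that by blast
    moreover have "G \<subseteq> insert P H" using H unfolding A_def by auto
    ultimately obtain Y where Y: "Y \<subseteq> insert P H" "finite Y" "\<not> (\<exists>i. \<forall>Q\<in>Y. Q i)"
      unfolding A_def by auto
    have "\<forall>i. (\<forall>Q\<in>Y - {P}. Q i) \<longrightarrow> \<not> P i" using Y(3) by (metis Diff_iff singletonD)
    then show ?thesis using Y by (intro exI[of _ "Y - {P}"]) auto
  qed
  have ultra: "P \<in> H \<or> (\<lambda>i. \<not> P i) \<in> H" for P
  proof (rule ccontr)
    assume "\<not> ?thesis"
    then have P: "P \<notin> H" "(\<lambda>i. \<not> P i) \<notin> H" by auto
    obtain X where X: "X \<subseteq> H" "finite X" "\<forall>i. (\<forall>Q\<in>X. Q i) \<longrightarrow> \<not> P i"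
      using incons[OF P(1)] by (elim exE conjE)
    obtain Y where Y: "Y \<subseteq> H" "finite Y" "\<forall>i. (\<forall>Q\<in>Y. Q i) \<longrightarrow> \<not> \<not> P i"
      using incons[OF P(2)] by (elim exE conjE)
    obtain i where "\<forall>Q\<in>X \<union> Y. Q i" using fipH[of "X \<union> Y"] X Y by auto
    then show False using X(3) Y(3) by auto
  qed
  define U where "U = (INF P\<in>H. principal {i. P i})"
  have U: "eventually P U" if "P \<in> H" for P
    unfolding U_def using that by (rule eventually_INF1) (simp add: eventually_principal)
  show thesis
  proof (rule that)
    show "U \<noteq> bot" unfolding U_def
    proof (rule INF_filter_not_bot)
      fix X assume "X \<subseteq> H" "finite X"
      then show "(INF P\<in>X. principal {i. P i}) \<noteq> bot"
        using fipH[of X] by (auto simp: INF_principal_finite principal_eq_bot_iff)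
    qed
    show "eventually P U" if "P \<in> G" for P using that H U by (auto simp: A_def)
    show "eventually P U \<or> eventually (\<lambda>i. \<not> P i) U" for P
      using ultra[of P] U by blast
  qed
qed

lemma nat_ordLeq: "Cinfinite lam \<Longrightarrow> |UNIV :: nat set| \<le>o lam"
  using card_of_nat natLeq_ordLeq_cinfinite ordIso_ordLeq_trans by blast

lemma UNION_ordLeq:
  "Cinfinite lam \<Longrightarrow> |I| \<le>o lam \<Longrightarrow> (\<And>i. i \<in> I \<Longrightarrow> |A i| \<le>o lam) \<Longrightarrow> |\<Union>i\<in>I. A i| \<le>o lam"
  by (rule card_of_UNION_ordLeq_infinite_Field) (auto simp: cinfinite_def)

lemma Times_ordLeq: "Cinfinite lam \<Longrightarrow> |A| \<le>o lam \<Longrightarrow> |B| \<le>o lam \<Longrightarrow> |A \<times> B| \<le>o lam"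
  by (rule card_of_Sigma_ordLeq_infinite_Field) (auto simp: cinfinite_def)

lemma Un_ordLeq: "Cinfinite lam \<Longrightarrow> |A| \<le>o lam \<Longrightarrow> |B| \<le>o lam \<Longrightarrow> |A \<union> B| \<le>o lam"
  by (rule card_of_Un_ordLeq_infinite_Field) (auto simp: cinfinite_def)

lemma image_ordLeq: "|A| \<le>o lam \<Longrightarrow> |f ` A| \<le>o lam"
  using card_of_image ordLeq_transitive by blast

lemma finite_ordLeq: "Cinfinite lam \<Longrightarrow> finite A \<Longrightarrow> |A| \<le>o lam"
  by (metis cinfinite_def finite_iff_ordLess_natLeq natLeq_ordLeq_cinfinite ordLess_imp_ordLeq ordLeq_transitive)

lemma lists_ordLeq:
  assumes lam: "Cinfinite lam" and A: "|A| \<le>o lam"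
  shows "|lists A| \<le>o lam"
proof -
  have "|{xs \<in> lists A. length xs = n}| \<le>o lam" for n
  proof (induction n)
    case 0
    have "{xs \<in> lists A. length xs = 0} = {[]}" by auto
    then show ?case using finite_ordLeq[OF lam, of "{[] :: 'b list}"] by simp
  next
    case (Suc n)
    have "{xs \<in> lists A. length xs = Suc n} = (\<lambda>(x, xs). x # xs) ` (A \<times> {xs \<in> lists A. length xs = n})"
      by (force simp: length_Suc_conv)
    then show ?case using image_ordLeq[OF Times_ordLeq[OF lam A Suc]] by simp
  qed
  then have "|\<Union>n. {xs \<in> lists A. length xs = n}| \<le>o lam"
    by (rule UNION_ordLeq[OF lam nat_ordLeq[OF lam]])
  moreover have "(\<Union>n. {xs \<in> lists A. length xs = n}) = lists A" by auto
  ultimately show ?thesis by simp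
qed

section \<open>Skolem hulls in powers and ultrapowers\<close>

text \<open>The hull is formed in the power of \<open>M\<close>, before any quotient, since only at
  most \<open>lam\<close> elements may have to find room in \<open>'m\<close>. A witness is chosen
  at all coordinates at once, so an existential statement true at many coordinates has its witness
  in \<open>S\<close>.\<close>

lemma skolem_hull:
  fixes M :: "('f, 'r, 'm) struct" and B :: "('i \<Rightarrow> 'm) set"
  assumes M: "is_struct L M" and lam: "Cinfinite lam" and L: "theory_card L \<le>o lam"
    and B: "|B| \<le>o lam" "\<forall>f\<in>B. \<forall>i. f i \<in> Dom M"
  obtains S where "B \<subseteq> S" "|S| \<le>o lam" "\<And>f i. f \<in> S \<Longrightarrow> f i \<in> Dom M"
    "\<And>\<phi> e x. wf_fm L \<phi> \<Longrightarrow> range e \<subseteq> S \<Longrightarrow>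
      \<exists>g\<in>S. \<forall>i. (\<exists>a\<in>Dom M. sat M ((\<lambda>v. e v i)(x := a)) \<phi>) \<longrightarrow> sat M ((\<lambda>v. e v i)(x := g i)) \<phi>"
proof -
  obtain m0 where m0: "m0 \<in> Dom M" using M unfolding is_struct_def by auto
  \<comment> \<open>Only the values at the free variables matter to a Skolem function, so finite
    lists padded by \<open>m0\<close> suffice and each stage adds at most \<open>lam\<close>
    functions.\<close>
  define env where "env xs i = (\<lambda>v. if v < length xs then (xs ! v) i else m0)"
    for xs :: "('i \<Rightarrow> 'm) list" and i
  define sk where "sk = (\<lambda>(\<phi>, x, xs) i. if \<exists>a\<in>Dom M. sat M ((env xs i)(x := a)) \<phi>
    then SOME a. a \<in> Dom M \<and> sat M ((env xs i)(x := a)) \<phi> else m0)"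
  define S where "S = rec_nat B (\<lambda>_ X. X \<union> sk ` ({\<phi>. wf_fm L \<phi>} \<times> UNIV \<times> lists X))"
  have S0: "S 0 = B" and SSuc: "S (Suc n) = S n \<union> sk ` ({\<phi>. wf_fm L \<phi>} \<times> UNIV \<times> lists (S n))" for n
    by (simp_all add: S_def)
  have mono: "i \<le> j \<Longrightarrow> S i \<subseteq> S j" for i j by (rule lift_Suc_mono_le[of S]) (simp_all add: SSuc)
  have sk: "sk (\<phi>, x, xs) i \<in> Dom M \<and>
      ((\<exists>a\<in>Dom M. sat M ((env xs i)(x := a)) \<phi>) \<longrightarrow> sat M ((env xs i)(x := sk (\<phi>, x, xs) i)) \<phi>)" for \<phi> x xs i
  proof (cases "\<exists>a\<in>Dom M. sat M ((env xs i)(x := a)) \<phi>")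
    case True
    then have "\<exists>a. a \<in> Dom M \<and> sat M ((env xs i)(x := a)) \<phi>" by blast
    from someI_ex[OF this] show ?thesis using True by (simp add: sk_def)
  qed (auto simp: sk_def m0)
  have Dom: "f i \<in> Dom M" if "f \<in> S n" for f i n
    using that by (induction n arbitrary: f) (use B sk in \<open>auto simp: S0 SSuc\<close>)
  have card: "|S n| \<le>o lam" for n
  proof (induction n)
    case (Suc n)
    show ?case unfolding SSuc
      by (intro Un_ordLeq lam Suc image_ordLeq Times_ordLeq nat_ordLeq lists_ordLeq
          L[unfolded theory_card_def])
  qed (simp add: S0 B)
  show thesis
  proof (rule that[of "\<Union>n. S n"])
    show "B \<subseteq> (\<Union>n. S n)" using S0 by blast
    show "|\<Union>n. S n| \<le>o lam" by (rule UNION_ordLeq[OF lam nat_ordLeq[OF lam] card])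
    show "\<And>f i. f \<in> (\<Union>n. S n) \<Longrightarrow> f i \<in> Dom M" using Dom by blast
    fix \<phi> :: "('f, 'r) fm" and e :: "nat \<Rightarrow> 'i \<Rightarrow> 'm" and x :: nat assume \<phi>: "wf_fm L \<phi>" and e: "range e \<subseteq> (\<Union>n. S n)"
    obtain k where k: "\<And>v. v \<in> fv \<phi> \<Longrightarrow> v < k"
      using finite_nat_set_iff_bounded[of "fv \<phi>"] finite_fv by blast
    define xs where "xs = map e [0..<k]"
    have "\<exists>n. \<forall>v<k. e v \<in> S n"
    proof (induction k)
      case (Suc k)
      then obtain n where n: "\<forall>v<k. e v \<in> S n" by blast
      obtain n' where n': "e k \<in> S n'" using e by blast
      show ?case using n n' mono[of n "max n n'"] mono[of n' "max n n'"]
        by (intro exI[of _ "max n n'"]) (auto simp: less_Suc_eq)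
    qed simp
    then obtain n where n: "\<forall>v<k. e v \<in> S n" by blast
    then have "(\<phi>, x, xs) \<in> {\<phi>. wf_fm L \<phi>} \<times> UNIV \<times> lists (S n)" using \<phi> by (auto simp: xs_def)
    then have "sk (\<phi>, x, xs) \<in> S (Suc n)" unfolding SSuc by blast
    moreover have "sat M ((\<lambda>v. e v i)(x := a)) \<phi> \<longleftrightarrow> sat M ((env xs i)(x := a)) \<phi>" for i a
      by (rule sat_cong) (auto simp: env_def xs_def dest: k)
    ultimately show "\<exists>g\<in>\<Union>n. S n. \<forall>i. (\<exists>a\<in>Dom M. sat M ((\<lambda>v. e v i)(x := a)) \<phi>)
        \<longrightarrow> sat M ((\<lambda>v. e v i)(x := g i)) \<phi>"
      using sk by blast
  qed
qed

text \<open>Skolem hulls inside an ultrapower of \<open>M\<close>; \<open>\<pi>\<close> places the equivalence class of a sequence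
  into the universe.\<close>
locale ultrapower_hull =
  fixes L :: "('f, 'r) lang" and M :: "('f, 'r, 'm) struct" and U :: "'i filter"
    and S :: "('i \<Rightarrow> 'm) set" and \<pi> :: "('i \<Rightarrow> 'm) \<Rightarrow> 'm"
  assumes struct: "is_struct L M"
    and U: "U \<noteq> bot" "\<And>P. eventually P U \<or> eventually (\<lambda>i. \<not> P i) U"
    and S_Dom: "\<And>f i. f \<in> S \<Longrightarrow> f i \<in> Dom M"
    and S_skolem: "\<And>\<phi> e x. wf_fm L \<phi> \<Longrightarrow> range e \<subseteq> S \<Longrightarrow>
      \<exists>g\<in>S. \<forall>i. (\<exists>a\<in>Dom M. sat M ((\<lambda>v. e v i)(x := a)) \<phi>) \<longrightarrow> sat M ((\<lambda>v. e v i)(x := g i)) \<phi>"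
    and S_const: "\<And>m. m \<in> Dom M \<Longrightarrow> (\<lambda>_. m) \<in> S"
    and \<pi>_eq: "\<And>f g. f \<in> S \<Longrightarrow> g \<in> S \<Longrightarrow> \<pi> f = \<pi> g \<longleftrightarrow> (\<forall>\<^sub>F i in U. f i = g i)"
    and \<pi>_const: "\<And>m. m \<in> Dom M \<Longrightarrow> \<pi> (\<lambda>_. m) = m"
begin

definition rep :: "'m \<Rightarrow> 'i \<Rightarrow> 'm" where "rep = inv_into S \<pi>"

definition N :: "('f, 'r, 'm) struct" where
  "N = \<lparr>Dom = \<pi> ` S, Fun = \<lambda>f xs. \<pi> (\<lambda>i. Fun M f (map (\<lambda>x. rep x i) xs)),
     Rel = \<lambda>r xs. \<forall>\<^sub>F i in U. Rel M r (map (\<lambda>x. rep x i) xs)\<rparr>"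

lemma rep_S: "x \<in> \<pi> ` S \<Longrightarrow> rep x \<in> S"
  unfolding rep_def by (rule inv_into_into)

lemma \<pi>_rep: "x \<in> \<pi> ` S \<Longrightarrow> \<pi> (rep x) = x"
  unfolding rep_def by (rule f_inv_into_f[of x \<pi> S])

lemma rep_\<pi>: "f \<in> S \<Longrightarrow> \<forall>\<^sub>F i in U. rep (\<pi> f) i = f i"
  using \<pi>_eq[of "rep (\<pi> f)" f] rep_S[of "\<pi> f"] \<pi>_rep[of "\<pi> f"] by simp

lemma rep_map:
  assumes "\<And>t. t \<in> set ts \<Longrightarrow> h t \<in> S"
  shows "\<forall>\<^sub>F i in U. map (\<lambda>t. rep (\<pi> (h t)) i) ts = map (\<lambda>t. h t i) ts"
proof -
  have "\<forall>\<^sub>F i in U. \<forall>t\<in>set ts. rep (\<pi> (h t)) i = h t i"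
    by (intro eventually_ball_finite) (auto intro!: rep_\<pi> assms)
  then show ?thesis by (rule eventually_mono) simp
qed

text \<open>Closure under terms is not built into the hull. It follows from the formula
  \<open>x = t\<close> with \<open>x\<close> fresh, whose only witness at each coordinate is the
  value of \<open>t\<close>.\<close>

lemma eval_S:
  assumes "wf_tm L t" "range e \<subseteq> S"
  shows "(\<lambda>i. eval_tm M (\<lambda>v. e v i) t) \<in> S"
proof -
  define x where "x = fresh (fv_tm t)"
  have x: "x \<notin> fv_tm t" unfolding x_def by (intro fresh_notin finite_fv_tm)
  have eq: "eval_tm M ((\<lambda>v. e v i)(x := a)) t = eval_tm M (\<lambda>v. e v i) t" for i a
    by (rule eval_tm_cong) (use x in auto)
  have D: "eval_tm M (\<lambda>v. e v i) t \<in> Dom M" for i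
    by (rule eval_tm_in_Dom[OF struct assms(1)]) (use assms(2) S_Dom in blast)
  obtain g where "g \<in> S" "\<forall>i. (\<exists>a\<in>Dom M. sat M ((\<lambda>v. e v i)(x := a)) (Equal (Var x) t))
      \<longrightarrow> sat M ((\<lambda>v. e v i)(x := g i)) (Equal (Var x) t)"
    using S_skolem[of "Equal (Var x) t" e x] assms by auto
  then have "g = (\<lambda>i. eval_tm M (\<lambda>v. e v i) t)" using D eq by (intro ext) auto
  then show ?thesis using \<open>g \<in> S\<close> by (simp only:)
qed

lemma Fun_S:
  assumes "f \<in> Funs L" "length gs = farity L f" "set gs \<subseteq> S"
  shows "(\<lambda>i. Fun M f (map (\<lambda>g. g i) gs)) \<in> S"
proof -
  obtain m where m: "m \<in> Dom M" using struct unfolding is_struct_def by auto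
  define e where "e v = (if v < length gs then gs ! v else (\<lambda>_. m))" for v
  have "range e \<subseteq> S" using assms(3) S_const[OF m] by (auto simp: e_def)
  then have "(\<lambda>i. eval_tm M (\<lambda>v. e v i) (App f (map Var [0..<length gs]))) \<in> S"
    by (intro eval_S) (use assms in auto)
  moreover have "map (\<lambda>v. e v i) [0..<length gs] = map (\<lambda>g. g i) gs" for i
    by (rule nth_equalityI) (auto simp: e_def)
  ultimately show ?thesis by (simp add: comp_def)
qed

lemma eval_N:
  assumes "range e \<subseteq> S" "wf_tm L t"
  shows "eval_tm N (\<lambda>v. \<pi> (e v)) t = \<pi> (\<lambda>i. eval_tm M (\<lambda>v. e v i) t)"
  using assms(2)
proof (induction t)
  case (App f ts)
  define h where "h t i = eval_tm M (\<lambda>v. e v i) t" for t i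
  have hS: "h t \<in> S" if "t \<in> set ts" for t
    unfolding h_def by (rule eval_S[OF _ assms(1)]) (use App.prems that in simp)
  have IH: "map (eval_tm N (\<lambda>v. \<pi> (e v))) ts = map (\<lambda>t. \<pi> (h t)) ts"
    using App unfolding h_def by auto
  have "eval_tm N (\<lambda>v. \<pi> (e v)) (App f ts) = \<pi> (\<lambda>i. Fun M f (map (\<lambda>x. rep x i) (map (\<lambda>t. \<pi> (h t)) ts)))"
    by (simp only: eval_tm.simps IH) (simp add: N_def)
  also have "\<dots> = \<pi> (\<lambda>i. Fun M f (map (\<lambda>t. h t i) ts))"
  proof (subst \<pi>_eq)
    show "(\<lambda>i. Fun M f (map (\<lambda>x. rep x i) (map (\<lambda>t. \<pi> (h t)) ts))) \<in> S"
      using Fun_S[of f "map (\<lambda>t. rep (\<pi> (h t))) ts"] App.prems hS rep_S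
      by (auto simp: comp_def image_subset_iff)
    show "(\<lambda>i. Fun M f (map (\<lambda>t. h t i) ts)) \<in> S"
      using Fun_S[of f "map h ts"] App.prems hS by (auto simp: comp_def)
    show "\<forall>\<^sub>F i in U. Fun M f (map (\<lambda>x. rep x i) (map (\<lambda>t. \<pi> (h t)) ts)) = Fun M f (map (\<lambda>t. h t i) ts)"
      unfolding map_map comp_def
      by (rule eventually_mono[OF rep_map[of ts h]], erule hS) (erule arg_cong[where f = "Fun M f"])
  qed
  finally show ?case by (simp add: h_def comp_def)
qed simp

text \<open>The theorem of Los for the hull: \<open>S_skolem\<close> supplies in \<open>S\<close>
  the coordinatewise witness that a full ultrapower would take from all sequences, and negation uses
  that \<open>U\<close> is an ultrafilter.\<close>

lemma los:
  assumes "wf_fm L \<phi>" "range e \<subseteq> S"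
  shows "sat N (\<lambda>v. \<pi> (e v)) \<phi> \<longleftrightarrow> (\<forall>\<^sub>F i in U. sat M (\<lambda>v. e v i) \<phi>)"
  using assms
proof (induction \<phi> arbitrary: e)
  case (Equal s t)
  then have wf: "wf_tm L s" "wf_tm L t" and e: "range e \<subseteq> S" by auto
  show ?case unfolding sat.simps eval_N[OF e wf(1)] eval_N[OF e wf(2)]
    by (rule \<pi>_eq[OF eval_S[OF wf(1) e] eval_S[OF wf(2) e]])
next
  case (Pred r ts)
  define h where "h t i = eval_tm M (\<lambda>v. e v i) t" for t i
  have hS: "h t \<in> S" if "t \<in> set ts" for t
    unfolding h_def by (rule eval_S[OF _ Pred.prems(2)]) (use Pred.prems that in simp)
  have *: "map (eval_tm N (\<lambda>v. \<pi> (e v))) ts = map (\<lambda>t. \<pi> (h t)) ts"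
    using Pred.prems eval_N unfolding h_def by auto
  have "sat N (\<lambda>v. \<pi> (e v)) (Pred r ts) \<longleftrightarrow> (\<forall>\<^sub>F i in U. Rel M r (map (\<lambda>t. rep (\<pi> (h t)) i) ts))"
    unfolding sat.simps * by (simp add: N_def comp_def)
  also have "\<dots> \<longleftrightarrow> (\<forall>\<^sub>F i in U. Rel M r (map (\<lambda>t. h t i) ts))"
    by (rule eventually_subst) (rule eventually_mono[OF rep_map[of ts h, OF hS]], assumption, erule arg_cong[where f = "Rel M r"])
  finally show ?case by (simp add: h_def comp_def)
next
  case (Neg \<phi>)
  have "(\<forall>\<^sub>F i in U. \<not> sat M (\<lambda>v. e v i) \<phi>) \<longleftrightarrow> \<not> (\<forall>\<^sub>F i in U. sat M (\<lambda>v. e v i) \<phi>)"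
    using U(2)[of "\<lambda>i. sat M (\<lambda>v. e v i) \<phi>"] U(1) eventually_conj[of "\<lambda>i. sat M (\<lambda>v. e v i) \<phi>" U "\<lambda>i. \<not> sat M (\<lambda>v. e v i) \<phi>"]
    by (auto simp: trivial_limit_def)
  then show ?case using Neg.IH[of e] Neg.prems by simp
next
  case (And \<phi> \<psi>)
  show ?case using And.IH(1)[of e] And.IH(2)[of e] And.prems by (simp add: eventually_conj_iff)
next
  case (Exists x \<phi>)
  have upd: "(\<lambda>v. \<pi> (e v))(x := \<pi> g) = (\<lambda>v. \<pi> ((e(x := g)) v))" for g by auto
  have upd': "(\<lambda>v. (e(x := g)) v i) = (\<lambda>v. e v i)(x := g i)" for g i by auto
  have IH: "sat N ((\<lambda>v. \<pi> (e v))(x := \<pi> g)) \<phi> \<longleftrightarrow> (\<forall>\<^sub>F i in U. sat M ((\<lambda>v. e v i)(x := g i)) \<phi>)"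
    if "g \<in> S" for g
  proof -
    have "sat N (\<lambda>v. \<pi> ((e(x := g)) v)) \<phi> \<longleftrightarrow> (\<forall>\<^sub>F i in U. sat M (\<lambda>v. (e(x := g)) v i) \<phi>)"
      by (rule Exists.IH) (use Exists.prems that in auto)
    then show ?thesis by (simp only: upd[of g] upd'[of g])
  qed
  have "sat N (\<lambda>v. \<pi> (e v)) (Exists x \<phi>) \<longleftrightarrow> (\<exists>g\<in>S. \<forall>\<^sub>F i in U. sat M ((\<lambda>v. e v i)(x := g i)) \<phi>)"
  proof -
    have "Dom N = \<pi> ` S" by (simp add: N_def)
    then show ?thesis unfolding sat.simps using IH by auto
  qed
  also have "\<dots> \<longleftrightarrow> (\<forall>\<^sub>F i in U. \<exists>a\<in>Dom M. sat M ((\<lambda>v. e v i)(x := a)) \<phi>)"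
  proof
    assume "\<exists>g\<in>S. \<forall>\<^sub>F i in U. sat M ((\<lambda>v. e v i)(x := g i)) \<phi>"
    then show "\<forall>\<^sub>F i in U. \<exists>a\<in>Dom M. sat M ((\<lambda>v. e v i)(x := a)) \<phi>"
      using S_Dom by (auto elim!: eventually_mono)
  next
    assume *: "\<forall>\<^sub>F i in U. \<exists>a\<in>Dom M. sat M ((\<lambda>v. e v i)(x := a)) \<phi>"
    obtain g where "g \<in> S" "\<forall>i. (\<exists>a\<in>Dom M. sat M ((\<lambda>v. e v i)(x := a)) \<phi>)
        \<longrightarrow> sat M ((\<lambda>v. e v i)(x := g i)) \<phi>"
      using S_skolem[of \<phi> e x] Exists.prems by auto
    then show "\<exists>g\<in>S. \<forall>\<^sub>F i in U. sat M ((\<lambda>v. e v i)(x := g i)) \<phi>"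
      using * by (intro bexI[of _ g]) (erule eventually_mono, simp)
  qed
  finally show ?case by simp
qed

lemma N_struct: "is_struct L N"
  unfolding is_struct_def
proof (intro conjI ballI impI)
  show "Dom N \<noteq> {}" using struct S_const by (auto simp: N_def is_struct_def)
  fix f xs assume f: "f \<in> Funs L" and xs: "xs \<in> lists (Dom N)" "length xs = farity L f"
  have "(\<lambda>i. Fun M f (map (\<lambda>x. rep x i) xs)) \<in> S"
    using Fun_S[of f "map rep xs"] f xs rep_S by (auto simp: comp_def N_def image_subset_iff in_lists_conv_set)
  then show "Fun N f xs \<in> Dom N" by (simp add: N_def)
qed

lemma elem_sub_N: "elem_sub L M N"
  unfolding elem_sub_def elem_emb_def
proof (intro conjI allI impI)
  show "id ` Dom M \<subseteq> Dom N" using S_const \<pi>_const by (force simp: N_def)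
  fix \<phi> and e :: "nat \<Rightarrow> 'm" assume "wf_fm L \<phi>" and e: "range e \<subseteq> Dom M"
  then have "sat N (\<lambda>v. \<pi> (\<lambda>_. e v)) \<phi> \<longleftrightarrow> (\<forall>\<^sub>F i in U. sat M e \<phi>)"
    using los[of \<phi> "\<lambda>v _. e v"] S_const by auto
  moreover have "(\<lambda>v. \<pi> (\<lambda>_. e v)) = id \<circ> e" using e \<pi>_const by auto
  ultimately show "sat M e \<phi> \<longleftrightarrow> sat N (id \<circ> e) \<phi>" using U(1) by (simp add: eventually_const_iff)
qed (rule struct N_struct)+

end

section \<open>Placing the hull in the universe, and compactness\<close>

text \<open>The class of a constant sequence goes back to its value, which is unique since
  \<open>U\<close> is proper. The remaining classes are injected into the complement of
  \<open>D\<close>; it has at least \<open>lam\<close> elements, for otherwise \<open>'m\<close>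
  would have at most \<open>lam\<close>.\<close>

lemma place_quotient:
  fixes S :: "('i \<Rightarrow> 'm) set" and U :: "'i filter"
  assumes lam: "Cinfinite lam" and big: "lam <o |UNIV :: 'm set|"
    and S: "|S| \<le>o lam" and D: "|D| \<le>o lam" and U: "U \<noteq> bot" and const: "\<And>m. m \<in> D \<Longrightarrow> (\<lambda>_. m) \<in> S"
  obtains \<pi> :: "('i \<Rightarrow> 'm) \<Rightarrow> 'm" where
    "\<And>f g. f \<in> S \<Longrightarrow> g \<in> S \<Longrightarrow> \<pi> f = \<pi> g \<longleftrightarrow> (\<forall>\<^sub>F i in U. f i = g i)"
    "\<And>m. m \<in> D \<Longrightarrow> \<pi> (\<lambda>_. m) = m"
proof -
  define cl where "cl f = {g. \<forall>\<^sub>F i in U. f i = g i}" for f :: "'i \<Rightarrow> 'm"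
  have cl: "cl f = cl g \<longleftrightarrow> (\<forall>\<^sub>F i in U. f i = g i)" for f g
  proof
    assume "cl f = cl g"
    moreover have "g \<in> cl g" by (simp add: cl_def)
    ultimately have "g \<in> cl f" by (simp only:)
    then show "\<forall>\<^sub>F i in U. f i = g i" by (simp add: cl_def)
  next
    assume *: "\<forall>\<^sub>F i in U. f i = g i"
    have "h \<in> cl f \<longleftrightarrow> h \<in> cl g" for h
      unfolding cl_def mem_Collect_eq using * by (intro eventually_subst) (erule eventually_mono, simp)
    then show "cl f = cl g" by (rule set_eqI)
  qed
  have "lam \<le>o |UNIV - D|"
  proof (rule ccontr)
    assume "\<not> lam \<le>o |UNIV - D|"
    then have "|UNIV - D| \<le>o lam"
      using lam ordLeq_total[of lam "|UNIV - D|"] card_of_Well_order by (auto simp: card_order_on_def)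
    then have "|D \<union> (UNIV - D)| \<le>o lam" by (rule Un_ordLeq[OF lam D])
    then show False using not_ordLess_ordLeq[OF big] by simp
  qed
  with image_ordLeq[OF S, of cl] have "|cl ` S| \<le>o |UNIV - D|" by (rule ordLeq_transitive)
  then obtain j where j: "inj_on j (cl ` S)" "j ` (cl ` S) \<subseteq> UNIV - D"
    using card_of_ordLeq[of "cl ` S" "UNIV - D"] by auto
  define \<pi> where "\<pi> f = (if \<exists>m\<in>D. cl f = cl (\<lambda>_. m) then THE m. m \<in> D \<and> cl f = cl (\<lambda>_. m) else j (cl f))" for f
  have uniq: "m = m'" if "cl f = cl (\<lambda>_. m)" "cl f = cl (\<lambda>_. m')" for f m m'
  proof -
    have "cl (\<lambda>_. m) = cl (\<lambda>_. m')" using that by (rule trans[OF sym])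
    then have "\<forall>\<^sub>F i in U. m = m'" by (simp only: cl)
    then show ?thesis using U by (simp add: eventually_const_iff)
  qed
  have \<pi>D: "\<pi> f = m" if "m \<in> D" "cl f = cl (\<lambda>_. m)" for f m
  proof -
    have "(THE m. m \<in> D \<and> cl f = cl (\<lambda>_. m)) = m"
    proof (rule the_equality)
      show "m' = m" if "m' \<in> D \<and> cl f = cl (\<lambda>_. m')" for m'
        using uniq[of f m' m] that \<open>cl f = cl (\<lambda>_. m)\<close> by simp
    qed (use that in simp)
    moreover have "\<exists>m\<in>D. cl f = cl (\<lambda>_. m)" using that by (intro bexI[of _ m])
    ultimately show ?thesis unfolding \<pi>_def by (simp only: if_True)
  qed
  have \<pi>j: "\<pi> f = j (cl f)" if "\<not> (\<exists>m\<in>D. cl f = cl (\<lambda>_. m))" for f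
    using that by (simp add: \<pi>_def)
  show thesis
  proof (rule that[of \<pi>])
    show "\<pi> (\<lambda>_. m) = m" if "m \<in> D" for m by (rule \<pi>D[OF that refl])
    fix f g assume fg: "f \<in> S" "g \<in> S"
    have "\<pi> f = \<pi> g \<longleftrightarrow> cl f = cl g"
    proof
      assume eq: "\<pi> f = \<pi> g"
      have jD: "j (cl f) \<notin> D" "j (cl g) \<notin> D" using j(2) fg by auto
      show "cl f = cl g"
      proof (cases "\<exists>m\<in>D. cl f = cl (\<lambda>_. m)")
        case True
        then obtain m where m: "m \<in> D" "cl f = cl (\<lambda>_. m)" by (elim bexE)
        have "\<exists>m\<in>D. cl g = cl (\<lambda>_. m)"
          using \<pi>j[of g] \<pi>D[OF m] eq jD(2) m(1) by (rule_tac ccontr) simp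
        then obtain m' where m': "m' \<in> D" "cl g = cl (\<lambda>_. m')" by (elim bexE)
        show ?thesis using \<pi>D[OF m] \<pi>D[OF m'] eq m m' by simp
      next
        case False
        have "\<not> (\<exists>m\<in>D. cl g = cl (\<lambda>_. m))"
        proof
          assume "\<exists>m\<in>D. cl g = cl (\<lambda>_. m)"
          then obtain m where m: "m \<in> D" "cl g = cl (\<lambda>_. m)" by (elim bexE)
          show False using \<pi>j[OF False] \<pi>D[OF m] eq jD(1) m(1) by simp
        qed
        then have "j (cl f) = j (cl g)" using \<pi>j[OF False] \<pi>j[of g] eq by simp
        then show ?thesis by (rule inj_onD[OF j(1)]) (use fg in simp_all)
      qed
    qed (simp only: \<pi>_def)
    then show "\<pi> f = \<pi> g \<longleftrightarrow> (\<forall>\<^sub>F i in U. f i = g i)" by (simp only: cl)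
  qed
qed

text \<open>In the lists of \<Gamma>, \<open>Inl\<close> names an element of \<open>M\<close> and
  \<open>Inr\<close> a new constant. The index set of the ultrapower consists of the interpretations
  of the constants in \<open>M\<close>; each condition of \<Gamma> puts the set of interpretations
  satisfying it into the filter.\<close>

theorem compactness:
  fixes M :: "('f, 'r, 'm) struct" and C :: "'c set"
    and \<Gamma> :: "(('f, 'r) fm \<times> ('m + 'c) list) set"
  assumes M: "is_struct L M" and lam: "Cinfinite lam" and big: "lam <o |UNIV :: 'm set|"
    and L: "theory_card L \<le>o lam" and D: "|Dom M| \<le>o lam" and C: "|C| \<le>o lam"
    and \<Gamma>: "\<And>\<phi> a. (\<phi>, a) \<in> \<Gamma> \<Longrightarrow> \<phi> \<in> formulas L (length a) \<and> set a \<subseteq> Dom M <+> C"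
    and fin: "\<And>\<Gamma>0. \<Gamma>0 \<subseteq> \<Gamma> \<Longrightarrow> finite \<Gamma>0 \<Longrightarrow>
      \<exists>h. h ` C \<subseteq> Dom M \<and> (\<forall>(\<phi>, a)\<in>\<Gamma>0. sat_tuple M (map (case_sum id h) a) \<phi>)"
  obtains N :: "('f, 'r, 'm) struct" and h :: "'c \<Rightarrow> 'm"
  where "elem_sub L M N" "|Dom N| \<le>o lam" "h ` C \<subseteq> Dom N"
    "\<And>\<phi> a. (\<phi>, a) \<in> \<Gamma> \<Longrightarrow> sat_tuple N (map (case_sum id h) a) \<phi>"
proof -
  obtain m0 where m0: "m0 \<in> Dom M" using M unfolding is_struct_def by auto
  \<comment> \<open>Read as a function of the interpretation \<open>h\<close>, \<open>ev c\<close>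
    is the element of the power that the constant \<open>c\<close> names; \<open>m0\<close> keeps
    its values in \<open>M\<close> when \<open>h c\<close> lies outside.\<close>
  define ev where "ev c h = (if h c \<in> Dom M then h c else m0)" for c :: 'c and h :: "'c \<Rightarrow> 'm"
  define G where "G = (\<lambda>(\<phi>, a) h. sat_tuple M (map (case_sum id (\<lambda>c. ev c h)) a) \<phi>) ` \<Gamma>"
  have "\<exists>h. \<forall>P\<in>X. P h" if X: "X \<subseteq> G" "finite X" for X
  proof -
    obtain \<Gamma>0 where \<Gamma>0: "\<Gamma>0 \<subseteq> \<Gamma>" "finite \<Gamma>0"
      "X = (\<lambda>(\<phi>, a) h. sat_tuple M (map (case_sum id (\<lambda>c. ev c h)) a) \<phi>) ` \<Gamma>0"
      using finite_subset_image[OF X(2) X(1)[unfolded G_def]] by blast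
    obtain h where h: "h ` C \<subseteq> Dom M" "\<forall>(\<phi>, a)\<in>\<Gamma>0. sat_tuple M (map (case_sum id h) a) \<phi>"
      using fin[OF \<Gamma>0(1,2)] by blast
    have "map (case_sum id (\<lambda>c. ev c h)) a = map (case_sum id h) a" if "(\<phi>, a) \<in> \<Gamma>0" for \<phi> a
      using \<Gamma>[of \<phi> a] \<Gamma>0(1) that h(1) by (fastforce simp: ev_def split: sum.split)
    then have "sat_tuple M (map (case_sum id (\<lambda>c. ev c h)) a) \<phi>" if "(\<phi>, a) \<in> \<Gamma>0" for \<phi> a
      using h(2) that by (simp only:) blast
    then have "\<forall>P\<in>X. P h" unfolding \<Gamma>0(3) by auto
    then show ?thesis by blast
  qed
  note fipG = this
  obtain U :: "('c \<Rightarrow> 'm) filter" where UF: "U \<noteq> bot" "\<And>P. P \<in> G \<Longrightarrow> eventually P U"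
    "\<And>P. eventually P U \<or> eventually (\<lambda>i. \<not> P i) U"
    by (rule ultrafilter_exists[of G]) (erule fipG, assumption, rule that)
  define B where "B = (\<lambda>m _. m) ` Dom M \<union> ev ` C"
  have B: "\<forall>f\<in>B. \<forall>h. f h \<in> Dom M" using m0 by (auto simp: B_def ev_def)
  have B1: "|B| \<le>o lam" unfolding B_def by (intro Un_ordLeq[OF lam] image_ordLeq D C)
  obtain S where S: "B \<subseteq> S" "|S| \<le>o lam" "\<And>f i. f \<in> S \<Longrightarrow> f i \<in> Dom M"
    "\<And>\<phi> e x. wf_fm L \<phi> \<Longrightarrow> range e \<subseteq> S \<Longrightarrow>
      \<exists>g\<in>S. \<forall>i. (\<exists>a\<in>Dom M. sat M ((\<lambda>v. e v i)(x := a)) \<phi>) \<longrightarrow> sat M ((\<lambda>v. e v i)(x := g i)) \<phi>"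
    by (rule skolem_hull[OF M lam L B1 B]) (rule that)
  have const: "(\<lambda>_. m) \<in> S" if "m \<in> Dom M" for m using S(1) that by (auto simp: B_def)
  have evS: "ev c \<in> S" if "c \<in> C" for c using S(1) that by (auto simp: B_def)
  obtain \<pi> where \<pi>: "\<And>f g. f \<in> S \<Longrightarrow> g \<in> S \<Longrightarrow> \<pi> f = \<pi> g \<longleftrightarrow> (\<forall>\<^sub>F i in U. f i = g i)"
    "\<And>m. m \<in> Dom M \<Longrightarrow> \<pi> (\<lambda>_. m) = m"
    by (rule place_quotient[OF lam big S(2) D UF(1)], erule const) (rule that)
  interpret ultrapower_hull L M U S \<pi>
    by unfold_locales (rule M UF S const \<pi>; assumption?)+
  show thesis
  proof (rule that[of N "\<pi> \<circ> ev"])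
    show "elem_sub L M N" by (rule elem_sub_N)
    show "|Dom N| \<le>o lam" using image_ordLeq[OF S(2)] by (simp add: N_def)
    show "(\<pi> \<circ> ev) ` C \<subseteq> Dom N" using evS by (auto simp: N_def)
    fix \<phi> a assume mem: "(\<phi>, a) \<in> \<Gamma>"
    define e where "e v = (if v < length a then (case a ! v of Inl m \<Rightarrow> (\<lambda>_. m) | Inr c \<Rightarrow> ev c) else (\<lambda>_. m0))" for v
    have a: "set a \<subseteq> Dom M <+> C" and \<phi>: "\<phi> \<in> formulas L (length a)" using \<Gamma>[OF mem] by auto
    have nth: "a ! v \<in> Dom M <+> C" if "v < length a" for v using a that by auto
    have e: "range e \<subseteq> S" using nth const evS m0 by (fastforce simp: e_def split: sum.split)
    have "sat_tuple N (map (case_sum id (\<pi> \<circ> ev)) a) \<phi> \<longleftrightarrow> sat N (\<lambda>v. \<pi> (e v)) \<phi>"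
      by (rule formulas_sat_cong[OF \<phi>]) (use nth \<pi>(2) in \<open>fastforce simp: e_def split: sum.split\<close>)
    also have "\<dots> \<longleftrightarrow> (\<forall>\<^sub>F h in U. sat M (\<lambda>v. e v h) \<phi>)"
      by (rule los[OF _ e]) (use \<phi> in \<open>simp add: formulas_def\<close>)
    also have "\<dots> \<longleftrightarrow> (\<forall>\<^sub>F h in U. sat_tuple M (map (case_sum id (\<lambda>c. ev c h)) a) \<phi>)"
    proof -
      have "sat M (\<lambda>v. e v h) \<phi> \<longleftrightarrow> sat_tuple M (map (case_sum id (\<lambda>c. ev c h)) a) \<phi>" for h
        by (rule formulas_sat_cong[OF \<phi>]) (simp add: e_def split: sum.split)
      then show ?thesis by simp
    qed
    finally have "sat_tuple N (map (case_sum id (\<pi> \<circ> ev)) a) \<phi> \<longleftrightarrow>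
      (\<forall>\<^sub>F h in U. sat_tuple M (map (case_sum id (\<lambda>c. ev c h)) a) \<phi>)" .
    moreover have "\<forall>\<^sub>F h in U. sat_tuple M (map (case_sum id (\<lambda>c. ev c h)) a) \<phi>"
      by (rule UF(2)) (unfold G_def, rule rev_image_eqI[OF mem], simp)
    ultimately show "sat_tuple N (map (case_sum id (\<pi> \<circ> ev)) a) \<phi>" by (simp only:)
  qed
qed

section \<open>Dividing in stable theories\<close>

text \<open>In \<open>dtree N n w t S\<close>, \<open>S\<close> contains the leaves of a tree whose levels are given by the labels
  \<open>w\<close>: below each node there are \<open>t\<close> instances of the formula at that level, any \<open>k\<close> of them
  inconsistent, and the branches are consistent.\<close>

fun dtree :: "('f, 'r, 'm) struct \<Rightarrow> nat \<Rightarrow> (('f, 'r) fm \<times> nat \<times> nat) list \<Rightarrow> nat \<Rightarrow> 'm list set \<Rightarrow> bool" where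
  "dtree N n [] t S \<longleftrightarrow> S \<noteq> {}"
| "dtree N n ((\<phi>, m, k) # w) t S \<longleftrightarrow> (\<exists>c. (\<forall>i<t. c i \<in> tuples N m) \<and>
     (\<forall>K. K \<subseteq> {..<t} \<longrightarrow> card K = k \<longrightarrow> \<not> (\<exists>a \<in> tuples N n. \<forall>i\<in>K. sat_tuple N (a @ c i) \<phi>)) \<and>
     (\<forall>i<t. dtree N n w t (S \<inter> {a. sat_tuple N (a @ c i) \<phi>})))"

text \<open>One instance of the formula and its negation split every node, and the parameter may
  vary with the node. With all labels equal, the possible heights measure Shelah's 2-rank.\<close>

fun btree :: "('f, 'r, 'm) struct \<Rightarrow> nat \<Rightarrow> (('f, 'r) fm \<times> nat) list \<Rightarrow> 'm list set \<Rightarrow> bool" where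
  "btree N n [] S \<longleftrightarrow> S \<noteq> {}"
| "btree N n ((\<phi>, m) # w) S \<longleftrightarrow> (\<exists>c \<in> tuples N m.
     btree N n w (S \<inter> {a. sat_tuple N (a @ c) \<phi>}) \<and> btree N n w (S - {a. sat_tuple N (a @ c) \<phi>}))"

section \<open>Combinatorics of the trees\<close>

lemma dtree_mono: "dtree N n w t S \<Longrightarrow> S \<subseteq> S' \<Longrightarrow> dtree N n w t S'"
proof (induction w arbitrary: S S')
  case (Cons l w)
  obtain \<phi> m k where l: "l = (\<phi>, m, k)" by (cases l)
  obtain c where c: "\<forall>i<t. c i \<in> tuples N m"
     "\<forall>K. K \<subseteq> {..<t} \<longrightarrow> card K = k \<longrightarrow> \<not> (\<exists>a \<in> tuples N n. \<forall>i\<in>K. sat_tuple N (a @ c i) \<phi>)"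
     "\<forall>i<t. dtree N n w t (S \<inter> {a. sat_tuple N (a @ c i) \<phi>})"
    using Cons.prems(1) unfolding l dtree.simps by (elim exE conjE)
  have "dtree N n w t (S' \<inter> {a. sat_tuple N (a @ c i) \<phi>})" if "i < t" for i
    by (rule Cons.IH[OF c(3)[rule_format, OF that]]) (use Cons.prems(2) in auto)
  then show ?case unfolding l dtree.simps using c by (intro exI[of _ c]) simp
qed auto

lemma dtree_antimono: "dtree N n w t S \<Longrightarrow> t' \<le> t \<Longrightarrow> dtree N n w t' S"
proof (induction w arbitrary: S)
  case (Cons l w)
  obtain \<phi> m k where l: "l = (\<phi>, m, k)" by (cases l)
  obtain c where c: "\<forall>i<t. c i \<in> tuples N m"
     "\<forall>K. K \<subseteq> {..<t} \<longrightarrow> card K = k \<longrightarrow> \<not> (\<exists>a \<in> tuples N n. \<forall>i\<in>K. sat_tuple N (a @ c i) \<phi>)"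
     "\<forall>i<t. dtree N n w t (S \<inter> {a. sat_tuple N (a @ c i) \<phi>})"
    using Cons.prems(1) unfolding l dtree.simps by (elim exE conjE)
  have "dtree N n w t' (S \<inter> {a. sat_tuple N (a @ c i) \<phi>})" if "i < t'" for i
    by (rule Cons.IH[OF c(3)[rule_format] Cons.prems(2)]) (use that Cons.prems(2) in simp)
  moreover have "K \<subseteq> {..<t}" if "K \<subseteq> {..<t'}" for K using that Cons.prems(2) by auto
  moreover have "c i \<in> tuples N m" if "i < t'" for i using c(1) that Cons.prems(2) by auto
  ultimately show ?case unfolding l dtree.simps using c(2) by (intro exI[of _ c]) simp
qed auto

lemma fibre_card:
  fixes J :: "'j set"
  assumes "finite J" "J \<noteq> {}" "f ` {..<card J * t} \<subseteq> J"
  obtains j where "j \<in> J" "t \<le> card {i \<in> {..<card J * t}. f i = j}"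
proof -
  define F where "F j = {i \<in> {..<card J * t}. f i = j}" for j
  have "\<exists>j\<in>J. t \<le> card (F j)"
  proof (rule ccontr)
    assume "\<not> ?thesis"
    then have lt: "\<And>j. j \<in> J \<Longrightarrow> card (F j) < t" by auto
    have "{..<card J * t} = (\<Union>j\<in>J. F j)" using assms(3) by (auto simp: F_def)
    then have "card J * t \<le> (\<Sum>j\<in>J. card (F j))"
      using card_UN_le[OF assms(1), of F] by (metis card_lessThan)
    also have "\<dots> < (\<Sum>j\<in>J. t)" by (rule sum_strict_mono) (use assms lt in auto)
    finally show False by simp
  qed
  then show thesis using that unfolding F_def by blast
qed

text \<open>The rank of a finite union is attained by one of the pieces. By induction each child of
  the root favours some \<open>j\<close>, and by pigeonhole \<open>t\<close> of the
  \<open>card J * t\<close> children favour the same one. The factor does not grow with the height,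
  as all levels have branching \<open>card J * t\<close>.\<close>

lemma dtree_Union:
  assumes "finite J" "J \<noteq> {}" "dtree N n w (card J * t) S" "S \<subseteq> (\<Union>j\<in>J. X j)"
  shows "\<exists>j\<in>J. dtree N n w t (X j)"
  using assms(3,4)
proof (induction w arbitrary: S X)
  case (Cons l w)
  obtain \<phi> m k where l: "l = (\<phi>, m, k)" by (cases l)
  define T where "T = card J * t"
  obtain c where c: "\<forall>i<T. c i \<in> tuples N m"
     "\<forall>K. K \<subseteq> {..<T} \<longrightarrow> card K = k \<longrightarrow> \<not> (\<exists>a \<in> tuples N n. \<forall>i\<in>K. sat_tuple N (a @ c i) \<phi>)"
     "\<forall>i<T. dtree N n w T (S \<inter> {a. sat_tuple N (a @ c i) \<phi>})"
    using Cons.prems(1) unfolding l dtree.simps T_def by (elim exE conjE)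
  have "\<exists>j\<in>J. dtree N n w t (X j \<inter> {a. sat_tuple N (a @ c i) \<phi>})" if "i < T" for i
    by (rule Cons.IH[OF c(3)[rule_format, OF that, unfolded T_def]]) (use Cons.prems(2) in auto)
  then have "\<exists>f. \<forall>i\<in>{..<T}. f i \<in> J \<and> dtree N n w t (X (f i) \<inter> {a. sat_tuple N (a @ c i) \<phi>})"
    by (intro bchoice) auto
  then obtain f where f: "\<And>i. i < T \<Longrightarrow> f i \<in> J \<and> dtree N n w t (X (f i) \<inter> {a. sat_tuple N (a @ c i) \<phi>})"
    by auto
  then have "f ` {..<card J * t} \<subseteq> J" unfolding T_def by auto
  then obtain j where j: "j \<in> J" "t \<le> card {i \<in> {..<T}. f i = j}"
    unfolding T_def by (rule fibre_card[OF assms(1,2)])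
  then obtain I where I: "I \<subseteq> {i \<in> {..<T}. f i = j}" "card I = t" "finite I"
    by (meson obtain_subset_with_card_n)
  obtain h where h: "bij_betw h {0..<t} I" using ex_bij_betw_nat_finite[OF I(3)] I(2) by auto
  have hT: "h i < T \<and> f (h i) = j" if "i < t" for i
    using bij_betwE[OF h] that I(1) by auto
  have "\<not> (\<exists>a \<in> tuples N n. \<forall>i\<in>K. sat_tuple N (a @ c (h i)) \<phi>)" if K: "K \<subseteq> {..<t}" "card K = k" for K
  proof -
    have "inj_on h K" using bij_betw_imp_inj_on[OF h] by (rule inj_on_subset) (use K(1) in auto)
    then have "card (h ` K) = k" using K(2) by (simp add: card_image)
    moreover have "h ` K \<subseteq> {..<T}" using hT K(1) by auto
    ultimately show ?thesis using c(2) by auto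
  qed
  moreover have "dtree N n w t (X j \<inter> {a. sat_tuple N (a @ c (h i)) \<phi>})" if "i < t" for i
    using f[of "h i"] hT[OF that] by simp
  ultimately have "dtree N n (l # w) t (X j)" unfolding l dtree.simps
    using c(1) hT by (intro exI[of _ "c \<circ> h"]) simp
  then show ?case using j(1) by blast
qed auto

lemma btree_mono: "btree N n w S \<Longrightarrow> S \<subseteq> S' \<Longrightarrow> btree N n w S'"
proof (induction w arbitrary: S S')
  case (Cons l w)
  obtain \<phi> m where l: "l = (\<phi>, m)" by (cases l)
  obtain c where c: "c \<in> tuples N m" "btree N n w (S \<inter> {a. sat_tuple N (a @ c) \<phi>})"
    "btree N n w (S - {a. sat_tuple N (a @ c) \<phi>})"
    using Cons.prems(1) unfolding l btree.simps by (elim bexE conjE)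
  have "btree N n w (S' \<inter> {a. sat_tuple N (a @ c) \<phi>})"
    by (rule Cons.IH[OF c(2)]) (use Cons.prems(2) in auto)
  moreover have "btree N n w (S' - {a. sat_tuple N (a @ c) \<phi>})"
    by (rule Cons.IH[OF c(3)]) (use Cons.prems(2) in auto)
  ultimately show ?case unfolding l btree.simps using c(1) by (intro bexI[of _ c]) simp_all
qed auto

lemma btree_Cons_D: "btree N n (l # w) S \<Longrightarrow> btree N n w S"
proof -
  assume *: "btree N n (l # w) S"
  obtain \<phi> m where l: "l = (\<phi>, m)" by (cases l)
  show "btree N n w S" using * unfolding l btree.simps
    by (elim bexE conjE) (erule btree_mono, blast)
qed

text \<open>A level is dropped by descending into one half of its node; the tree below also lives in
  the larger set.\<close>

lemma btree_filter: "btree N n w S \<Longrightarrow> btree N n (filter Q w) S"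
proof (induction w arbitrary: S)
  case (Cons l w)
  obtain \<phi> m where l: "l = (\<phi>, m)" by (cases l)
  show ?case
  proof (cases "Q l")
    case True
    obtain c where c: "c \<in> tuples N m" "btree N n w (S \<inter> {a. sat_tuple N (a @ c) \<phi>})"
      "btree N n w (S - {a. sat_tuple N (a @ c) \<phi>})"
      using Cons.prems(1) unfolding l btree.simps by (elim bexE conjE)
    then have "btree N n (l # filter Q w) S" unfolding l btree.simps
      using Cons.IH by (intro bexI[of _ c]) simp_all
    then show ?thesis using True by simp
  next
    case False
    then show ?thesis using Cons.IH[OF btree_Cons_D[OF Cons.prems]] by simp
  qed
qed auto

lemma btree_replicate_mono: "btree N n (replicate r l) S \<Longrightarrow> r' \<le> r \<Longrightarrow> btree N n (replicate r' l) S"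
proof (induction r)
  case (Suc r)
  then show ?case using btree_Cons_D[of N n l "replicate r l" S] by (auto simp: le_Suc_eq)
qed auto

text \<open>No point satisfies all of the first \<open>k\<close> instances, so the part of
  \<open>S\<close> inside one of them is covered by their \<open>k\<close> complements. By
  \<open>dtree_Union\<close> some complement carries a tree below, and so does the instance with
  that index: both halves of a binary node.\<close>

lemma dtree_btree:
  assumes "is_struct L N"
  shows "\<exists>t. \<forall>S. S \<subseteq> tuples N n \<longrightarrow> dtree N n w t S \<longrightarrow> btree N n (map (\<lambda>(\<phi>, m, k). (\<phi>, m)) w) S"
proof (induction w)
  case (Cons l w)
  obtain \<phi> m k where l: "l = (\<phi>, m, k)" by (cases l)
  let ?w = "map (\<lambda>(\<phi>, m, k). (\<phi>, m)) w"
  obtain t where t: "\<And>S. S \<subseteq> tuples N n \<Longrightarrow> dtree N n w t S \<Longrightarrow> btree N n ?w S"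
    using Cons by blast
  \<comment> \<open>At least \<open>k\<close>, for the inconsistency of \<open>k\<close> instances;
    at least \<open>k * t\<close>, so that passing to one of \<open>k\<close> pieces leaves
    branching \<open>t\<close>; and at least \<open>t\<close>, for the half inside the instance. The
    successors make it positive, so that child 0 exists.\<close>
  define T where "T = Suc k * Suc t"
  have kT: "k \<le> T" "k * t \<le> T" "t \<le> T" by (auto simp: T_def)
  have "btree N n (map (\<lambda>(\<phi>, m, k). (\<phi>, m)) (l # w)) S" if S: "S \<subseteq> tuples N n" "dtree N n (l # w) T S" for S
  proof -
    obtain c where c: "\<forall>i<T. c i \<in> tuples N m"
       "\<forall>K. K \<subseteq> {..<T} \<longrightarrow> card K = k \<longrightarrow> \<not> (\<exists>a \<in> tuples N n. \<forall>i\<in>K. sat_tuple N (a @ c i) \<phi>)"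
       "\<forall>i<T. dtree N n w T (S \<inter> {a. sat_tuple N (a @ c i) \<phi>})"
      using S(2) unfolding l dtree.simps by (elim exE conjE)
    have incons: "\<not> (\<exists>a \<in> tuples N n. \<forall>i\<in>{..<k}. sat_tuple N (a @ c i) \<phi>)"
      using c(2)[rule_format, of "{..<k}"] kT by simp
    \<comment> \<open>Inconsistency of no instances at all would deny that there are
      \<open>n\<close>-tuples.\<close>
    have "k \<noteq> 0" using incons tuples_nonempty[OF assms, of n] by auto
    have "0 < T" by (simp add: T_def)
    have "dtree N n w (card {..<k} * t) (S \<inter> {a. sat_tuple N (a @ c 0) \<phi>})"
      using dtree_antimono[OF c(3)[rule_format, OF \<open>0 < T\<close>], of "k * t"] kT by simp
    moreover have "S \<inter> {a. sat_tuple N (a @ c 0) \<phi>} \<subseteq> (\<Union>j\<in>{..<k}. S - {a. sat_tuple N (a @ c j) \<phi>})"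
      using incons S(1) by auto
    ultimately have "\<exists>j\<in>{..<k}. dtree N n w t (S - {a. sat_tuple N (a @ c j) \<phi>})"
      using \<open>k \<noteq> 0\<close> by (intro dtree_Union) auto
    then obtain j where j: "j < k" "dtree N n w t (S - {a. sat_tuple N (a @ c j) \<phi>})" by auto
    have jT: "j < T" using j(1) kT by simp
    have "dtree N n w t (S \<inter> {a. sat_tuple N (a @ c j) \<phi>})"
      by (rule dtree_antimono[OF c(3)[rule_format, OF jT] kT(3)])
    then have "btree N n ?w (S \<inter> {a. sat_tuple N (a @ c j) \<phi>})" by (intro t) (use S(1) in auto)
    moreover have "btree N n ?w (S - {a. sat_tuple N (a @ c j) \<phi>})" by (intro t j(2)) (use S(1) in auto)
    moreover have "c j \<in> tuples N m" using c(1) jT by simp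
    ultimately show ?thesis unfolding l list.map prod.case btree.simps by (intro bexI[of _ "c j"] conjI)
  qed
  then show ?case by blast
qed auto

section \<open>Existence of a tree is first-order\<close>

lemma concat_slice:
  "(\<And>i. i < t \<Longrightarrow> length (c i) = m) \<Longrightarrow> i < t \<Longrightarrow> take m (drop (i * m) (concat (map c [0..<t]))) = c i"
proof (induction t)
  case (Suc t)
  have len: "length (concat (map c [0..<t])) = t * m"
    using Suc.prems(1) by (induction t) auto
  show ?case
  proof (cases "i < t")
    case True
    then have "i * m + m \<le> t * m" by (metis Suc_leI add.commute mult_Suc mult_le_mono1)
    then show ?thesis using Suc.IH[OF _ True] Suc.prems(1) len by simp
  next
    case False
    then have "i = t" using Suc.prems(2) by simp
    then show ?thesis using len Suc.prems(1)[of t] by simp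
  qed
qed auto

text \<open>Trades a quantifier over \<open>t\<close> tuples for one over a single tuple of length
  \<open>t * m\<close>, which \<open>dfn_ex\<close> can handle. It requires that \<open>Q\<close>
  looks at its argument only below \<open>t\<close>.\<close>

lemma tuples_slices:
  "(\<exists>c. (\<forall>i<t. c i \<in> tuples N m) \<and> Q c) \<longleftrightarrow> (\<exists>C\<in>tuples N (t * m). Q (\<lambda>i. take m (drop (i * m) C)))"
  if Q: "\<And>c c'. (\<And>i. i < t \<Longrightarrow> c i = c' i) \<Longrightarrow> Q c \<longleftrightarrow> Q c'"
proof
  assume "\<exists>c. (\<forall>i<t. c i \<in> tuples N m) \<and> Q c"
  then obtain c where "\<forall>i<t. c i \<in> tuples N m" and c2: "Q c" by (elim exE conjE)
  then have c: "\<And>i. i < t \<Longrightarrow> c i \<in> tuples N m" by simp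
  define C where "C = concat (map c [0..<t])"
  have C: "concat (map c [0..<t]) \<in> tuples N (t * m)" using c
  proof (induction t)
    case (Suc t)
    then have "concat (map c [0..<t]) @ c t \<in> tuples N (t * m + m)" by (intro tuples_append) auto
    then show ?case by (simp add: add.commute)
  qed (simp add: tuples_def)
  have "Q c \<longleftrightarrow> Q (\<lambda>i. take m (drop (i * m) C))"
  proof (rule Q)
    fix i assume "i < t"
    then show "c i = take m (drop (i * m) C)" unfolding C_def
      by (intro concat_slice[symmetric]) (use c in \<open>simp_all add: tuples_def\<close>)
  qed
  then have "Q (\<lambda>i. take m (drop (i * m) C))" using c2 by (simp only:)
  then show "\<exists>C\<in>tuples N (t * m). Q (\<lambda>i. take m (drop (i * m) C))"
    unfolding C_def by (rule bexI[OF _ C])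
next
  assume "\<exists>C\<in>tuples N (t * m). Q (\<lambda>i. take m (drop (i * m) C))"
  then obtain C where C: "C \<in> tuples N (t * m)" "Q (\<lambda>i. take m (drop (i * m) C))" by (elim bexE)
  have "take m (drop (i * m) C) \<in> tuples N m" if "i < t" for i
  proof -
    have "Suc i * m \<le> t * m" using that by (intro mult_le_mono1) simp
    then have "length (take m (drop (i * m) C)) = m" using C(1) by (simp add: tuples_def)
    moreover have "set (take m (drop (i * m) C)) \<subseteq> set C"
      by (meson set_drop_subset set_take_subset order_trans)
    ultimately show ?thesis using C(1) unfolding tuples_def by auto
  qed
  then show "\<exists>c. (\<forall>i<t. c i \<in> tuples N m) \<and> Q c"
    by (intro exI[of _ "\<lambda>i. take m (drop (i * m) C)"] conjI C(2)) simp
qed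

lemma map_nth_slice: "i + m \<le> length a \<Longrightarrow> map ((!) a) [i..<i + m] = take m (drop i a)"
  by (rule nth_equalityI) auto

lemma dfn_slices2:
  assumes "dfn L (p + q) R" "i + p \<le> K" "j + q \<le> K"
  shows "dfn L K (\<lambda>N s. R N (take p (drop i s) @ take q (drop j s)))"
  by (rule dfn_rearrange[OF assms(1), of "[i..<i + p] @ [j..<j + q]"])
    (use assms(2,3) in \<open>auto simp: map_nth_slice\<close>)

text \<open>With \<open>w\<close> and \<open>t\<close> fixed the tree is a finite configuration. Its
  existence inside the set defined from \<open>p\<close> thus becomes a formula in \<open>p\<close>,
  so parameters of the same type bound sets with the same trees.\<close>

lemma dfn_dtree:
  fixes R :: "('f, 'r, 'm) struct \<Rightarrow> 'm list \<Rightarrow> bool"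
  assumes "dfn L (K + n) R" "\<And>\<phi> m k. (\<phi>, m, k) \<in> set w \<Longrightarrow> \<phi> \<in> formulas L (n + m)"
  shows "dfn L K (\<lambda>N p. dtree N n w t {x \<in> tuples N n. R N (p @ x)})"
  using assms
proof (induction w arbitrary: K R)
  case Nil
  have "dfn L K (\<lambda>N p. \<exists>x\<in>tuples N n. R N (p @ x))" by (rule dfn_ex[OF Nil.prems(1)])
  then show ?case by (rule dfn_cong) auto
next
  case (Cons l w)
  obtain \<phi> m k where l: "l = (\<phi>, m, k)" by (cases l)
  have \<phi>: "dfn L (n + m) (\<lambda>N a. sat_tuple N a \<phi>)" using Cons.prems(2) l by (auto intro: dfn_formula)
  \<comment> \<open>Coordinates are laid out as the parameters, then the \<open>t\<close> tuples at
    the root in one block, then the point \<open>x\<close> from position \<open>K'\<close>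
    on.\<close>
  define K' where "K' = K + t * m"
  define R1 where "R1 i N s = sat_tuple N (take n (drop K' s) @ take m (drop (K + i * m) s)) \<phi>"
    for i and N :: "('f, 'r, 'm) struct" and s
  have im: "i * m + m \<le> t * m" if "i < t" for i
    using that by (metis Suc_leI add.commute mult_Suc mult_le_mono1)
  have R1: "dfn L (K' + n) (R1 i)" if "i < t" for i
    unfolding R1_def by (rule dfn_slices2[OF \<phi>]) (use im[OF that] in \<open>auto simp: K'_def\<close>)
  have R1_eq: "R1 i N ((p @ C) @ x) \<longleftrightarrow> sat_tuple N (x @ take m (drop (i * m) C)) \<phi>"
    if "i < t" "p \<in> tuples N K" "C \<in> tuples N (t * m)" "x \<in> tuples N n"
    for i and N :: "('f, 'r, 'm) struct" and p C x
    using that im[of i] by (simp add: R1_def K'_def tuples_def)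
  define R' where "R' i N s \<longleftrightarrow> R N (take K (drop 0 s) @ take n (drop K' s)) \<and> R1 i N s"
    for i and N :: "('f, 'r, 'm) struct" and s
  have R': "dfn L (K' + n) (R' i)" if "i < t" for i
    unfolding R'_def by (intro dfn_conj dfn_slices2[OF Cons.prems(1)] R1 that) (auto simp: K'_def)
  have R'_eq: "R' i N ((p @ C) @ x) \<longleftrightarrow> R N (p @ x) \<and> sat_tuple N (x @ take m (drop (i * m) C)) \<phi>"
    if "i < t" "p \<in> tuples N K" "C \<in> tuples N (t * m)" "x \<in> tuples N n"
    for i and N :: "('f, 'r, 'm) struct" and p C x
    using that R1_eq[of i p N C x] by (simp add: R'_def K'_def tuples_def)
  have "dfn L K' (\<lambda>N q. (\<forall>I\<in>{I. I \<subseteq> {..<t} \<and> card I = k}. \<not> (\<exists>x\<in>tuples N n. \<forall>i\<in>I. R1 i N (q @ x))) \<and>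
     (\<forall>i\<in>{..<t}. dtree N n w t {x \<in> tuples N n. R' i N (q @ x)}))"
  proof (rule dfn_conj)
    show "dfn L K' (\<lambda>N q. \<forall>I\<in>{I. I \<subseteq> {..<t} \<and> card I = k}. \<not> (\<exists>x\<in>tuples N n. \<forall>i\<in>I. R1 i N (q @ x)))"
    proof (rule dfn_ball)
      fix I assume I: "I \<in> {I. I \<subseteq> {..<t} \<and> card I = k}"
      have "dfn L (K' + n) (\<lambda>N s. \<forall>i\<in>I. R1 i N s)"
        by (rule dfn_ball) (use I R1 finite_subset in auto)
      then show "dfn L K' (\<lambda>N q. \<not> (\<exists>x\<in>tuples N n. \<forall>i\<in>I. R1 i N (q @ x)))"
        by (rule dfn_not[OF dfn_ex])
    qed simp
    show "dfn L K' (\<lambda>N q. \<forall>i\<in>{..<t}. dtree N n w t {x \<in> tuples N n. R' i N (q @ x)})"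
      by (rule dfn_ball) (use Cons.IH[OF R'] Cons.prems(2) in auto)
  qed
  then have "dfn L K (\<lambda>N p. \<exists>C\<in>tuples N (t * m).
      (\<forall>I\<in>{I. I \<subseteq> {..<t} \<and> card I = k}. \<not> (\<exists>x\<in>tuples N n. \<forall>i\<in>I. R1 i N ((p @ C) @ x))) \<and>
      (\<forall>i\<in>{..<t}. dtree N n w t {x \<in> tuples N n. R' i N ((p @ C) @ x)}))"
    unfolding K'_def by (rule dfn_ex)
  then show ?case
  proof (rule dfn_cong)
    fix N :: "('f, 'r, 'm) struct" and p assume p: "p \<in> tuples N K"
    define S where "S = {x \<in> tuples N n. R N (p @ x)}"
    define Q where "Q c \<longleftrightarrow>
      (\<forall>I. I \<subseteq> {..<t} \<longrightarrow> card I = k \<longrightarrow> \<not> (\<exists>a \<in> tuples N n. \<forall>i\<in>I. sat_tuple N (a @ c i) \<phi>)) \<and>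
      (\<forall>i<t. dtree N n w t (S \<inter> {a. sat_tuple N (a @ c i) \<phi>}))" for c
    have Qcong: "Q c \<longleftrightarrow> Q c'" if "\<And>i. i < t \<Longrightarrow> c i = c' i" for c c'
    proof -
      have "(\<forall>i\<in>I. sat_tuple N (a @ c i) \<phi>) \<longleftrightarrow> (\<forall>i\<in>I. sat_tuple N (a @ c' i) \<phi>)"
        if "I \<subseteq> {..<t}" for I a using that \<open>\<And>i. i < t \<Longrightarrow> c i = c' i\<close> by (intro ball_cong) auto
      then show ?thesis unfolding Q_def using that by simp
    qed
    have "dtree N n (l # w) t S \<longleftrightarrow> (\<exists>c. (\<forall>i<t. c i \<in> tuples N m) \<and> Q c)"
      unfolding l dtree.simps Q_def ..
    also have "\<dots> \<longleftrightarrow> (\<exists>C\<in>tuples N (t * m). Q (\<lambda>i. take m (drop (i * m) C)))"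
      by (rule tuples_slices[OF Qcong])
    also have "\<dots> \<longleftrightarrow> (\<exists>C\<in>tuples N (t * m).
      (\<forall>I\<in>{I. I \<subseteq> {..<t} \<and> card I = k}. \<not> (\<exists>x\<in>tuples N n. \<forall>i\<in>I. R1 i N ((p @ C) @ x))) \<and>
      (\<forall>i\<in>{..<t}. dtree N n w t {x \<in> tuples N n. R' i N ((p @ C) @ x)}))"
    proof (rule bex_cong[OF refl])
      fix C assume C: "C \<in> tuples N (t * m)"
      have "{x \<in> tuples N n. R' i N ((p @ C) @ x)} = S \<inter> {a. sat_tuple N (a @ take m (drop (i * m) C)) \<phi>}"
        if "i < t" for i using R'_eq[OF that p C] unfolding S_def by auto
      moreover have "(\<exists>x\<in>tuples N n. \<forall>i\<in>I. R1 i N ((p @ C) @ x)) \<longleftrightarrow>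
        (\<exists>a\<in>tuples N n. \<forall>i\<in>I. sat_tuple N (a @ take m (drop (i * m) C)) \<phi>)" if "I \<subseteq> {..<t}" for I
        by (intro bex_cong ball_cong refl R1_eq p C) (use that in auto)
      ultimately show "Q (\<lambda>i. take m (drop (i * m) C)) \<longleftrightarrow>
        (\<forall>I\<in>{I. I \<subseteq> {..<t} \<and> card I = k}. \<not> (\<exists>x\<in>tuples N n. \<forall>i\<in>I. R1 i N ((p @ C) @ x))) \<and>
        (\<forall>i\<in>{..<t}. dtree N n w t {x \<in> tuples N n. R' i N ((p @ C) @ x)})"
        unfolding Q_def by auto
    qed
    finally show "dtree N n (l # w) t {x \<in> tuples N n. R N (p @ x)} \<longleftrightarrow> (\<exists>C\<in>tuples N (t * m).
      (\<forall>I\<in>{I. I \<subseteq> {..<t} \<and> card I = k}. \<not> (\<exists>x\<in>tuples N n. \<forall>i\<in>I. R1 i N ((p @ C) @ x))) \<and>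
      (\<forall>i\<in>{..<t}. dtree N n w t {x \<in> tuples N n. R' i N ((p @ C) @ x)}))"
      unfolding S_def .
  qed
qed

text \<open>For \<open>K = 0\<close> the existence of a binary tree with given labels is a sentence,
  so completeness compares ranks in different models.\<close>

lemma dfn_btree:
  fixes R :: "('f, 'r, 'm) struct \<Rightarrow> 'm list \<Rightarrow> bool"
  assumes "dfn L (K + n) R" "\<And>\<phi> m. (\<phi>, m) \<in> set w \<Longrightarrow> \<phi> \<in> formulas L (n + m)"
  shows "dfn L K (\<lambda>N p. btree N n w {x \<in> tuples N n. R N (p @ x)})"
  using assms
proof (induction w arbitrary: K R)
  case Nil
  have "dfn L K (\<lambda>N p. \<exists>x\<in>tuples N n. R N (p @ x))" by (rule dfn_ex[OF Nil.prems(1)])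
  then show ?case by (rule dfn_cong) auto
next
  case (Cons l w)
  obtain \<phi> m where l: "l = (\<phi>, m)" by (cases l)
  have \<phi>: "dfn L (n + m) (\<lambda>N a. sat_tuple N a \<phi>)" using Cons.prems(2) l by (auto intro: dfn_formula)
  define R1 where "R1 N s = sat_tuple N (take n (drop (K + m) s) @ take m (drop K s)) \<phi>"
    for N :: "('f, 'r, 'm) struct" and s
  define R0 where "R0 N s = R N (take K (drop 0 s) @ take n (drop (K + m) s))"
    for N :: "('f, 'r, 'm) struct" and s
  have R1: "dfn L (K + m + n) R1" unfolding R1_def by (rule dfn_slices2[OF \<phi>]) auto
  have R0: "dfn L (K + m + n) R0" unfolding R0_def by (rule dfn_slices2[OF Cons.prems(1)]) auto
  have w: "\<And>\<phi> m. (\<phi>, m) \<in> set w \<Longrightarrow> \<phi> \<in> formulas L (n + m)" using Cons.prems(2) by simp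
  have "dfn L (K + m) (\<lambda>N q. btree N n w {x \<in> tuples N n. R0 N (q @ x) \<and> R1 N (q @ x)} \<and>
     btree N n w {x \<in> tuples N n. R0 N (q @ x) \<and> \<not> R1 N (q @ x)})"
    by (intro dfn_conj Cons.IH dfn_not R0 R1 w)
  then have "dfn L K (\<lambda>N p. \<exists>c\<in>tuples N m. btree N n w {x \<in> tuples N n. R0 N ((p @ c) @ x) \<and> R1 N ((p @ c) @ x)} \<and>
     btree N n w {x \<in> tuples N n. R0 N ((p @ c) @ x) \<and> \<not> R1 N ((p @ c) @ x)})" by (rule dfn_ex)
  then show ?case
  proof (rule dfn_cong)
    fix N :: "('f, 'r, 'm) struct" and p assume p: "p \<in> tuples N K"
    have "{x \<in> tuples N n. R0 N ((p @ c) @ x) \<and> R1 N ((p @ c) @ x)} =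
        {x \<in> tuples N n. R N (p @ x)} \<inter> {a. sat_tuple N (a @ c) \<phi>}"
      "{x \<in> tuples N n. R0 N ((p @ c) @ x) \<and> \<not> R1 N ((p @ c) @ x)} =
        {x \<in> tuples N n. R N (p @ x)} - {a. sat_tuple N (a @ c) \<phi>}" if "c \<in> tuples N m" for c
      using that p by (auto simp: R0_def R1_def tuples_def)
    then show "btree N n (l # w) {x \<in> tuples N n. R N (p @ x)} \<longleftrightarrow>
      (\<exists>c\<in>tuples N m. btree N n w {x \<in> tuples N n. R0 N ((p @ c) @ x) \<and> R1 N ((p @ c) @ x)} \<and>
        btree N n w {x \<in> tuples N n. R0 N ((p @ c) @ x) \<and> \<not> R1 N ((p @ c) @ x)})"
      unfolding l btree.simps by (intro bex_cong refl) (simp only:)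
  qed
qed

section \<open>Finite rank against dividing\<close>

text \<open>Finiteness of the Littlestone dimension (Shelah's 2-rank) of every formula.\<close>
definition stable_struct :: "('f, 'r) lang \<Rightarrow> ('f, 'r, 'm) struct \<Rightarrow> bool" where
  "stable_struct L N \<longleftrightarrow> (\<forall>n m. \<forall>\<phi> \<in> formulas L (n + m). \<exists>r. \<not> btree N n (replicate r (\<phi>, m)) (tuples N n))"

text \<open>Forgetting all levels but those with one formula leaves a binary tree for it, so
  stability bounds how often each formula occurs; there are finitely many. All branchings are
  demanded because the one that \<open>dtree_btree\<close> needs depends on
  \<open>w\<close>.\<close>

lemma dtree_bounded:
  assumes N: "is_struct L N" "stable_struct L N"
    and D: "finite D" "\<And>\<phi> m k. (\<phi>, m, k) \<in> D \<Longrightarrow> \<phi> \<in> formulas L (n + m)"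
  shows "\<exists>b. \<forall>w. set w \<subseteq> D \<longrightarrow> (\<forall>t. dtree N n w t (tuples N n)) \<longrightarrow> length w \<le> b"
proof -
  define D' where "D' = (\<lambda>(\<phi>, m, k). (\<phi>, m)) ` D"
  have "\<exists>r. \<not> btree N n (replicate r l) (tuples N n)" if "l \<in> D'" for l
    using that D(2) N(2) unfolding D'_def stable_struct_def by force
  then obtain r where r: "\<And>l. l \<in> D' \<Longrightarrow> \<not> btree N n (replicate (r l) l) (tuples N n)" by metis
  have finD': "finite D'" using D(1) by (simp add: D'_def)
  show ?thesis
  proof (intro exI allI impI)
    fix w assume w: "set w \<subseteq> D" "\<forall>t. dtree N n w t (tuples N n)"
    define w' where "w' = map (\<lambda>(\<phi>, m, k). (\<phi>, m)) w"
    have w': "set w' \<subseteq> D'" "length w' = length w" using image_mono[OF w(1)] unfolding w'_def D'_def by simp_all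
    have bt: "btree N n w' (tuples N n)"
      using dtree_btree[OF N(1), of n w] w(2) unfolding w'_def by blast
    have "count_list w' l \<le> r l" if "l \<in> D'" for l
    proof (rule ccontr)
      assume *: "\<not> ?thesis"
      have "filter ((=) l) w' = replicate (count_list w' l) l"
        using replicate_length_filter[of l w'] by (simp add: count_list_eq_length_filter)
      then have "btree N n (replicate (count_list w' l) l) (tuples N n)"
        using btree_filter[OF bt, of "(=) l"] by simp
      moreover have "r l \<le> count_list w' l" using * by simp
      ultimately show False using btree_replicate_mono r[OF that] by blast
    qed
    then have "(\<Sum>l\<in>D'. count_list w' l) \<le> (\<Sum>l\<in>D'. r l)" by (rule sum_mono)
    then show "length w \<le> (\<Sum>l\<in>D'. r l)" using sum_count_set[OF w'(1) finD'] w'(2) by simp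
  qed
qed

text \<open>Formulas over \<open>B\<close> do not fork over \<open>B\<close>: a longest sequence of labels admitting trees of every
  branching inside the formula could be prolonged by the label of one of the dividing formulas.\<close>
theorem definable_not_covered_by_dividing:
  fixes N :: "('f, 'r, 'm) struct"
  assumes N: "is_struct L N" "stable_struct L N"
    and R: "dfn L (K + n) R" and u: "set u \<subseteq> B" "length u = K" and B: "B \<subseteq> Dom N"
    and D: "finite D" "\<And>\<phi> b. (\<phi>, b) \<in> D \<Longrightarrow> \<phi> \<in> formulas L (n + length b) \<and> set b \<subseteq> Dom N \<and> divides L N B n \<phi> b"
    and x0: "x0 \<in> tuples N n" "R N (u @ x0)"
  shows "\<exists>x\<in>tuples N n. R N (u @ x) \<and> (\<forall>(\<phi>, b)\<in>D. \<not> sat_tuple N (x @ b) \<phi>)"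
proof (rule ccontr)
  assume "\<not> ?thesis"
  then have cover: "\<And>x. x \<in> tuples N n \<Longrightarrow> R N (u @ x) \<Longrightarrow> \<exists>(\<phi>, b)\<in>D. sat_tuple N (x @ b) \<phi>" by fastforce
  define X where "X = {x \<in> tuples N n. R N (u @ x)}"
  define Wit where "Wit d k c \<longleftrightarrow> (\<forall>i. c i \<in> tuples N (length (snd d)) \<and> type_of L N B (c i) = type_of L N B (snd d)) \<and>
     (\<forall>I :: nat set. finite I \<and> card I = k \<longrightarrow> \<not> (\<exists>a \<in> tuples N n. \<forall>i \<in> I. sat_tuple N (a @ c i) (fst d)))"
    for d :: "('f, 'r) fm \<times> 'm list" and k and c :: "nat \<Rightarrow> 'm list"
  have "\<exists>k c. Wit d k c" if "d \<in> D" for d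
    using D(2)[of "fst d" "snd d"] that unfolding divides_def Wit_def by simp
  then obtain kf cf where kc: "\<And>d. d \<in> D \<Longrightarrow> Wit d (kf d) (cf d)"
    by metis
  define lab where "lab d = (fst d, length (snd d), kf d)" for d
  define W where "W = {w. set w \<subseteq> lab ` D \<and> (\<forall>t. dtree N n w t X)}"
  have "X \<subseteq> tuples N n" by (auto simp: X_def)
  have lab: "\<phi> \<in> formulas L (n + m)" if "(\<phi>, m, k) \<in> lab ` D" for \<phi> m k
    using that D(2) by (auto simp: lab_def)
  obtain b where b: "\<And>w. set w \<subseteq> lab ` D \<Longrightarrow> (\<forall>t. dtree N n w t (tuples N n)) \<Longrightarrow> length w \<le> b"
    using dtree_bounded[OF N, of "lab ` D" n] D(1) lab by auto
  have bW: "length w \<le> b" if "w \<in> W" for w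
  proof (rule b)
    show "set w \<subseteq> lab ` D" using that by (simp add: W_def)
    show "\<forall>t. dtree N n w t (tuples N n)"
      using that dtree_mono[OF _ \<open>X \<subseteq> tuples N n\<close>] unfolding W_def by blast
  qed
  have "[] \<in> W" using x0 by (auto simp: W_def X_def)
  then obtain w where w: "w \<in> W" "\<And>v. v \<in> W \<Longrightarrow> length v \<le> length w"
    using ex_has_greatest_nat[of "\<lambda>w. w \<in> W" "[]" length "Suc b"] bW le_imp_less_Suc by blast
  have "\<exists>d\<in>D. \<forall>t. dtree N n w t (X \<inter> {a. sat_tuple N (a @ snd d) (fst d)})"
  proof (rule ccontr)
    assume "\<not> ?thesis"
    then have "\<forall>d\<in>D. \<exists>t. \<not> dtree N n w t (X \<inter> {a. sat_tuple N (a @ snd d) (fst d)})" by simp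
    from bchoice[OF this] obtain tf where
      tf: "\<forall>d\<in>D. \<not> dtree N n w (tf d) (X \<inter> {a. sat_tuple N (a @ snd d) (fst d)})" by (elim exE)
    \<comment> \<open>A branching above all the individual failures, so that the single piece given
      by \<open>dtree_Union\<close> contradicts its own failure.\<close>
    define t where "t = (\<Sum>d\<in>D. tf d)"
    have le: "tf d \<le> t" if "d \<in> D" for d unfolding t_def using that D(1) by (simp add: member_le_sum)
    have "X \<subseteq> (\<Union>d\<in>D. X \<inter> {a. sat_tuple N (a @ snd d) (fst d)})"
      using cover unfolding X_def by fastforce
    moreover have "D \<noteq> {}" using cover[OF x0] by auto
    ultimately have "\<exists>d\<in>D. dtree N n w t (X \<inter> {a. sat_tuple N (a @ snd d) (fst d)})"
      using w(1) D(1) by (intro dtree_Union[where S = X]) (auto simp: W_def)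
    then obtain d where d: "d \<in> D" "dtree N n w t (X \<inter> {a. sat_tuple N (a @ snd d) (fst d)})" by (elim bexE)
    show False using dtree_antimono[OF d(2) le[OF d(1)]] tf d(1) by simp
  qed
  then obtain d where d: "d \<in> D" and dt: "\<And>t. dtree N n w t (X \<inter> {a. sat_tuple N (a @ snd d) (fst d)})"
    by auto
  define \<phi> where "\<phi> = fst d"
  define c where "c = cf d"
  define m where "m = length (snd d)"
  have \<phi>: "\<phi> \<in> formulas L (n + m)" and sb: "snd d \<in> tuples N m"
    using D(2)[of \<phi> "snd d"] d by (auto simp: \<phi>_def m_def tuples_def)
  have c: "\<And>i. c i \<in> tuples N m" "\<And>i. type_of L N B (c i) = type_of L N B (snd d)"
    "\<And>I :: nat set. finite I \<Longrightarrow> card I = kf d \<Longrightarrow> \<not> (\<exists>a \<in> tuples N n. \<forall>i \<in> I. sat_tuple N (a @ c i) \<phi>)"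
    using kc[OF d] unfolding c_def \<phi>_def m_def Wit_def by auto
  \<comment> \<open>The order is \<open>b\<close>, \<open>u\<close>, \<open>x\<close>:
    \<open>type_eq_sat\<close> wants the conjugated tuple first and the parameters from
    \<open>B\<close> behind it.\<close>
  define R' where "R' N s \<longleftrightarrow> R N (take K (drop m s) @ take n (drop (m + K) s)) \<and>
    sat_tuple N (take n (drop (m + K) s) @ take m (drop 0 s)) \<phi>" for N :: "('f, 'r, 'm) struct" and s
  have R': "dfn L (m + K + n) R'"
    unfolding R'_def by (intro dfn_conj dfn_slices2[OF R] dfn_slices2[OF dfn_formula[OF \<phi>]]) auto
  have R'_eq: "{x \<in> tuples N n. R' N ((b @ u) @ x)} = X \<inter> {a. sat_tuple N (a @ b) \<phi>}"
    if "length b = m" for b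
    using u(2) that by (auto simp: R'_def X_def tuples_def)
  \<comment> \<open>That the piece cut out by \<open>\<phi>(x, b)\<close> carries a tree is a
    property of \<open>b\<close> over \<open>u\<close>, which lies in \<open>B\<close>. So the
    conjugates \<open>c i\<close> share it.\<close>
  have "dtree N n w t (X \<inter> {a. sat_tuple N (a @ c i) \<phi>})" for i t
  proof -
    have wl: "\<And>\<phi> m k. (\<phi>, m, k) \<in> set w \<Longrightarrow> \<phi> \<in> formulas L (n + m)"
      using w(1) lab unfolding W_def by blast
    have "dfn L (m + K) (\<lambda>N p. dtree N n w t {x \<in> tuples N n. R' N (p @ x)})"
      by (rule dfn_dtree[OF R']) (erule wl)
    then obtain \<psi> where \<psi>: "\<psi> \<in> formulas L (m + K)" "\<And>N p. p \<in> tuples N (m + K) \<Longrightarrow>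
        dtree N n w t {x \<in> tuples N n. R' N (p @ x)} \<longleftrightarrow> sat_tuple N p \<psi>"
      unfolding dfn_def by blast
    have uN: "u \<in> tuples N K" using u B by (auto simp: tuples_def)
    have "sat_tuple N (snd d @ u) \<psi>"
      using dt[of t] \<psi>(2)[OF tuples_append[OF sb uN]] R'_eq[of "snd d"] by (simp add: m_def \<phi>_def)
    then have "sat_tuple N (c i @ u) \<psi>"
      using type_eq_sat[OF c(2), of i \<psi> u] c(1)[of i] \<psi>(1) u by (simp add: m_def tuples_def)
    then show ?thesis
      using \<psi>(2)[OF tuples_append[OF c(1)[of i] uN]] R'_eq[of "c i"] c(1)[of i] by (simp add: tuples_def)
  qed
  moreover have "\<not> (\<exists>a \<in> tuples N n. \<forall>i\<in>I. sat_tuple N (a @ c i) \<phi>)" if "I \<subseteq> {..<t}" "card I = kf d" for I t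
    using c(3) that finite_subset[OF that(1)] by simp
  \<comment> \<open>The conjugates become the children of a new root, one level more than the
    longest list of labels in \<open>W\<close>.\<close>
  ultimately have "dtree N n ((\<phi>, m, kf d) # w) t X" for t
    unfolding dtree.simps using c(1) by (intro exI[of _ c]) simp
  moreover have "(\<phi>, m, kf d) = lab d" by (simp add: lab_def \<phi>_def m_def)
  ultimately have "(\<phi>, m, kf d) # w \<in> W" using w(1) d unfolding W_def by auto
  then show False using w(2) by force
qed

section \<open>Finite rank from counting types\<close>

text \<open>A node at level \<open>i\<close> is named by the set of levels below \<open>i\<close> at which the branch turned towards
  the formula.\<close>
lemma btree_nodes:
  assumes N: "is_struct L N" and r: "Well_order r"
  shows "finite F \<Longrightarrow> F \<subseteq> Field r \<Longrightarrow> btree N n (replicate (card F) (\<phi>, m)) S \<Longrightarrow>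
    \<exists>c. (\<forall>i Y. c i Y \<in> tuples N m) \<and>
      (\<forall>X. \<exists>x\<in>S. \<forall>i\<in>F. sat_tuple N (x @ c i (X \<inter> F \<inter> underS r i)) \<phi> \<longleftrightarrow> i \<in> X)"
proof (induction "card F" arbitrary: F S)
  case 0
  then have "F = {}" "S \<noteq> {}" by auto
  moreover obtain a where "a \<in> tuples N m" using tuples_nonempty[OF N] by blast
  ultimately show ?case by (intro exI[of _ "\<lambda>_ _. a"]) auto
next
  case (Suc k)
  have wo: "wo_rel r" using r by (simp add: wo_rel_def)
  have "F \<noteq> {}" using Suc.hyps(2) by auto
  \<comment> \<open>The least level of \<open>F\<close> becomes the root, since it lies below every
    other level and so occurs in the names of all their nodes on the positive side.\<close>
  define i0 where "i0 = wo_rel.minim r F"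
  have i0: "i0 \<in> F" "\<And>j. j \<in> F \<Longrightarrow> (i0, j) \<in> r"
    unfolding i0_def using wo_rel.minim_in[OF wo Suc.prems(2) \<open>F \<noteq> {}\<close>]
      wo_rel.minim_least[OF wo Suc.prems(2)] by auto
  define F' where "F' = F - {i0}"
  have F': "k = card F'" "finite F'" "F' \<subseteq> Field r"
    using Suc.hyps(2) Suc.prems i0(1) by (auto simp: F'_def)
  have under: "i0 \<in> underS r j" if "j \<in> F'" for j using i0(2)[of j] that by (auto simp: F'_def underS_def)
  have card: "card F = Suc (card F')" using F'(1) Suc.hyps(2) by simp
  obtain c0 where c0: "c0 \<in> tuples N m"
    "btree N n (replicate (card F') (\<phi>, m)) (S \<inter> {a. sat_tuple N (a @ c0) \<phi>})"
    "btree N n (replicate (card F') (\<phi>, m)) (S - {a. sat_tuple N (a @ c0) \<phi>})"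
    using Suc.prems(3) unfolding card replicate.simps btree.simps by (elim bexE conjE)
  obtain c1 where c1: "\<And>i Y. c1 i Y \<in> tuples N m"
    "\<And>X. \<exists>x\<in>S \<inter> {a. sat_tuple N (a @ c0) \<phi>}. \<forall>i\<in>F'. sat_tuple N (x @ c1 i (X \<inter> F' \<inter> underS r i)) \<phi> \<longleftrightarrow> i \<in> X"
    using Suc.hyps(1)[OF F' c0(2)] by blast
  obtain c2 where c2: "\<And>i Y. c2 i Y \<in> tuples N m"
    "\<And>X. \<exists>x\<in>S - {a. sat_tuple N (a @ c0) \<phi>}. \<forall>i\<in>F'. sat_tuple N (x @ c2 i (X \<inter> F' \<inter> underS r i)) \<phi> \<longleftrightarrow> i \<in> X"
    using Suc.hyps(1)[OF F' c0(3)] by blast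
  \<comment> \<open>Membership of \<open>i0\<close> in the name \<open>Y\<close> tells the side of
    the root. It is removed before asking the positive subtree, whose names only use levels of
    \<open>F'\<close>.\<close>
  define c where "c i Y = (if i = i0 then c0 else if i0 \<in> Y then c1 i (Y - {i0}) else c2 i Y)" for i Y
  have "\<exists>x\<in>S. \<forall>i\<in>F. sat_tuple N (x @ c i (X \<inter> F \<inter> underS r i)) \<phi> \<longleftrightarrow> i \<in> X" for X
  proof (cases "i0 \<in> X")
    case True
    obtain x where x: "x \<in> S" "sat_tuple N (x @ c0) \<phi>"
      "\<And>i. i \<in> F' \<Longrightarrow> sat_tuple N (x @ c1 i (X \<inter> F' \<inter> underS r i)) \<phi> \<longleftrightarrow> i \<in> X"
      using c1(2)[of X] by blast
    have "c i (X \<inter> F \<inter> underS r i) = c1 i (X \<inter> F' \<inter> underS r i)" if "i \<in> F'" for i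
    proof -
      have "i0 \<in> X \<inter> F \<inter> underS r i" using True i0(1) under[OF that] by simp
      moreover have "X \<inter> F \<inter> underS r i - {i0} = X \<inter> F' \<inter> underS r i" by (auto simp: F'_def)
      moreover have "i \<noteq> i0" using that by (simp add: F'_def)
      ultimately show ?thesis unfolding c_def by (simp only: if_True if_False)
    qed
    then have "sat_tuple N (x @ c i (X \<inter> F \<inter> underS r i)) \<phi> \<longleftrightarrow> i \<in> X" if "i \<in> F" for i
      using x(2) x(3)[of i] True that by (cases "i = i0") (simp_all add: F'_def c_def)
    then show ?thesis using x(1) by blast
  next
    case False
    obtain x where x: "x \<in> S" "\<not> sat_tuple N (x @ c0) \<phi>"
      "\<And>i. i \<in> F' \<Longrightarrow> sat_tuple N (x @ c2 i (X \<inter> F' \<inter> underS r i)) \<phi> \<longleftrightarrow> i \<in> X"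
      using c2(2)[of X] by blast
    have "c i (X \<inter> F \<inter> underS r i) = c2 i (X \<inter> F' \<inter> underS r i)" if "i \<in> F'" for i
    proof -
      have "i0 \<notin> X \<inter> F \<inter> underS r i" using False by simp
      moreover have "X \<inter> F \<inter> underS r i = X \<inter> F' \<inter> underS r i" using False by (auto simp: F'_def)
      moreover have "i \<noteq> i0" using that by (simp add: F'_def)
      ultimately show ?thesis unfolding c_def by (simp only: if_True if_False)
    qed
    then have "sat_tuple N (x @ c i (X \<inter> F \<inter> underS r i)) \<phi> \<longleftrightarrow> i \<in> X" if "i \<in> F" for i
      using x(2) x(3)[of i] False that by (cases "i = i0") (simp_all add: F'_def c_def)
    then show ?thesis using x(1) by blast
  qed
  moreover have "c i Y \<in> tuples N m" for i Y using c0(1) c1(1) c2(1) by (simp add: c_def)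
  ultimately show ?case by blast
qed

text \<open>The classical choice of the least exponent: a binary tree of height \<open>K\<close>
  then has more than \<open>lam\<close> branches, although each level has at most \<open>lam\<close>
  nodes.\<close>

lemma minimal_exponent:
  assumes "Card_order lam"
  obtains K :: "'l set" where "lam <o |Pow K|" "|K| \<le>o lam"
    "\<And>i. i \<in> K \<Longrightarrow> |Pow (underS |K| i)| \<le>o (lam :: 'l rel)"
proof -
  define R where "R = {|K| | K :: 'l set. lam <o |Pow K|}"
  have Field: "|Field lam| =o lam" "lam =o |Field lam|"
    using card_of_Field_ordIso[OF assms] ordIso_symmetric by auto
  have "lam <o |Pow (Field lam)|" using Field(2) card_of_Pow ordIso_ordLess_trans by blast
  then have mem: "|Field lam| \<in> R" unfolding R_def by blast
  have "\<forall>r\<in>R. Card_order r" unfolding R_def by (auto simp: card_of_Card_order)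
  then obtain r0 where r0: "r0 \<in> R" "\<And>r. r \<in> R \<Longrightarrow> r0 \<le>o r"
    using exists_minim_Card_order[of R] mem by blast
  then obtain K where K: "r0 = |K|" "lam <o |Pow K|" by (auto simp: R_def)
  have "|Pow (underS |K| i)| \<le>o lam" if "i \<in> K" for i
  proof -
    have lt: "|underS |K| i| <o |K|" by (rule card_of_underS[OF card_of_Card_order]) (simp add: that Field_card_of)
    have "\<not> lam <o |Pow (underS |K| i)|"
    proof
      assume "lam <o |Pow (underS |K| i)|"
      then have "|K| \<le>o |underS |K| i|" using r0(2) K(1) unfolding R_def by blast
      then show False using lt not_ordLess_ordLeq by blast
    qed
    then show ?thesis using assms card_of_Well_order[of "Pow (underS |K| i)"] not_ordLess_iff_ordLeq[of "|Pow (underS |K| i)|" lam]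
      by (simp add: card_order_on_def)
  qed
  moreover have "|K| \<le>o lam" using r0(2)[OF mem] K(1) Field(1) ordLeq_ordIso_trans by blast
  ultimately show thesis using that K(2) by blast
qed

text \<open>An ultrafilter on tuples decides every formula. The family \<open>G\<close> may also
  prescribe that formulas fail, which is how the types of different branches are kept apart.\<close>

lemma type_exists:
  fixes N :: "('f, 'r, 'm) struct" and G :: "('m list \<Rightarrow> bool) set"
  assumes "\<And>X. X \<subseteq> G \<Longrightarrow> finite X \<Longrightarrow> \<exists>x\<in>tuples N n. \<forall>P\<in>X. P x"
  obtains p where "p \<in> types L N A n"
    "\<And>\<chi>. \<chi> \<in> formulas (with_params L A) n \<Longrightarrow> (\<lambda>x. sat_tuple (expand N id) x \<chi>) \<in> G \<Longrightarrow> \<chi> \<in> p"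
    "\<And>\<chi>. (\<lambda>x. \<not> sat_tuple (expand N id) x \<chi>) \<in> G \<Longrightarrow> \<chi> \<notin> p"
proof -
  have fip: "\<exists>x. \<forall>P\<in>X. P x" if X: "X \<subseteq> insert (\<lambda>x. x \<in> tuples N n) G" "finite X" for X
  proof -
    have "X - {\<lambda>x. x \<in> tuples N n} \<subseteq> G" "finite (X - {\<lambda>x. x \<in> tuples N n})" using X by auto
    from assms[OF this] show ?thesis by auto
  qed
  obtain U :: "'m list filter" where U: "U \<noteq> bot" "\<And>P. P \<in> insert (\<lambda>x. x \<in> tuples N n) G \<Longrightarrow> eventually P U"
    "\<And>P. eventually P U \<or> eventually (\<lambda>i. \<not> P i) U"
    by (rule ultrafilter_exists[of "insert (\<lambda>x. x \<in> tuples N n) G"]) (erule fip, assumption, rule that)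
  define p where "p = {\<chi> \<in> formulas (with_params L A) n. eventually (\<lambda>x. sat_tuple (expand N id) x \<chi>) U}"
  show thesis
  proof (rule that[of p])
    show "p \<in> types L N A n" unfolding types_def mem_Collect_eq
    proof (intro conjI allI impI ballI)
      fix q assume q: "q \<subseteq> p" "finite q"
      have "\<forall>\<^sub>F x in U. \<forall>\<chi>\<in>q. sat_tuple (expand N id) x \<chi>"
        using q by (intro eventually_ball_finite) (auto simp: p_def)
      moreover have "\<forall>\<^sub>F x in U. x \<in> tuples N n" by (rule U(2)) simp
      ultimately have "\<forall>\<^sub>F x in U. x \<in> tuples N n \<and> (\<forall>\<chi>\<in>q. sat_tuple (expand N id) x \<chi>)"
        by (simp add: eventually_conj)
      then show "\<exists>a\<in>tuples N n. \<forall>\<phi>\<in>q. sat_tuple (expand N id) a \<phi>"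
        using eventually_happens'[OF U(1)] by blast
    next
      fix \<chi> assume \<chi>: "\<chi> \<in> formulas (with_params L A) n"
      show "\<chi> \<in> p \<or> Neg \<chi> \<in> p"
        using U(3)[of "\<lambda>x. sat_tuple (expand N id) x \<chi>"] \<chi> by (auto simp: p_def formulas_def)
    qed (auto simp: p_def)
    show "\<chi> \<in> p" if "\<chi> \<in> formulas (with_params L A) n" "(\<lambda>x. sat_tuple (expand N id) x \<chi>) \<in> G" for \<chi>
      unfolding p_def using that U(2) by simp
    show "\<chi> \<notin> p" if "(\<lambda>x. \<not> sat_tuple (expand N id) x \<chi>) \<in> G" for \<chi>
    proof
      assume "\<chi> \<in> p"
      then have "\<forall>\<^sub>F x in U. sat_tuple (expand N id) x \<chi>" by (simp add: p_def)
      moreover have "\<forall>\<^sub>F x in U. \<not> sat_tuple (expand N id) x \<chi>" by (rule U(2)) (use that in simp)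
      ultimately have "\<forall>\<^sub>F x in U. False" by eventually_elim simp
      then show False using U(1) by (simp add: trivial_limit_def)
    qed
  qed
qed

text \<open>Compactness stretches trees of all finite heights to one of height \<open>K\<close>. Its
  at most \<open>lam\<close> nodes supply the parameters, and its more than \<open>lam\<close>
  branches give distinct types over them.\<close>

lemma no_big_tree:
  fixes M :: "('f, 'r, 'm) struct" and lam :: "'l rel"
  assumes lam: "Cinfinite lam" and big: "lam <o |UNIV :: 'm set|"
    and L: "theory_card L \<le>o lam" and T: "T \<subseteq> sentences L" and stable: "stable_in TYPE('m) L T lam"
    and M: "model L T M" "|Dom M| \<le>o lam" and \<phi>: "\<phi> \<in> formulas L (n + m)"
  shows "\<exists>r. \<not> btree M n (replicate r (\<phi>, m)) (tuples M n)"
proof (rule ccontr)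
  assume "\<not> ?thesis"
  then have tree: "\<And>r. btree M n (replicate r (\<phi>, m)) (tuples M n)" by blast
  have Ms: "is_struct L M" using M(1) by (simp add: model_def)
  have co: "Card_order lam" using lam by simp
  obtain K :: "'l set" where K: "lam <o |Pow K|" "|K| \<le>o lam" "\<And>i. i \<in> K \<Longrightarrow> |Pow (underS |K| i)| \<le>o lam"
    using minimal_exponent[OF co] by metis
  define r where "r = |K|"
  have r: "Well_order r" "Field r = K" unfolding r_def by (rule card_of_Well_order) (rule Field_card_of)
  \<comment> \<open>A node is a level with the set of earlier levels at which the branch turned to
    the formula. By minimality of \<open>K\<close> there are at most \<open>lam\<close> of
    them.\<close>
  define V where "V = (SIGMA i : K. Pow (underS r i))"
  define C where "C = V \<times> {..<m}"
  have "|V| \<le>o lam" unfolding V_def r_def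
    by (rule card_of_Sigma_ordLeq_infinite_Field) (use lam K in \<open>auto simp: cinfinite_def\<close>)
  then have C: "|C| \<le>o lam" unfolding C_def
    by (rule Times_ordLeq[OF lam _ finite_ordLeq[OF lam finite_lessThan]])
  define Q where "Q X il N s \<longleftrightarrow> (\<exists>x\<in>tuples N n. \<forall>j\<in>{..<length il}.
      sat_tuple N (x @ take m (drop (j * m) s)) \<phi> \<longleftrightarrow> il ! j \<in> X)"
    for X :: "'l set" and il and N :: "('f, 'r, 'm) struct" and s
  have im: "j * m + m \<le> t * m" if "j < t" for j t :: nat
    using that by (metis Suc_leI add.commute mult_Suc mult_le_mono1)
  have "dfn L (length il * m) (Q X il)" for X il
  proof -
    let ?k = "length il * m"
    have dd: "dfn L (?k + n) (\<lambda>N s. sat_tuple N (take n (drop ?k s) @ take m (drop (j * m) s)) \<phi>)"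
      if "j < length il" for j
      by (rule dfn_slices2[OF dfn_formula[OF \<phi>]]) (use im[OF that] in auto)
    have "dfn L (?k + n) (\<lambda>N s. \<forall>j\<in>{..<length il}.
        (il ! j \<in> X \<longrightarrow> sat_tuple N (take n (drop ?k s) @ take m (drop (j * m) s)) \<phi>) \<and>
        (il ! j \<notin> X \<longrightarrow> \<not> sat_tuple N (take n (drop ?k s) @ take m (drop (j * m) s)) \<phi>))"
      by (intro dfn_ball dfn_conj dfn_imp dfn_const dfn_not dd) auto
    then have "dfn L ?k (\<lambda>N s. \<exists>x\<in>tuples N n. \<forall>j\<in>{..<length il}.
        (il ! j \<in> X \<longrightarrow> sat_tuple N (take n (drop ?k (s @ x)) @ take m (drop (j * m) (s @ x))) \<phi>) \<and>
        (il ! j \<notin> X \<longrightarrow> \<not> sat_tuple N (take n (drop ?k (s @ x)) @ take m (drop (j * m) (s @ x))) \<phi>))"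
      by (rule dfn_ex)
    then show ?thesis
    proof (rule dfn_cong)
      fix N :: "('f, 'r, 'm) struct" and s assume s: "s \<in> tuples N ?k"
      have "take n (drop ?k (s @ x)) @ take m (drop (j * m) (s @ x)) = x @ take m (drop (j * m) s)"
        if "x \<in> tuples N n" "j < length il" for x j
        using s that im[of j "length il"] by (simp add: tuples_def)
      then show "Q X il N s \<longleftrightarrow> (\<exists>x\<in>tuples N n. \<forall>j\<in>{..<length il}.
        (il ! j \<in> X \<longrightarrow> sat_tuple N (take n (drop ?k (s @ x)) @ take m (drop (j * m) (s @ x))) \<phi>) \<and>
        (il ! j \<notin> X \<longrightarrow> \<not> sat_tuple N (take n (drop ?k (s @ x)) @ take m (drop (j * m) (s @ x))) \<phi>))"
        unfolding Q_def by (intro bex_cong ball_cong refl) auto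
    qed
  qed
  then have ex: "\<exists>\<theta>. \<theta> \<in> formulas L (length il * m) \<and> (\<forall>N. \<forall>s\<in>tuples N (length il * m). Q X il N s \<longleftrightarrow> sat_tuple N s \<theta>)"
    for X il unfolding dfn_def by blast
  define \<theta> where "\<theta> X il = (SOME \<theta>. \<theta> \<in> formulas L (length il * m) \<and>
    (\<forall>N. \<forall>s\<in>tuples N (length il * m). Q X il N s \<longleftrightarrow> sat_tuple N s \<theta>))" for X il
  have \<theta>: "\<theta> X il \<in> formulas L (length il * m)"
    "s \<in> tuples N (length il * m) \<Longrightarrow> Q X il N s \<longleftrightarrow> sat_tuple N s (\<theta> X il)" for X il N s
    using someI_ex[OF ex[of il X]] unfolding \<theta>_def[symmetric] by simp_all
  \<comment> \<open>The constants for the nodes that the branch \<open>X\<close> passes at the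
    levels \<open>il\<close>, in the order in which \<open>Q\<close> cuts its tuple into
    pieces.\<close>
  define names :: "'l set \<Rightarrow> 'l list \<Rightarrow> ('m + ('l \<times> 'l set) \<times> nat) list" where "names X il = concat (map (\<lambda>j. map (\<lambda>t. Inr ((il ! j, X \<inter> underS r (il ! j)), t)) [0..<m]) [0..<length il])"
    for X :: "'l set" and il :: "'l list"
  define hc where "hc h i Y = map (\<lambda>t. h ((i, Y), t)) [0..<m]" for h :: "('l \<times> 'l set) \<times> nat \<Rightarrow> 'm" and i Y
  have map_names: "map (case_sum id h) (names X il) =
      concat (map (\<lambda>j. hc h (il ! j) (X \<inter> underS r (il ! j))) [0..<length il])" for h X il
    by (simp add: names_def hc_def map_concat comp_def)
  have hc_len: "length (hc h i Y) = m" for h i Y by (simp add: hc_def)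
  have hC: "hc h i Y \<in> tuples N m" if "h ` C \<subseteq> Dom N" "i \<in> K" "Y \<subseteq> underS r i" for h i Y and N :: "('f, 'r, 'm) struct"
    using that by (force simp: hc_def tuples_def C_def V_def)
  have sat_names: "sat_tuple N (map (case_sum id h) (names X il)) (\<theta> X il) \<longleftrightarrow>
     (\<exists>x\<in>tuples N n. \<forall>i\<in>set il. sat_tuple N (x @ hc h i (X \<inter> underS r i)) \<phi> \<longleftrightarrow> i \<in> X)"
    if h: "h ` C \<subseteq> Dom N" and il: "set il \<subseteq> K" for h X il and N :: "('f, 'r, 'm) struct"
  proof -
    let ?s = "map (case_sum id h) (names X il)"
    have "set (hc h (il ! j) (X \<inter> underS r (il ! j))) \<subseteq> Dom N" if "j < length il" for j
      using hC[OF h, of "il ! j" "X \<inter> underS r (il ! j)"] il nth_mem[OF that] by (auto simp: tuples_def)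
    then have "set ?s \<subseteq> Dom N" unfolding map_names by (simp add: UN_subset_iff)
    moreover have "length ?s = length il * m"
      unfolding map_names by (simp add: length_concat comp_def hc_len sum_list_triv)
    ultimately have "?s \<in> tuples N (length il * m)" by (simp add: tuples_def)
    then have "sat_tuple N ?s (\<theta> X il) \<longleftrightarrow> Q X il N ?s" using \<theta>(2) by simp
    also have "\<dots> \<longleftrightarrow> (\<exists>x\<in>tuples N n. \<forall>j\<in>{..<length il}.
        sat_tuple N (x @ hc h (il ! j) (X \<inter> underS r (il ! j))) \<phi> \<longleftrightarrow> il ! j \<in> X)"
      unfolding Q_def map_names
    proof (intro bex_cong ball_cong refl)
      fix x j assume "j \<in> {..<length il}"
      then have "take m (drop (j * m) (concat (map (\<lambda>j. hc h (il ! j) (X \<inter> underS r (il ! j))) [0..<length il]))) =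
          hc h (il ! j) (X \<inter> underS r (il ! j))"
        by (intro concat_slice) (simp_all add: hc_len)
      then show "(sat_tuple N (x @ take m (drop (j * m) (concat (map (\<lambda>j. hc h (il ! j) (X \<inter> underS r (il ! j))) [0..<length il])))) \<phi>
          \<longleftrightarrow> il ! j \<in> X) \<longleftrightarrow> (sat_tuple N (x @ hc h (il ! j) (X \<inter> underS r (il ! j))) \<phi> \<longleftrightarrow> il ! j \<in> X)"
        by (simp only:)
    qed
    also have "\<dots> \<longleftrightarrow> (\<exists>x\<in>tuples N n. \<forall>i\<in>set il. sat_tuple N (x @ hc h i (X \<inter> underS r i)) \<phi> \<longleftrightarrow> i \<in> X)"
      by (intro bex_cong refl) (auto simp: all_set_conv_all_nth)
    finally show ?thesis .
  qed
  \<comment> \<open>Only finite pieces of branches are asked to be realized, as these are single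
    formulas. Whole branches become types afterwards.\<close>
  define \<Gamma> :: "(('f, 'r) fm \<times> ('m + ('l \<times> 'l set) \<times> nat) list) set"
    where "\<Gamma> = (\<lambda>(X, il). (\<theta> X il, names X il)) ` (Pow K \<times> lists K)"
  have names_len: "length (names X il) = length il * m" for X il
    by (simp add: names_def length_concat comp_def sum_list_triv)
  have names_C: "set (names X il) \<subseteq> Dom M <+> C" if "set il \<subseteq> K" for X il
    using that by (auto simp: names_def C_def V_def)
  have "\<exists>h. h ` C \<subseteq> Dom M \<and> (\<forall>(\<phi>, a)\<in>\<Gamma>0. sat_tuple M (map (case_sum id h) a) \<phi>)"
    if \<Gamma>0: "\<Gamma>0 \<subseteq> \<Gamma>" "finite \<Gamma>0" for \<Gamma>0
  proof -
    obtain P where P: "P \<subseteq> Pow K \<times> lists K" "finite P" "\<Gamma>0 = (\<lambda>(X, il). (\<theta> X il, names X il)) ` P"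
      using finite_subset_image[OF \<Gamma>0(2) \<Gamma>0(1)[unfolded \<Gamma>_def]] by auto
    define F where "F = (\<Union>(X, il)\<in>P. set il)"
    have F: "finite F" "F \<subseteq> Field r" using P(1,2) by (auto simp: F_def r(2))
    obtain c where c: "\<And>i Y. c i Y \<in> tuples M m"
      "\<And>X. \<exists>x\<in>tuples M n. \<forall>i\<in>F. sat_tuple M (x @ c i (X \<inter> F \<inter> underS r i)) \<phi> \<longleftrightarrow> i \<in> X"
      using btree_nodes[OF Ms r(1) F tree] by blast
    \<comment> \<open>When only the levels in \<open>F\<close> are in play, a node of the infinite
      tree is represented by the node of the finite tree named by
      \<open>Y \<inter> F\<close>.\<close>
    define h where "h = (\<lambda>((i, Y), t). c i (Y \<inter> F) ! t)"
    have h: "h ` C \<subseteq> Dom M" using tuples_nth[OF c(1)] by (auto simp: h_def C_def)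
    have hc: "hc h i Y = c i (Y \<inter> F)" for i Y
      using c(1)[of i "Y \<inter> F"] map_nth[of "c i (Y \<inter> F)"] by (simp add: hc_def h_def tuples_def)
    have "sat_tuple M (map (case_sum id h) (names X il)) (\<theta> X il)" if "(X, il) \<in> P" for X il
    proof (subst sat_names[OF h])
      show il: "set il \<subseteq> K" using P(1) that by auto
      obtain x where "x \<in> tuples M n" "\<forall>i\<in>F. sat_tuple M (x @ c i (X \<inter> F \<inter> underS r i)) \<phi> \<longleftrightarrow> i \<in> X"
        using c(2)[of X] by (elim bexE)
      moreover have "set il \<subseteq> F" using that by (auto simp: F_def)
      moreover have "X \<inter> F \<inter> underS r i = X \<inter> underS r i \<inter> F" for i by auto
      ultimately show "\<exists>x\<in>tuples M n. \<forall>i\<in>set il. sat_tuple M (x @ hc h i (X \<inter> underS r i)) \<phi> \<longleftrightarrow> i \<in> X"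
        unfolding hc by (intro bexI[of _ x]) auto
    qed
    then show ?thesis using h P(3) by (intro exI[of _ h]) auto
  qed
  note fin = this
  obtain N :: "('f, 'r, 'm) struct" and h where N: "elem_sub L M N" "|Dom N| \<le>o lam" "h ` C \<subseteq> Dom N"
    "\<And>\<psi> a. (\<psi>, a) \<in> \<Gamma> \<Longrightarrow> sat_tuple N (map (case_sum id h) a) \<psi>"
  proof (rule compactness[OF Ms lam big L M(2) C, of \<Gamma>])
    fix \<psi> a assume "(\<psi>, a) \<in> \<Gamma>"
    then obtain X il where "\<psi> = \<theta> X il" "a = names X il" "set il \<subseteq> K" by (auto simp: \<Gamma>_def)
    then show "\<psi> \<in> formulas L (length a) \<and> set a \<subseteq> Dom M <+> C"
      using \<theta>(1)[of X il] names_len[of X il] names_C[of il X] by simp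
  qed (erule fin, assumption, rule that)
  have branch: "\<exists>x\<in>tuples N n. \<forall>i\<in>I. sat_tuple N (x @ hc h i (X \<inter> underS r i)) \<phi> \<longleftrightarrow> i \<in> X"
    if X: "X \<subseteq> K" "I \<subseteq> K" "finite I" for X I
  proof -
    obtain il where il: "set il = I" using finite_list[OF X(3)] by blast
    have "(\<theta> X il, names X il) \<in> \<Gamma>" unfolding \<Gamma>_def using X il by auto
    from N(4)[OF this] sat_names[OF N(3)] show ?thesis using il X(2) by simp
  qed
  define A where "A = h ` C"
  have A: "A \<subseteq> Dom N" "|A| \<le>o lam" using N(3) image_ordLeq[OF C] by (auto simp: A_def)
  have hA: "set (hc h i Y) \<subseteq> A" if "i \<in> K" "Y \<subseteq> underS r i" for i Y
    using that by (auto simp: hc_def A_def C_def V_def)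
  have ex: "\<exists>\<chi>. \<chi> \<in> formulas (with_params L A) n \<and>
      (\<forall>x. length x = n \<longrightarrow> (sat_tuple (expand N id) x \<chi> \<longleftrightarrow> sat_tuple N (x @ hc h i Y) \<phi>))"
    if "i \<in> K" "Y \<subseteq> underS r i" for i Y
  proof -
    have "set (hc h i Y) \<subseteq> A" by (rule hA[OF that])
    moreover have "\<phi> \<in> formulas L (n + length (hc h i Y))" using \<phi> by (simp add: hc_len)
    ultimately obtain \<chi> where "\<chi> \<in> formulas (with_params L A) n"
      "\<And>(N :: ('f, 'r, 'm) struct) f a. length a = n \<Longrightarrow>
       sat_tuple (expand N f) a \<chi> \<longleftrightarrow> sat_tuple N (a @ map f (hc h i Y)) \<phi>"
      using param[where 'm = 'm] by metis
    then show "\<exists>\<chi>. \<chi> \<in> formulas (with_params L A) n \<and>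
      (\<forall>x. length x = n \<longrightarrow> (sat_tuple (expand N id) x \<chi> \<longleftrightarrow> sat_tuple N (x @ hc h i Y) \<phi>))"
      by (intro exI[of _ \<chi>]) simp
  qed
  define \<chi> where "\<chi> i Y = (SOME \<chi>. \<chi> \<in> formulas (with_params L A) n \<and>
    (\<forall>x. length x = n \<longrightarrow> (sat_tuple (expand N id) x \<chi> \<longleftrightarrow> sat_tuple N (x @ hc h i Y) \<phi>)))" for i Y
  have \<chi>: "\<chi> i Y \<in> formulas (with_params L A) n"
    "length x = n \<Longrightarrow> sat_tuple (expand N id) x (\<chi> i Y) \<longleftrightarrow> sat_tuple N (x @ hc h i Y) \<phi>"
    if "i \<in> K" "Y \<subseteq> underS r i" for i Y x
    using someI_ex[OF ex[OF that]] unfolding \<chi>_def[symmetric] by simp_all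
  have ex_p: "\<exists>p. p \<in> types L N A n \<and> (\<forall>i\<in>K. \<chi> i (X \<inter> underS r i) \<in> p \<longleftrightarrow> i \<in> X)" if X: "X \<subseteq> K" for X
  proof -
    define G where "G = (\<lambda>i. if i \<in> X then (\<lambda>x. sat_tuple (expand N id) x (\<chi> i (X \<inter> underS r i)))
       else (\<lambda>x. \<not> sat_tuple (expand N id) x (\<chi> i (X \<inter> underS r i)))) ` K"
    have fip: "\<exists>x\<in>tuples N n. \<forall>P\<in>Z. P x" if Z: "Z \<subseteq> G" "finite Z" for Z
    proof -
      obtain I where I: "I \<subseteq> K" "finite I" "Z = (\<lambda>i. if i \<in> X then (\<lambda>x. sat_tuple (expand N id) x (\<chi> i (X \<inter> underS r i)))
       else (\<lambda>x. \<not> sat_tuple (expand N id) x (\<chi> i (X \<inter> underS r i)))) ` I"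
        using finite_subset_image[OF Z(2) Z(1)[unfolded G_def]] by auto
      obtain x where x: "x \<in> tuples N n" "\<forall>i\<in>I. sat_tuple N (x @ hc h i (X \<inter> underS r i)) \<phi> \<longleftrightarrow> i \<in> X"
        using branch[OF X I(1,2)] by (elim bexE)
      have "sat_tuple (expand N id) x (\<chi> i (X \<inter> underS r i)) \<longleftrightarrow> i \<in> X" if "i \<in> I" for i
        using \<chi>(2)[of i "X \<inter> underS r i" x] x that I(1) by (auto simp: tuples_def)
      then show ?thesis using x(1) unfolding I(3) by (intro bexI[of _ x]) auto
    qed
    obtain p where p: "p \<in> types L N A n"
      "\<And>\<chi>. \<chi> \<in> formulas (with_params L A) n \<Longrightarrow> (\<lambda>x. sat_tuple (expand N id) x \<chi>) \<in> G \<Longrightarrow> \<chi> \<in> p"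
      "\<And>\<chi>. (\<lambda>x. \<not> sat_tuple (expand N id) x \<chi>) \<in> G \<Longrightarrow> \<chi> \<notin> p"
      by (rule type_exists[of G N n L A]) (erule fip, assumption, rule that)
    have "\<chi> i (X \<inter> underS r i) \<in> p \<longleftrightarrow> i \<in> X" if i: "i \<in> K" for i
    proof (cases "i \<in> X")
      case True
      then have "(\<lambda>x. sat_tuple (expand N id) x (\<chi> i (X \<inter> underS r i))) \<in> G"
        unfolding G_def using i by (intro image_eqI[of _ _ i]) auto
      then show ?thesis using p(2) \<chi>(1)[OF i, of "X \<inter> underS r i"] True by simp
    next
      case False
      then have "(\<lambda>x. \<not> sat_tuple (expand N id) x (\<chi> i (X \<inter> underS r i))) \<in> G"
        unfolding G_def using i by (intro image_eqI[of _ _ i]) auto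
      then show ?thesis using p(3) False by simp
    qed
    then show ?thesis using p(1) by blast
  qed
  define p where "p X = (SOME p. p \<in> types L N A n \<and> (\<forall>i\<in>K. \<chi> i (X \<inter> underS r i) \<in> p \<longleftrightarrow> i \<in> X))" for X
  have p: "p X \<in> types L N A n" "i \<in> K \<Longrightarrow> \<chi> i (X \<inter> underS r i) \<in> p X \<longleftrightarrow> i \<in> X" if "X \<subseteq> K" for X i
    using someI_ex[OF ex_p[OF that]] unfolding p_def[symmetric] by simp_all
  have "inj_on p (Pow K)"
  proof (rule inj_onI, rule ccontr)
    fix X Y assume XY: "X \<in> Pow K" "Y \<in> Pow K" "p X = p Y" "X \<noteq> Y"
    have wo: "wo_rel r" using r by (simp add: wo_rel_def)
    \<comment> \<open>At the first level where \<open>X\<close> and \<open>Y\<close> differ both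
      branches are still at the same node, so equal types would have to agree about its
      formula.\<close>
    define E where "E = (X - Y) \<union> (Y - X)"
    have E: "E \<subseteq> Field r" "E \<noteq> {}" using XY by (auto simp: E_def r(2))
    define i where "i = wo_rel.minim r E"
    have i: "i \<in> E" "\<And>j. j \<in> E \<Longrightarrow> (i, j) \<in> r"
      unfolding i_def using wo_rel.minim_in[OF wo E] wo_rel.minim_least[OF wo E(1)] by auto
    have anti: "antisym r" using wo wo_rel.ANTISYM by blast
    have "j \<notin> E" if "j \<in> underS r i" for j
      using i(2)[of j] that antisymD[OF anti] by (auto simp: underS_def)
    then have "X \<inter> underS r i = Y \<inter> underS r i" by (auto simp: E_def)
    then have "i \<in> X \<longleftrightarrow> i \<in> Y" using p(2)[of X i] p(2)[of Y i] XY i(1) E(1) r(2) by auto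
    then show False using i(1) by (auto simp: E_def)
  qed
  moreover have "p ` Pow K \<subseteq> types L N A n" using p(1) by auto
  ultimately have "|Pow K| \<le>o |types L N A n|" using card_of_ordLeq by blast
  moreover have "model L T N" using model_elem_emb[OF T M(1)] N(1) by (simp add: elem_sub_def)
  then have "|types L N A n| \<le>o lam" using stable A unfolding stable_in_def by blast
  ultimately have "|Pow K| \<le>o lam" by (rule ordLeq_transitive)
  then show False using K(1) not_ordLess_ordLeq by blast
qed

text \<open>Types are counted over a model of size at most \<open>lam\<close>, but the extensions
  that witness forking may be larger. The rank bound, being a sentence, is transferred to
  them.\<close>

theorem stable_in_imp_stable_struct:
  fixes M N :: "('f, 'r, 'm) struct" and lam :: "'l rel"
  assumes lam: "Cinfinite lam" and big: "lam <o |UNIV :: 'm set|"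
    and L: "theory_card L \<le>o lam" and T: "complete_theory TYPE('m) L T" and stable: "stable_in TYPE('m) L T lam"
    and M: "model L T M" "|Dom M| \<le>o lam" and N: "model L T N"
  shows "stable_struct L N"
  unfolding stable_struct_def
proof (intro allI ballI)
  fix n m \<phi> assume \<phi>: "\<phi> \<in> formulas L (n + m)"
  have TL: "T \<subseteq> sentences L" using T by (simp add: complete_theory_def)
  obtain r where r: "\<not> btree M n (replicate r (\<phi>, m)) (tuples M n)"
    using no_big_tree[OF lam big L TL stable M \<phi>] by blast
  have "dfn L 0 (\<lambda>(N :: ('f, 'r, 'm) struct) p. btree N n (replicate r (\<phi>, m)) {x \<in> tuples N n. True})"
    by (rule dfn_btree[OF dfn_const]) (use \<phi> in auto)
  from complete_dfn[OF T M(1) N this] r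
  show "\<exists>r. \<not> btree N n (replicate r (\<phi>, m)) (tuples N n)" by auto
qed

section \<open>Omitting a forking type\<close>

text \<open>Dividing survives the addition of dummy variables. This allows several candidate
  realizations to be treated as one tuple, with the dividing formula applied to its
  \<open>j\<close>-th block.\<close>

lemma divides_block:
  assumes "divides L N B n \<phi> b" "\<phi> \<in> formulas L (n + length b)" "j < s"
  obtains \<psi> where "\<psi> \<in> formulas L (n * s + length b)" "divides L N B (n * s) \<psi> b"
    "\<And>x c. x \<in> tuples N (n * s) \<Longrightarrow> c \<in> tuples N (length b) \<Longrightarrow>
       sat_tuple N (x @ c) \<psi> \<longleftrightarrow> sat_tuple N (take n (drop (j * n) x) @ c) \<phi>"
proof -
  have jn: "j * n + n \<le> n * s" using assms(3) by (metis Suc_leI add.commute mult.commute mult_Suc mult_le_mono1)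
  have "dfn L (n * s + length b) (\<lambda>N a. sat_tuple N (take n (drop (j * n) a) @ take (length b) (drop (n * s) a)) \<phi>)"
    by (rule dfn_slices2[OF dfn_formula[OF assms(2)]]) (use jn in auto)
  then obtain \<psi> where \<psi>: "\<psi> \<in> formulas L (n * s + length b)" "\<And>a. a \<in> tuples N (n * s + length b) \<Longrightarrow>
      sat_tuple N (take n (drop (j * n) a) @ take (length b) (drop (n * s) a)) \<phi> \<longleftrightarrow> sat_tuple N a \<psi>"
    unfolding dfn_def by blast
  have eq: "sat_tuple N (x @ c) \<psi> \<longleftrightarrow> sat_tuple N (take n (drop (j * n) x) @ c) \<phi>"
    if "x \<in> tuples N (n * s)" "c \<in> tuples N (length b)" for x c
    using \<psi>(2)[OF tuples_append[OF that]] that jn by (simp add: tuples_def)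
  have block: "take n (drop (j * n) x) \<in> tuples N n" if "x \<in> tuples N (n * s)" for x
    using that jn set_take_subset[of n "drop (j * n) x"] set_drop_subset[of "j * n" x] by (auto simp: tuples_def)
  obtain k and c :: "nat \<Rightarrow> _ list" where
    c': "\<forall>i. c i \<in> tuples N (length b) \<and> type_of L N B (c i) = type_of L N B b"
    "\<forall>K. finite K \<and> card K = k \<longrightarrow> \<not> (\<exists>a \<in> tuples N n. \<forall>i \<in> K. sat_tuple N (a @ c i) \<phi>)"
    using assms(1) unfolding divides_def by (elim exE conjE)
  have c: "\<And>i. c i \<in> tuples N (length b)" "\<And>i. type_of L N B (c i) = type_of L N B b"
    using c'(1) by auto
  have div: "divides L N B (n * s) \<psi> b" unfolding divides_def
  proof (intro exI[of _ k] exI[of _ c] conjI allI impI)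
    fix K :: "nat set" assume K: "finite K \<and> card K = k"
    show "\<not> (\<exists>a \<in> tuples N (n * s). \<forall>i \<in> K. sat_tuple N (a @ c i) \<psi>)"
    proof
      assume "\<exists>a \<in> tuples N (n * s). \<forall>i \<in> K. sat_tuple N (a @ c i) \<psi>"
      then obtain a where a: "a \<in> tuples N (n * s)" "\<forall>i \<in> K. sat_tuple N (a @ c i) \<psi>" by blast
      then have "\<forall>i \<in> K. sat_tuple N (take n (drop (j * n) a) @ c i) \<phi>" using eq[OF a(1) c(1)] by simp
      then show False using c'(2)[rule_format, OF K] block[OF a(1)] by blast
    qed
  qed (rule c)+
  show thesis by (rule that[OF \<psi>(1) div eq])
qed

text \<open>If no copy of \<open>yl\<close> avoided \<open>ms\<close>, then over \<open>g u\<close>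
  the concatenation of \<open>ms\<close> would meet every \<open>y\<close> satisfying
  \<open>P\<close> in some block. A tuple with this property exists also over \<open>u\<close> in
  \<open>M\<close> and over \<open>f u\<close> in \<open>N\<close>. There \<open>f yl\<close> is
  such a \<open>y\<close>, so the consistent formula expressing the property, over parameters in
  \<open>f\<close> A\<open>, would be covered by formulas dividing over\<close>f
  \<open>A\<close>.\<close>

lemma omit_finite:
  fixes M Mi N :: "('f, 'r, 'm) struct"
  assumes g: "pelem L M Mi U g" and f: "elem_emb L f M N" and N: "stable_struct L N"
    and A: "U \<subseteq> A" "A \<subseteq> Dom M" and D: "finite D"
    "\<And>\<phi> b. (\<phi>, b) \<in> D \<Longrightarrow> \<phi> \<in> formulas L (n + length b) \<and> set b \<subseteq> Dom N \<and> divides L N (f ` A) n \<phi> b"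
    and u: "set u \<subseteq> U" and yl: "set yl \<subseteq> Dom M"
    and \<phi>: "\<phi> \<in> formulas L (n + length ib)" "\<And>i. i \<in> set ib \<Longrightarrow> i < length u + length yl"
    and imp: "\<And>a. a \<in> tuples N n \<Longrightarrow> sat_tuple N (a @ map f (map ((!) (u @ yl)) ib)) \<phi> \<Longrightarrow>
      \<exists>(\<phi>, b)\<in>D. sat_tuple N (a @ b) \<phi>"
    and P: "finite P" "\<And>\<psi> ix. (\<psi>, ix) \<in> P \<Longrightarrow> \<psi> \<in> formulas L (length ix) \<and>
      (\<forall>i\<in>set ix. i < length u + length yl) \<and> sat_tuple M (map ((!) (u @ yl)) ix) \<psi>"
    and ms: "set ms \<subseteq> tuples Mi n"
  shows "\<exists>y\<in>tuples Mi (length yl). (\<forall>(\<psi>, ix)\<in>P. sat_tuple Mi (map ((!) (map g u @ y)) ix) \<psi>) \<and>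
    (\<forall>a\<in>set ms. \<not> sat_tuple Mi (a @ map ((!) (map g u @ y)) ib) \<phi>)"
proof (rule ccontr)
  assume no: "\<not> ?thesis"
  define s where "s = length ms"
  define lu where "lu = length u"
  define ky where "ky = length yl"
  \<comment> \<open>Makes room for the \<open>s\<close> blocks of length \<open>n\<close> between
    \<open>u\<close> and \<open>y\<close>: positions of \<open>y\<close> move up by
    \<open>n * s\<close>.\<close>
  define sh where "sh i = (if i < lu then i else i + n * s)" for i
  \<comment> \<open>The finitely many blocks jointly obstruct \<open>P\<close> over
    \<open>u\<close>. The disjunction over the blocks is written as a negated conjunction to suit
    \<open>dfn_ball\<close>.\<close>
  define R where "R N v \<longleftrightarrow> (\<forall>y\<in>tuples N ky.
      (\<forall>(\<psi>, ix)\<in>P. sat_tuple N (map ((!) (v @ y)) (map sh ix)) \<psi>) \<longrightarrow>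
      \<not> (\<forall>j\<in>{..<s}. \<not> sat_tuple N (map ((!) (v @ y)) ([lu + j * n..<lu + j * n + n] @ map sh ib)) \<phi>))"
    for N :: "('f, 'r, 'm) struct" and v
  have jn: "j * n + n \<le> n * s" if "j < s" for j
    using that by (metis Suc_leI add.commute mult.commute mult_Suc mult_le_mono1)
  have sh: "map ((!) ((u' @ x) @ y)) (map sh ix) = map ((!) (u' @ y)) ix"
    if "length u' = lu" "length x = n * s" "length y = ky" "\<And>i. i \<in> set ix \<Longrightarrow> i < lu + ky" for u' x y ix
    using that by (auto simp: sh_def nth_append)
  have block: "map ((!) ((u' @ x) @ y)) [lu + j * n..<lu + j * n + n] = take n (drop (j * n) x)"
    if "length u' = lu" "length x = n * s" "j < s" for u' x y j
    using map_nth_slice[of "lu + j * n" n "(u' @ x) @ y"] that jn[OF that(3)] by simp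
  have R_iff: "R N (u' @ x) \<longleftrightarrow> (\<forall>y\<in>tuples N ky. (\<forall>(\<psi>, ix)\<in>P. sat_tuple N (map ((!) (u' @ y)) ix) \<psi>) \<longrightarrow>
      (\<exists>j<s. sat_tuple N (take n (drop (j * n) x) @ map ((!) (u' @ y)) ib) \<phi>))"
    if ux: "length u' = lu" "length x = n * s" for N :: "('f, 'r, 'm) struct" and u' x
  proof -
    have 1: "(\<forall>(\<psi>, ix)\<in>P. sat_tuple N (map ((!) ((u' @ x) @ y)) (map sh ix)) \<psi>) \<longleftrightarrow>
      (\<forall>(\<psi>, ix)\<in>P. sat_tuple N (map ((!) (u' @ y)) ix) \<psi>)" if "length y = ky" for y
    proof (rule ball_cong[OF refl])
      fix d assume "d \<in> P"
      then show "(case d of (\<psi>, ix) \<Rightarrow> sat_tuple N (map ((!) ((u' @ x) @ y)) (map sh ix)) \<psi>) \<longleftrightarrow>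
          (case d of (\<psi>, ix) \<Rightarrow> sat_tuple N (map ((!) (u' @ y)) ix) \<psi>)"
        using sh[OF ux that, of "snd d"] P(2)[of "fst d" "snd d"]
        by (cases d) (simp add: lu_def ky_def del: map_map append_assoc)
    qed
    have 2: "map ((!) ((u' @ x) @ y)) ([lu + j * n..<lu + j * n + n] @ map sh ib) =
        take n (drop (j * n) x) @ map ((!) (u' @ y)) ib" if "length y = ky" "j < s" for y j
      unfolding map_append using block[OF ux that(2)] sh[OF ux that(1), of ib] \<phi>(2)
      by (simp add: lu_def ky_def del: map_map append_assoc)
    show ?thesis unfolding R_def
      by (intro ball_cong refl) (simp add: 1 2 tuples_def Bex_def del: map_map append_assoc map_append)
  qed
  have dR: "dfn L (lu + n * s) R" unfolding R_def
  proof (rule dfn_all, rule dfn_imp)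
    have "dfn L (lu + n * s + ky) (\<lambda>N v. case d of (\<psi>, ix) \<Rightarrow> sat_tuple N (map ((!) v) (map sh ix)) \<psi>)"
      if d: "d \<in> P" for d
    proof -
      obtain \<psi> ix where d: "d = (\<psi>, ix)" by (cases d)
      have "dfn L (lu + n * s + ky) (\<lambda>N v. sat_tuple N (map ((!) v) (map sh ix)) \<psi>)"
        by (rule dfn_map[OF dfn_formula]) (use P(2)[of \<psi> ix] \<open>d \<in> P\<close> d in \<open>auto simp: sh_def lu_def ky_def\<close>)
      then show ?thesis by (simp add: d)
    qed
    then show "dfn L (lu + n * s + ky) (\<lambda>N v. \<forall>(\<psi>, ix)\<in>P. sat_tuple N (map ((!) v) (map sh ix)) \<psi>)"
      by (rule dfn_ball[OF P(1)])
    have "dfn L (lu + n * s + ky) (\<lambda>N v. sat_tuple N (map ((!) v) ([lu + j * n..<lu + j * n + n] @ map sh ib)) \<phi>)"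
      if "j < s" for j
    proof (rule dfn_map[OF dfn_formula[OF \<phi>(1)]])
      fix i assume "i \<in> set ([lu + j * n..<lu + j * n + n] @ map sh ib)"
      then show "i < lu + n * s + ky" using jn[OF that] \<phi>(2) by (force simp: sh_def lu_def ky_def split: if_splits)
    qed simp
    then show "dfn L (lu + n * s + ky) (\<lambda>N v. \<not> (\<forall>j\<in>{..<s}. \<not> sat_tuple N (map ((!) v) ([lu + j * n..<lu + j * n + n] @ map sh ib)) \<phi>))"
      by (intro dfn_not dfn_ball) auto
  qed
  have Mi_R: "R Mi (map g u @ concat ms)"
  proof (subst R_iff)
    show len: "length (map g u) = lu" by (simp add: lu_def)
    have lms: "\<And>a. a \<in> set ms \<Longrightarrow> length a = n" using ms by (auto simp: tuples_def)
    then show "length (concat ms) = n * s" unfolding s_def by (induction ms) auto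
    have slice: "take n (drop (j * n) (concat ms)) = ms ! j" if "j < s" for j
      using concat_slice[of s "(!) ms" n j] that lms map_nth[of ms] by (simp add: s_def)
    show "\<forall>y\<in>tuples Mi ky. (\<forall>(\<psi>, ix)\<in>P. sat_tuple Mi (map ((!) (map g u @ y)) ix) \<psi>) \<longrightarrow>
      (\<exists>j<s. sat_tuple Mi (take n (drop (j * n) (concat ms)) @ map ((!) (map g u @ y)) ib) \<phi>)"
    proof (intro ballI impI)
      fix y assume y: "y \<in> tuples Mi ky" "\<forall>(\<psi>, ix)\<in>P. sat_tuple Mi (map ((!) (map g u @ y)) ix) \<psi>"
      then obtain a where "a \<in> set ms" "sat_tuple Mi (a @ map ((!) (map g u @ y)) ib) \<phi>"
        using no unfolding ky_def by blast
      then obtain j where "j < s" "sat_tuple Mi (ms ! j @ map ((!) (map g u @ y)) ib) \<phi>"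
        by (metis in_set_conv_nth s_def)
      then show "\<exists>j<s. sat_tuple Mi (take n (drop (j * n) (concat ms)) @ map ((!) (map g u @ y)) ib) \<phi>"
        using slice by (intro exI[of _ j]) simp
    qed
  qed
  have "concat ms \<in> tuples Mi (n * s)"
  proof -
    have "\<And>a. a \<in> set ms \<Longrightarrow> length a = n" using ms by (auto simp: tuples_def)
    then have "length (concat ms) = n * s" unfolding s_def by (induction ms) auto
    then show ?thesis using ms by (auto simp: tuples_def)
  qed
  \<comment> \<open>The tuples \<open>ms\<close> themselves need not have counterparts in
    \<open>M\<close>; it is only the existence of an obstructing tuple over \<open>u\<close> that is
    transported.\<close>
  then have "\<exists>x\<in>tuples Mi (n * s). R Mi (map g u @ x)" using Mi_R by blast
  moreover have dex: "dfn L lu (\<lambda>N v. \<exists>x\<in>tuples N (n * s). R N (v @ x))" by (rule dfn_ex[OF dR])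
  ultimately have "\<exists>x\<in>tuples M (n * s). R M (u @ x)"
    using pelem_dfn[OF g dex u] by (simp add: lu_def)
  moreover have uM: "u \<in> tuples M lu" using u A by (auto simp: tuples_def lu_def)
  ultimately have "\<exists>x\<in>tuples N (n * s). R N (map f u @ x)" using elem_emb_dfn[OF f dex uM] by simp
  then obtain x0 where x0: "x0 \<in> tuples N (n * s)" "R N (map f u @ x0)" by blast
  have "\<forall>d\<in>D \<times> {..<s}. \<exists>\<psi>. \<psi> \<in> formulas L (n * s + length (snd (fst d))) \<and>
    divides L N (f ` A) (n * s) \<psi> (snd (fst d)) \<and> (\<forall>x\<in>tuples N (n * s).
      sat_tuple N (x @ snd (fst d)) \<psi> \<longleftrightarrow> sat_tuple N (take n (drop (snd d * n) x) @ snd (fst d)) (fst (fst d)))"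
  proof
    fix d assume d: "d \<in> D \<times> {..<s}"
    have D': "divides L N (f ` A) n (fst (fst d)) (snd (fst d))"
      "fst (fst d) \<in> formulas L (n + length (snd (fst d)))" "snd (fst d) \<in> tuples N (length (snd (fst d)))" "snd d < s"
      using d D(2)[of "fst (fst d)" "snd (fst d)"] by (auto simp: tuples_def)
    show "\<exists>\<psi>. \<psi> \<in> formulas L (n * s + length (snd (fst d))) \<and>
    divides L N (f ` A) (n * s) \<psi> (snd (fst d)) \<and> (\<forall>x\<in>tuples N (n * s).
      sat_tuple N (x @ snd (fst d)) \<psi> \<longleftrightarrow> sat_tuple N (take n (drop (snd d * n) x) @ snd (fst d)) (fst (fst d)))"
      by (rule divides_block[OF D'(1,2,4)]) (use D'(3) in blast)
  qed
  from bchoice[OF this] obtain \<Psi> where \<Psi>: "\<And>\<phi> b j. (\<phi>, b) \<in> D \<Longrightarrow> j < s \<Longrightarrow> \<Psi> ((\<phi>, b), j) \<in> formulas L (n * s + length b)"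
    "\<And>\<phi> b j. (\<phi>, b) \<in> D \<Longrightarrow> j < s \<Longrightarrow> divides L N (f ` A) (n * s) (\<Psi> ((\<phi>, b), j)) b"
    "\<And>\<phi> b j x. (\<phi>, b) \<in> D \<Longrightarrow> j < s \<Longrightarrow> x \<in> tuples N (n * s) \<Longrightarrow>
      sat_tuple N (x @ b) (\<Psi> ((\<phi>, b), j)) \<longleftrightarrow> sat_tuple N (take n (drop (j * n) x) @ b) \<phi>"
    by fastforce
  \<comment> \<open>Every dividing formula is imposed on every block, since any block may be the one
    that meets \<open>f yl\<close>.\<close>
  define D' where "D' = (\<lambda>d. (\<Psi> d, snd (fst d))) ` (D \<times> {..<s})"
  have Ns: "is_struct L N" using elem_emb_struct[OF f] by simp
  have fA: "f ` A \<subseteq> Dom N" using f A(2) by (auto simp: elem_emb_def)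
  have "\<exists>x\<in>tuples N (n * s). R N (map f u @ x) \<and> (\<forall>(\<phi>, b)\<in>D'. \<not> sat_tuple N (x @ b) \<phi>)"
  proof (rule definable_not_covered_by_dividing[OF Ns N dR _ _ fA _ _ x0])
    show "set (map f u) \<subseteq> f ` A" using u A(1) by auto
    show "length (map f u) = lu" by (simp add: lu_def)
    show "finite D'" using D(1) by (simp add: D'_def)
    fix \<phi> b assume "(\<phi>, b) \<in> D'"
    then obtain \<phi>' j where "(\<phi>', b) \<in> D" "j < s" "\<phi> = \<Psi> ((\<phi>', b), j)" by (auto simp: D'_def)
    then show "\<phi> \<in> formulas L (n * s + length b) \<and> set b \<subseteq> Dom N \<and> divides L N (f ` A) (n * s) \<phi> b"
      using \<Psi>(1,2) D(2) by blast
  qed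
  then obtain x where x: "x \<in> tuples N (n * s)" "R N (map f u @ x)" "\<And>\<phi> b. (\<phi>, b) \<in> D' \<Longrightarrow> \<not> sat_tuple N (x @ b) \<phi>"
    by blast
  have fyl: "map f yl \<in> tuples N ky" by (rule elem_emb_tuples[OF f]) (use yl in \<open>simp add: tuples_def ky_def\<close>)
  have uyl: "map ((!) (map f u @ map f yl)) ix = map f (map ((!) (u @ yl)) ix)"
    if "\<And>i. i \<in> set ix \<Longrightarrow> i < length u + length yl" for ix
  proof -
    have "map f (u @ yl) ! i = f ((u @ yl) ! i)" if "i \<in> set ix" for i
      using \<open>\<And>i. i \<in> set ix \<Longrightarrow> i < length u + length yl\<close>[OF that] by (intro nth_map) simp
    then show ?thesis by simp
  qed
  have *: "\<forall>(\<psi>, ix)\<in>P. sat_tuple N (map ((!) (map f u @ map f yl)) ix) \<psi>"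
  proof clarify
    fix \<psi> ix assume d: "(\<psi>, ix) \<in> P"
    have ix: "\<And>i. i \<in> set ix \<Longrightarrow> i < length u + length yl" using P(2)[OF d] by simp
    have "set (u @ yl) \<subseteq> Dom M" using u A yl by auto
    then have "(u @ yl) ! i \<in> Dom M" if "i \<in> set ix" for i
      using ix[OF that] nth_mem[of i "u @ yl"] by auto
    then have ix_M: "map ((!) (u @ yl)) ix \<in> tuples M (length ix)" by (auto simp: tuples_def)
    have eq: "map ((!) (map f u @ map f yl)) ix = map f (map ((!) (u @ yl)) ix)"
      by (rule uyl) (rule ix)
    show "sat_tuple N (map ((!) (map f u @ map f yl)) ix) \<psi>"
      unfolding eq using elem_emb_sat[OF f _ ix_M, of \<psi>] P(2)[OF d] by blast
  qed
  obtain j where j: "j < s" "sat_tuple N (take n (drop (j * n) x) @ map ((!) (map f u @ map f yl)) ib) \<phi>"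
  proof -
    have "length (map f u) = lu" "length x = n * s" using x(1) by (auto simp: lu_def tuples_def)
    from x(2)[unfolded R_iff[OF this]] fyl
    have "(\<forall>(\<psi>, ix)\<in>P. sat_tuple N (map ((!) (map f u @ map f yl)) ix) \<psi>) \<longrightarrow>
      (\<exists>j<s. sat_tuple N (take n (drop (j * n) x) @ map ((!) (map f u @ map f yl)) ib) \<phi>)" by (rule bspec)
    with * that show thesis by blast
  qed
  have "take n (drop (j * n) x) \<in> tuples N n"
    using x(1) jn[OF j(1)] set_take_subset[of n "drop (j * n) x"] set_drop_subset[of "j * n" x] by (auto simp: tuples_def)
  moreover have eq: "map ((!) (map f u @ map f yl)) ib = map f (map ((!) (u @ yl)) ib)"
    by (rule uyl) (rule \<phi>(2))
  ultimately obtain \<phi>' b where b: "(\<phi>', b) \<in> D" "sat_tuple N (take n (drop (j * n) x) @ b) \<phi>'"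
    using imp[OF _ j(2)[unfolded eq]] by blast
  have "(\<Psi> ((\<phi>', b), j), b) \<in> D'" unfolding D'_def using b(1) j(1) by (intro image_eqI[of _ _ "((\<phi>', b), j)"]) auto
  then show False using x(3) \<Psi>(3)[OF b(1) j(1) x(1)] b(2) by blast
qed

lemma finite_conj_formula:
  assumes "finite q" "q \<subseteq> formulas L n"
  obtains \<chi> where "\<chi> \<in> formulas L n"
    "\<And>(N :: ('f, 'r, 'm) struct) a. a \<in> tuples N n \<Longrightarrow> sat_tuple N a \<chi> \<longleftrightarrow> (\<forall>\<psi>\<in>q. sat_tuple N a \<psi>)"
proof -
  have "dfn L n (\<lambda>(N :: ('f, 'r, 'm) struct) a. \<forall>\<psi>\<in>q. sat_tuple N a \<psi>)"
    by (rule dfn_ball[OF assms(1)]) (use assms(2) in \<open>auto intro: dfn_formula\<close>)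
  then show thesis using that unfolding dfn_def by blast
qed

text \<open>The finite part of \<open>p\<close> is conjoined and its constants are turned into
  \<open>\<beta>\<close>, so that the forking formula can be re-read at a copy of
  \<open>\<beta>\<close> in another model.\<close>

lemma forks_formula:
  fixes M :: "('f, 'r, 'm) struct"
  assumes "forks L M n p A" "p \<subseteq> formulas (with_params L A') n"
  obtains N :: "('f, 'r, 'm) struct" and f D q \<phi> \<beta> where "elem_emb L f M N" "finite D"
    "\<And>\<phi> b. (\<phi>, b) \<in> D \<Longrightarrow> \<phi> \<in> formulas L (n + length b) \<and> set b \<subseteq> Dom N \<and> divides L N (f ` A) n \<phi> b"
    "finite q" "q \<subseteq> p" "set \<beta> \<subseteq> A'" "\<phi> \<in> formulas L (n + length \<beta>)"
    "\<And>a. a \<in> tuples M n \<Longrightarrow> sat_tuple M (a @ \<beta>) \<phi> \<longleftrightarrow> (\<forall>\<psi>\<in>q. sat_tuple (expand M id) a \<psi>)"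
    "\<And>a. a \<in> tuples N n \<Longrightarrow> sat_tuple N (a @ map f \<beta>) \<phi> \<Longrightarrow> \<exists>(\<phi>, b)\<in>D. sat_tuple N (a @ b) \<phi>"
proof -
  obtain N :: "('f, 'r, 'm) struct" and f D q where 1: "elem_emb L f M N" "finite D"
     "\<forall>(\<phi>, b) \<in> D. \<phi> \<in> formulas L (n + length b) \<and> set b \<subseteq> Dom N \<and> divides L N (f ` A) n \<phi> b"
     "finite q" "q \<subseteq> p"
     "\<forall>a \<in> tuples N n. (\<forall>\<psi> \<in> q. sat_tuple (expand N f) a \<psi>) \<longrightarrow> (\<exists>(\<phi>, b) \<in> D. sat_tuple N (a @ b) \<phi>)"
    using assms(1) unfolding forks_def by blast
  have q: "q \<subseteq> formulas (with_params L A') n" using 1(5) assms(2) by blast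
  obtain \<chi> where \<chi>: "\<chi> \<in> formulas (with_params L A') n"
    "\<And>(N :: ('f + 'm, 'r, 'm) struct) a. a \<in> tuples N n \<Longrightarrow> sat_tuple N a \<chi> \<longleftrightarrow> (\<forall>\<psi>\<in>q. sat_tuple N a \<psi>)"
    using finite_conj_formula[OF 1(4) q, where 'm = 'm] by metis
  obtain \<beta> \<phi> where \<phi>: "set \<beta> \<subseteq> A'" "\<phi> \<in> formulas L (n + length \<beta>)"
    "\<And>(N :: ('f, 'r, 'm) struct) h a. length a = n \<Longrightarrow>
       sat_tuple (expand N h) a \<chi> \<longleftrightarrow> sat_tuple N (a @ map h \<beta>) \<phi>"
    using unparam[OF \<chi>(1), where 'm = 'm] by metis
  have eq: "sat_tuple N (a @ map h \<beta>) \<phi> \<longleftrightarrow> (\<forall>\<psi>\<in>q. sat_tuple (expand N h) a \<psi>)"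
    if "a \<in> tuples N n" for N :: "('f, 'r, 'm) struct" and h a
    using \<phi>(3)[of a N h] \<chi>(2)[of a "expand N h"] that by (simp add: tuples_def expand_def)
  show thesis
  proof (rule that[OF 1(1,2) _ 1(4,5) \<phi>(1,2)])
    show "\<phi> \<in> formulas L (n + length b) \<and> set b \<subseteq> Dom N \<and> divides L N (f ` A) n \<phi> b"
      if "(\<phi>, b) \<in> D" for \<phi> b using 1(3) that by blast
    show "sat_tuple M (a @ \<beta>) \<phi> \<longleftrightarrow> (\<forall>\<psi>\<in>q. sat_tuple (expand M id) a \<psi>)" if "a \<in> tuples M n" for a
      using eq[OF that, of id] by simp
    show "\<exists>(\<phi>, b)\<in>D. sat_tuple N (a @ b) \<phi>" if "a \<in> tuples N n" "sat_tuple N (a @ map f \<beta>) \<phi>" for a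
      using eq[OF that(1), of f] that 1(6) by blast
  qed
qed

text \<open>Compactness passes from avoiding finitely many tuples of \<open>Mi\<close> to avoiding
  all of them. The new copy of \<open>\<beta>\<close> then lives in an extension of
  \<open>Mi\<close> of size at most \<open>lam\<close>.\<close>

lemma omit_model:
  fixes M Mi N :: "('f, 'r, 'm) struct" and lam :: "'l rel"
  assumes lam: "Cinfinite lam" and big: "lam <o |UNIV :: 'm set|" and L: "theory_card L \<le>o lam"
    and Mi: "is_struct L Mi" "|Dom Mi| \<le>o lam"
    and g: "pelem L M Mi U g" and f: "elem_emb L f M N" and N: "stable_struct L N"
    and A: "U \<subseteq> A" "A \<subseteq> Dom M" and U: "|U| \<le>o lam" and D: "finite D"
    "\<And>\<phi> b. (\<phi>, b) \<in> D \<Longrightarrow> \<phi> \<in> formulas L (n + length b) \<and> set b \<subseteq> Dom N \<and> divides L N (f ` A) n \<phi> b"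
    and \<beta>: "set \<beta> \<subseteq> Dom M" and \<phi>: "\<phi> \<in> formulas L (n + length \<beta>)"
    and imp: "\<And>a. a \<in> tuples N n \<Longrightarrow> sat_tuple N (a @ map f \<beta>) \<phi> \<Longrightarrow> \<exists>(\<phi>, b)\<in>D. sat_tuple N (a @ b) \<phi>"
  obtains N' :: "('f, 'r, 'm) struct" and h where "elem_sub L Mi N'" "|Dom N'| \<le>o lam"
    "pelem L M N' (U \<union> set \<beta>) h" "\<And>u. u \<in> U \<Longrightarrow> h u = g u"
    "\<And>a. a \<in> tuples Mi n \<Longrightarrow> \<not> sat_tuple N' (a @ map h \<beta>) \<phi>"
proof -
  define C where "C = U \<union> set \<beta>"
  have C: "|C| \<le>o lam" unfolding C_def by (rule Un_ordLeq[OF lam U finite_ordLeq[OF lam finite_set]])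
  have CM: "C \<subseteq> Dom M" using A \<beta> by (auto simp: C_def)
  define F1 :: "('f, 'r) fm \<times> 'm list \<Rightarrow> ('f, 'r) fm \<times> ('m + 'm) list" where "F1 = (\<lambda>(\<psi>, a). (\<psi>, map Inr a))"
  define S1 where "S1 = {(\<psi>, a). set a \<subseteq> C \<and> \<psi> \<in> formulas L (length a) \<and> sat_tuple M a \<psi>}"
  define F2 :: "'m \<Rightarrow> ('f, 'r) fm \<times> ('m + 'm) list" where "F2 u = (Equal (Var 0) (Var 1), [Inr u, Inl (g u)])" for u
  define F3 :: "'m list \<Rightarrow> ('f, 'r) fm \<times> ('m + 'm) list" where "F3 a = (Neg \<phi>, map Inl a @ map Inr \<beta>)" for a
  \<comment> \<open>\<open>F1\<close> makes the interpretation elementary on \<open>C\<close>,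
    \<open>F2\<close> pins it to \<open>g\<close> on \<open>U\<close>, and \<open>F3\<close> forbids
    every tuple of \<open>Mi\<close> to realize the formula at the copy of
    \<open>\<beta>\<close>.\<close>
  define \<Gamma> where "\<Gamma> = F1 ` S1 \<union> F2 ` U \<union> F3 ` tuples Mi n"
  have gU: "g ` U \<subseteq> Dom Mi" using g by (simp add: pelem_def)
  have wf: "\<psi> \<in> formulas L (length a) \<and> set a \<subseteq> Dom Mi <+> C" if mem: "(\<psi>, a) \<in> \<Gamma>" for \<psi> a
  proof -
    consider "(\<psi>, a) \<in> F1 ` S1" | "(\<psi>, a) \<in> F2 ` U" | "(\<psi>, a) \<in> F3 ` tuples Mi n"
      using mem unfolding \<Gamma>_def by blast
    then show ?thesis
    proof cases
      case 1
      then show ?thesis by (auto simp: F1_def S1_def)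
    next
      case 2
      then show ?thesis using gU by (auto simp: F2_def formulas_def C_def)
    next
      case 3
      then show ?thesis using \<phi> by (auto simp: F3_def formulas_def tuples_def C_def)
    qed
  qed
  have fin: "\<exists>h. h ` C \<subseteq> Dom Mi \<and> (\<forall>(\<psi>, a)\<in>\<Gamma>0. sat_tuple Mi (map (case_sum id h) a) \<psi>)"
    if \<Gamma>0: "\<Gamma>0 \<subseteq> \<Gamma>" "finite \<Gamma>0" for \<Gamma>0
  proof -
    obtain P1 where P1: "P1 \<subseteq> S1" "finite P1" "\<Gamma>0 \<inter> F1 ` S1 = F1 ` P1"
      using finite_subset_image[of "\<Gamma>0 \<inter> F1 ` S1" F1 S1] \<Gamma>0(2) by auto
    obtain P3 where P3: "P3 \<subseteq> tuples Mi n" "finite P3" "\<Gamma>0 \<inter> F3 ` tuples Mi n = F3 ` P3"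
      using finite_subset_image[of "\<Gamma>0 \<inter> F3 ` tuples Mi n" F3 "tuples Mi n"] \<Gamma>0(2) by auto
    obtain ms where ms: "set ms = P3" using finite_list[OF P3(2)] by blast
    \<comment> \<open>Only finitely many elements of \<open>U\<close> are mentioned. They form
      \<open>u\<close>, with prescribed images; the elements of \<open>\<beta>\<close> outside
      \<open>U\<close> form \<open>yl\<close> and may still be moved.\<close>
    have "finite (U \<inter> ((\<Union>(\<psi>, a)\<in>P1. set a) \<union> set \<beta>))" using P1(2) by auto
    then obtain u where u: "set u = U \<inter> ((\<Union>(\<psi>, a)\<in>P1. set a) \<union> set \<beta>)" using finite_list by blast
    obtain yl where yl: "set yl = set \<beta> - U" using finite_list[of "set \<beta> - U"] by auto
    define ind where "ind c = (SOME i. i < length u + length yl \<and> (u @ yl) ! i = c)" for c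
    have ind: "ind c < length u + length yl \<and> (u @ yl) ! ind c = c" if "c \<in> set u \<union> set yl" for c
    proof -
      have "c \<in> set (u @ yl)" using that by simp
      then have "\<exists>i. i < length u + length yl \<and> (u @ yl) ! i = c" by (metis in_set_conv_nth length_append)
      then show ?thesis unfolding ind_def by (rule someI_ex)
    qed
    have indU: "ind c < length u \<and> u ! ind c = c" if "c \<in> U" "c \<in> set u" for c
    proof -
      have "ind c < length u"
      proof (rule ccontr)
        assume "\<not> ind c < length u"
        then have "c \<in> set yl" using ind[of c] that nth_mem[of "ind c - length u" yl] by (auto simp: nth_append)
        then show False using yl that by auto
      qed
      then show ?thesis using ind[of c] that by (auto simp: nth_append)
    qed
    have sub: "set a \<subseteq> set u \<union> set yl" if "(\<psi>, a) \<in> P1" for \<psi> a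
      using that P1(1) u yl by (fastforce simp: S1_def C_def)
    have sub\<beta>: "set \<beta> \<subseteq> set u \<union> set yl" using u yl by auto
    have map_ind: "map ((!) (u @ yl)) (map ind a) = a" if "set a \<subseteq> set u \<union> set yl" for a
      using that ind by (auto intro!: map_idI)
    define P where "P = (\<lambda>(\<psi>, a). (\<psi>, map ind a)) ` P1"
    have "\<exists>y\<in>tuples Mi (length yl). (\<forall>(\<psi>, ix)\<in>P. sat_tuple Mi (map ((!) (map g u @ y)) ix) \<psi>) \<and>
      (\<forall>a\<in>set ms. \<not> sat_tuple Mi (a @ map ((!) (map g u @ y)) (map ind \<beta>)) \<phi>)"
    proof (rule omit_finite[OF g f N A D])
      show "set u \<subseteq> U" using u by auto
      show "set yl \<subseteq> Dom M" using yl \<beta> by auto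
      show "\<phi> \<in> formulas L (n + length (map ind \<beta>))" using \<phi> by simp
      show "i < length u + length yl" if "i \<in> set (map ind \<beta>)" for i using that ind sub\<beta> by auto
      show "\<exists>(\<phi>, b)\<in>D. sat_tuple N (a @ b) \<phi>"
        if "a \<in> tuples N n" "sat_tuple N (a @ map f (map ((!) (u @ yl)) (map ind \<beta>))) \<phi>" for a
        using imp[OF that(1)] that(2) unfolding map_ind[OF sub\<beta>] by simp
      show "finite P" using P1(2) by (simp add: P_def)
      show "set ms \<subseteq> tuples Mi n" using ms P3(1) by simp
      fix \<psi> ix assume "(\<psi>, ix) \<in> P"
      then obtain a where a: "(\<psi>, a) \<in> P1" "ix = map ind a" by (auto simp: P_def)
      have "set a \<subseteq> set u \<union> set yl" by (rule sub[OF a(1)])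
      then show "\<psi> \<in> formulas L (length ix) \<and> (\<forall>i\<in>set ix. i < length u + length yl) \<and>
          sat_tuple M (map ((!) (u @ yl)) ix) \<psi>"
        using map_ind[of a] a P1(1) ind by (auto simp: S1_def simp del: map_map)
    qed auto
    then obtain y where y: "y \<in> tuples Mi (length yl)"
      "\<And>\<psi> ix. (\<psi>, ix) \<in> P \<Longrightarrow> sat_tuple Mi (map ((!) (map g u @ y)) ix) \<psi>"
      "\<And>a. a \<in> set ms \<Longrightarrow> \<not> sat_tuple Mi (a @ map ((!) (map g u @ y)) (map ind \<beta>)) \<phi>" by blast
    \<comment> \<open>On all of \<open>U\<close>, and not only on \<open>u\<close>, the
      interpretation follows \<open>g\<close>, as the conditions \<open>F2\<close> require.\<close>
    define h where "h c = (if c \<in> U then g c else (map g u @ y) ! ind c)" for c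
    have h: "(map g u @ y) ! ind c = h c" if "c \<in> set u \<union> set yl" for c
    proof (cases "c \<in> U")
      case True
      then have "c \<in> set u" using that yl by auto
      from indU[OF True this] show ?thesis using True by (simp add: h_def nth_append)
    qed (simp add: h_def)
    have maph: "map ((!) (map g u @ y)) (map ind a) = map h a" if "set a \<subseteq> set u \<union> set yl" for a
      using h that by auto
    have hC: "h ` C \<subseteq> Dom Mi"
    proof
      fix x assume "x \<in> h ` C"
      then obtain c where c: "c \<in> C" "x = h c" by blast
      show "x \<in> Dom Mi"
      proof (cases "c \<in> U")
        case True
        then show ?thesis using c gU by (auto simp: h_def)
      next
        case False
        then have "c \<in> set yl" using c(1) yl by (auto simp: C_def)
        then have "ind c < length (map g u @ y)" using ind[of c] y(1) by (simp add: tuples_def)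
        then have "(map g u @ y) ! ind c \<in> set (map g u @ y)" by (rule nth_mem)
        moreover have "set (map g u @ y) \<subseteq> Dom Mi" using y(1) gU u by (auto simp: tuples_def)
        ultimately show ?thesis using False c(2) by (auto simp: h_def)
      qed
    qed
    have "sat_tuple Mi (map (case_sum id h) a) \<psi>" if mem: "(\<psi>, a) \<in> \<Gamma>0" for \<psi> a
    proof -
      consider "(\<psi>, a) \<in> F1 ` P1" | "(\<psi>, a) \<in> F2 ` U" | "(\<psi>, a) \<in> F3 ` P3"
        using mem \<Gamma>0(1) P1(3) P3(3) unfolding \<Gamma>_def by blast
      then show ?thesis
      proof cases
        case 1
        then obtain b where b: "(\<psi>, b) \<in> P1" "a = map Inr b" by (auto simp: F1_def)
        have "(\<psi>, map ind b) \<in> P" using b(1) by (force simp: P_def)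
        from y(2)[OF this, unfolded maph[OF sub[OF b(1)]]] show ?thesis using b(2) by (simp add: comp_def)
      next
        case 2
        then show ?thesis by (auto simp: F2_def h_def)
      next
        case 3
        then obtain b where b: "b \<in> P3" "a = map Inl b @ map Inr \<beta>" "\<psi> = Neg \<phi>" by (auto simp: F3_def)
        have "\<not> sat_tuple Mi (b @ map h \<beta>) \<phi>" using y(3)[of b, unfolded maph[OF sub\<beta>]] b(1) ms by simp
        then show ?thesis using b by (simp add: comp_def)
      qed
    qed
    then show ?thesis using hC by blast
  qed
  obtain N' :: "('f, 'r, 'm) struct" and h where N': "elem_sub L Mi N'" "|Dom N'| \<le>o lam" "h ` C \<subseteq> Dom N'"
    "\<And>\<psi> a. (\<psi>, a) \<in> \<Gamma> \<Longrightarrow> sat_tuple N' (map (case_sum id h) a) \<psi>"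
    by (rule compactness[OF Mi(1) lam big L Mi(2) C, of \<Gamma>]) (erule wf, erule fin, assumption, rule that)
  have pos: "sat_tuple N' (map h a) \<psi>" if "set a \<subseteq> C" "\<psi> \<in> formulas L (length a)" "sat_tuple M a \<psi>" for a \<psi>
  proof -
    have "(\<psi>, map Inr a) \<in> \<Gamma>" using that unfolding \<Gamma>_def by (force simp: F1_def S1_def)
    from N'(4)[OF this] show ?thesis by (simp add: comp_def)
  qed
  show thesis
  proof (rule that[OF N'(1,2)])
    show "pelem L M N' (U \<union> set \<beta>) h" unfolding pelem_def C_def[symmetric]
    proof (intro conjI allI impI ballI)
      fix a \<psi> assume a: "set a \<subseteq> C" "\<psi> \<in> formulas L (length a)"
      show "sat_tuple N' (map h a) \<psi> \<longleftrightarrow> sat_tuple M a \<psi>"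
        using pos[OF a] pos[OF a(1), of "Neg \<psi>"] a(2) by (auto simp: formulas_def)
    qed (rule CM N'(3))+
    show "h u = g u" if "u \<in> U" for u
    proof -
      have "F2 u \<in> \<Gamma>" using that unfolding \<Gamma>_def by blast
      from N'(4)[OF this[unfolded F2_def]] show ?thesis by simp
    qed
    show "\<not> sat_tuple N' (a @ map h \<beta>) \<phi>" if "a \<in> tuples Mi n" for a
    proof -
      have "F3 a \<in> \<Gamma>" using that unfolding \<Gamma>_def by blast
      from N'(4)[OF this[unfolded F3_def]] show ?thesis by (simp add: comp_def)
    qed
  qed
qed

text \<open>Universality concerns models of size exactly \<open>lam\<close>; the lower bound for
  \<open>N\<close> comes from its submodel \<open>Mi\<close>.\<close>

lemma universal_embed:
  assumes "universal_over L T lam Mj Mi" "T \<subseteq> sentences L" "elem_sub L Mi N" "|Dom N| \<le>o lam"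
  obtains k where "elem_emb L k N Mj" "\<And>a. a \<in> Dom Mi \<Longrightarrow> k a = a"
proof -
  have Mi: "model L T Mi" "|Dom Mi| =o lam" using assms(1) by (auto simp: universal_over_def model_of_size_def)
  have "model L T N" using model_elem_emb[OF assms(2) Mi(1)] assms(3) by (simp add: elem_sub_def)
  moreover have "|Dom N| =o lam"
  proof -
    have "|Dom Mi| \<le>o |Dom N|" by (rule card_of_mono1[OF elem_sub_Dom[OF assms(3)]])
    then have "lam \<le>o |Dom N|" using ordIso_ordLeq_trans[OF ordIso_symmetric[OF Mi(2)]] by blast
    then show ?thesis using assms(4) by (simp add: ordIso_iff_ordLeq)
  qed
  ultimately show thesis using that assms(1,3) unfolding universal_over_def model_of_size_def by blast
qed

text \<open>One stage of the recursion. The extension omitting the formula embeds into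
  \<open>Mj\<close> over \<open>Mi\<close>, and as tuples of \<open>Mi\<close> are fixed by the
  embedding, none of them realizes the copied formula in \<open>Mj\<close>.\<close>

lemma forks_step:
  fixes M Mi Mj :: "('f, 'r, 'm) struct" and lam :: "'l rel"
  assumes lam: "Cinfinite lam" and big: "lam <o |UNIV :: 'm set|" and L: "theory_card L \<le>o lam"
    and T: "complete_theory TYPE('m) L T" and stable: "stable_in TYPE('m) L T lam"
    and M: "model L T M" and A: "A \<subseteq> Dom M" "A' \<subseteq> Dom M"
    and p: "p \<subseteq> formulas (with_params L A') n" "forks L M n p A"
    and U: "U \<subseteq> A" "|U| \<le>o lam" and univ: "universal_over L T lam Mj Mi" and g: "pelem L M Mi U g"
  obtains q \<phi> \<beta> h where "finite q" "q \<subseteq> p" "set \<beta> \<subseteq> A'" "\<phi> \<in> formulas L (n + length \<beta>)"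
    "\<And>a. a \<in> tuples M n \<Longrightarrow> sat_tuple M (a @ \<beta>) \<phi> \<longleftrightarrow> (\<forall>\<psi>\<in>q. sat_tuple (expand M id) a \<psi>)"
    "pelem L M Mj (U \<union> set \<beta>) h" "\<And>u. u \<in> U \<Longrightarrow> h u = g u"
    "\<And>a. a \<in> tuples Mi n \<Longrightarrow> \<not> sat_tuple Mj (a @ map h \<beta>) \<phi>"
proof -
  have TL: "T \<subseteq> sentences L" using T by (simp add: complete_theory_def)
  have Mi: "model L T Mi" "|Dom Mi| \<le>o lam"
    using univ by (auto simp: universal_over_def model_of_size_def ordIso_iff_ordLeq)
  obtain N :: "('f, 'r, 'm) struct" and f D q \<phi> \<beta> where 1: "elem_emb L f M N" "finite D"
    "\<And>\<phi> b. (\<phi>, b) \<in> D \<Longrightarrow> \<phi> \<in> formulas L (n + length b) \<and> set b \<subseteq> Dom N \<and> divides L N (f ` A) n \<phi> b"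
    "finite q" "q \<subseteq> p" "set \<beta> \<subseteq> A'" "\<phi> \<in> formulas L (n + length \<beta>)"
    "\<And>a. a \<in> tuples M n \<Longrightarrow> sat_tuple M (a @ \<beta>) \<phi> \<longleftrightarrow> (\<forall>\<psi>\<in>q. sat_tuple (expand M id) a \<psi>)"
    "\<And>a. a \<in> tuples N n \<Longrightarrow> sat_tuple N (a @ map f \<beta>) \<phi> \<Longrightarrow> \<exists>(\<phi>, b)\<in>D. sat_tuple N (a @ b) \<phi>"
    by (rule forks_formula[OF p(2,1)]) (rule that)
  have N: "stable_struct L N"
    by (rule stable_in_imp_stable_struct[OF lam big L T stable Mi model_elem_emb[OF TL M 1(1)]])
  have Mis: "is_struct L Mi" using Mi(1) by (simp add: model_def)
  have \<beta>M: "set \<beta> \<subseteq> Dom M" using 1(6) A(2) by blast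
  obtain N' :: "('f, 'r, 'm) struct" and h where 2: "elem_sub L Mi N'" "|Dom N'| \<le>o lam"
    "pelem L M N' (U \<union> set \<beta>) h" "\<And>u. u \<in> U \<Longrightarrow> h u = g u"
    "\<And>a. a \<in> tuples Mi n \<Longrightarrow> \<not> sat_tuple N' (a @ map h \<beta>) \<phi>"
    by (rule omit_model[OF lam big L Mis Mi(2) g 1(1) N U(1) A(1) U(2) 1(2,3) \<beta>M 1(7) 1(9)])
      (assumption | rule that)+
  obtain k where k: "elem_emb L k N' Mj" "\<And>a. a \<in> Dom Mi \<Longrightarrow> k a = a"
    using universal_embed[OF univ TL 2(1,2)] by metis
  show thesis
  proof (rule that[OF 1(4-7) 1(8) pelem_comp_emb[OF 2(3) k(1)]])
    show "(k \<circ> h) u = g u" if "u \<in> U" for u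
      using 2(4)[OF that] k(2)[of "g u"] g that by (auto simp: pelem_def)
    show "\<not> sat_tuple Mj (a @ map (k \<circ> h) \<beta>) \<phi>" if a: "a \<in> tuples Mi n" for a
    proof -
      have "map h \<beta> \<in> tuples N' (length \<beta>)" using 2(3) by (auto simp: pelem_def tuples_def)
      moreover have "a \<in> tuples N' n" using elem_sub_tuples[OF 2(1)] a by blast
      ultimately have "a @ map h \<beta> \<in> tuples N' (n + length \<beta>)" by (intro tuples_append)
      from elem_emb_sat[OF k(1) 1(7) this] have "\<not> sat_tuple Mj (map k (a @ map h \<beta>)) \<phi>"
        using 2(5)[OF a] by simp
      moreover have "map k a = a" using a k(2) by (auto simp: tuples_def intro!: map_idI)
      ultimately show ?thesis by simp
    qed
  qed
qed

section \<open>Chains\<close>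

lemma limit_suc:
  assumes "limit_ordinal r" "i \<in> Field r"
  shows "wo_rel.suc r {i} \<in> Field r" "(i, wo_rel.suc r {i}) \<in> r"
    "i \<in> underS r j \<Longrightarrow> (wo_rel.suc r {i}, j) \<in> r"
proof -
  have wo: "wo_rel r" using assms(1) by (simp add: limit_ordinal_def wo_rel_def)
  have ne: "AboveS r {i} \<noteq> {}"
    using assms by (auto simp: limit_ordinal_def AboveS_def aboveS_def Field_def)
  have sub: "{i} \<subseteq> Field r" using assms(2) by simp
  show "wo_rel.suc r {i} \<in> Field r" by (rule wo_rel.suc_inField[OF wo sub ne])
  show "(i, wo_rel.suc r {i}) \<in> r" using wo_rel.suc_greater[OF wo sub ne] by simp
  show "(wo_rel.suc r {i}, j) \<in> r" if "i \<in> underS r j"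
    by (rule wo_rel.suc_least_AboveS[OF wo]) (use that in \<open>auto simp: AboveS_def underS_def Field_def\<close>)
qed

lemma finite_ordLess: "Cinfinite r \<Longrightarrow> finite A \<Longrightarrow> |A| <o r"
  by (rule ordLess_ordLeq_trans[OF _ natLeq_ordLeq_cinfinite]) (simp_all add: finite_iff_ordLess_natLeq[symmetric])

lemma finite_max:
  assumes "Well_order r" "finite J" "J \<noteq> {}" "J \<subseteq> Field r"
  shows "\<exists>m\<in>J. \<forall>j\<in>J. (j, m) \<in> r"
  using assms(2-4)
proof (induction J rule: finite_ne_induct)
  case (singleton x)
  have "Refl r" using assms(1) by (simp add: order_on_defs)
  then show ?case using singleton by (auto simp: refl_on_def)
next
  case (insert x J)
  then obtain m where m: "m \<in> J" "\<And>j. j \<in> J \<Longrightarrow> (j, m) \<in> r" by auto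
  have r: "Refl r" "Total r" "trans r" using assms(1) by (auto simp: order_on_defs)
  have "m \<in> Field r" "x \<in> Field r" using m(1) insert.prems by auto
  then consider "(x, m) \<in> r" | "(m, x) \<in> r" "x \<noteq> m"
    using r(1,2) unfolding total_on_def refl_on_def by metis
  then show ?case
  proof cases
    case 1
    then show ?thesis using m by auto
  next
    case 2
    have "(x, x) \<in> r" using r(1) insert.prems by (auto simp: refl_on_def)
    moreover have "(j, x) \<in> r" if "j \<in> J" for j using m(2)[OF that] 2(1) transD[OF r(3)] by blast
    ultimately show ?thesis by auto
  qed
qed

text \<open>Elementarity concerns finitely many elements at a time. The largest index
  \<open>m\<close> chosen for them has a map \<open>h m\<close> that is elementary on all of them
  and agrees there with the earlier maps.\<close>

lemma glue:
  fixes M N :: "('f, 'r, 'm) struct" and r :: "'a rel" and h :: "'a \<Rightarrow> 'm \<Rightarrow> 'm"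
  assumes r: "Well_order r" and T: "complete_theory TYPE('m) L T" and M: "model L T M" "model L T N"
    and I: "I \<subseteq> Field r"
    and h: "\<And>i. i \<in> I \<Longrightarrow> pelem L M N ((\<Union>j\<in>underS r i. B j) \<union> B i) (h i)"
    and coh: "\<And>i j u. i \<in> I \<Longrightarrow> j \<in> underS r i \<Longrightarrow> u \<in> B j \<Longrightarrow> h i u = h j u"
  obtains g where "pelem L M N (\<Union>i\<in>I. B i) g" "\<And>i u. i \<in> I \<Longrightarrow> u \<in> B i \<Longrightarrow> g u = h i u"
proof -
  define ju where "ju u = (SOME i. i \<in> I \<and> u \<in> B i)" for u
  have ju: "ju u \<in> I \<and> u \<in> B (ju u)" if "i \<in> I" "u \<in> B i" for i u
    unfolding ju_def by (rule someI[of _ i]) (use that in simp)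
  define g where "g u = h (ju u) u" for u
  have tot: "(j, i) \<in> r \<Longrightarrow> j = i \<or> j \<in> underS r i" for i j by (auto simp: underS_def)
  have total: "j = i \<or> j \<in> underS r i \<or> i \<in> underS r j" if "i \<in> I" "j \<in> I" for i j
    using r I that by (auto simp: order_on_defs total_on_def underS_def)
  have g: "g u = h i u" if "i \<in> I" "u \<in> B i" for i u
    using total[of i "ju u"] coh[of i "ju u" u] coh[of "ju u" i u] ju[OF that] that unfolding g_def by metis
  show thesis
  proof (rule that[OF _ g])
    show "pelem L M N (\<Union>i\<in>I. B i) g"
    proof (rule pelemI_finite)
      fix F assume F: "finite F" "F \<subseteq> (\<Union>i\<in>I. B i)"
      show "pelem L M N F g"
      proof (cases "F = {}")
        \<comment> \<open>This covers \<open>I = {}\<close>, the first stage of the recursion: the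
          two models agree on sentences by completeness.\<close>
        case True
        show ?thesis unfolding True pelem_def
        proof (intro conjI allI impI ballI)
          fix a :: "'m list" and \<phi> assume "set a \<subseteq> {}" "\<phi> \<in> formulas L (length a)"
          then show "sat_tuple N (map g a) \<phi> \<longleftrightarrow> sat_tuple M a \<phi>"
            using complete_sat[OF T M, of \<phi>] by simp
        qed auto
      next
        case False
        have "ju ` F \<subseteq> Field r" using ju F(2) I by blast
        then obtain m where m: "m \<in> ju ` F" "\<And>j. j \<in> ju ` F \<Longrightarrow> (j, m) \<in> r"
          using finite_max[OF r, of "ju ` F"] F(1) False by auto
        have mI: "m \<in> I" using m(1) ju F(2) by blast
        have Fu: "u \<in> B (ju u) \<and> (ju u = m \<or> ju u \<in> underS r m)" if "u \<in> F" for u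
          using ju[of _ u] F(2) that tot[OF m(2)[of "ju u"]] by blast
        have "pelem L M N F (h m)"
          by (rule pelem_subset[OF h[OF mI]]) (use Fu in blast)
        then show ?thesis
        proof (rule pelem_cong)
          fix u assume "u \<in> F"
          from Fu[OF this] show "g u = h m u" using coh[OF mI, of "ju u" u] unfolding g_def by auto
        qed
      qed
    qed
  qed
qed

lemma pelem_elem_sub:
  assumes "pelem L M N U g" "elem_sub L N N'"
  shows "pelem L M N' U g"
  using pelem_comp_emb[OF assms(1) assms(2)[unfolded elem_sub_def]] by simp

text \<open>The parameters of finite parts of \<open>p\<close> are copied into the chain so that the \<open>i\<close>-th part has no
  realization in the \<open>i\<close>-th model.\<close>
lemma omit_along_chain:
  fixes M N :: "('f, 'r, 'm) struct" and lam :: "'l rel" and r :: "'a rel" and Mc :: "'a \<Rightarrow> ('f, 'r, 'm) struct"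
  assumes lam: "Cinfinite lam" and big: "lam <o |UNIV :: 'm set|" and L: "theory_card L \<le>o lam"
    and T: "complete_theory TYPE('m) L T" and stable: "stable_in TYPE('m) L T lam"
    and r: "Cinfinite r" "regularCard r" "r \<le>o lam" "limit_ordinal r"
    and Mc: "\<And>i. i \<in> Field r \<Longrightarrow> model L T (Mc i)" "\<And>i j. (i, j) \<in> r \<Longrightarrow> elem_sub L (Mc i) (Mc j)"
    "\<And>i. i \<in> Field r \<Longrightarrow> elem_sub L (Mc i) N" "Dom N = (\<Union>i\<in>Field r. Dom (Mc i))" "model L T N"
    "\<And>i. i \<in> Field r \<Longrightarrow> universal_over L T lam (Mc (wo_rel.suc r {i})) (Mc i)"
    and M: "model L T M" and A: "\<And>i. i \<in> Field r \<Longrightarrow> A i \<subseteq> Dom M" "relChain r A"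
    and p: "p \<in> types L M (\<Union>i\<in>Field r. A i) n" "\<And>i. i \<in> Field r \<Longrightarrow> forks L M n p (A i)"
  obtains \<phi> \<beta> g where "pelem L M N (\<Union>i\<in>Field r. set (\<beta> i)) g"
    "\<And>i. i \<in> Field r \<Longrightarrow> \<phi> i \<in> formulas L (n + length (\<beta> i))"
    "\<And>F. finite F \<Longrightarrow> F \<subseteq> Field r \<Longrightarrow> \<exists>a\<in>tuples M n. \<forall>i\<in>F. sat_tuple M (a @ \<beta> i) (\<phi> i)"
    "\<And>a. a \<in> tuples N n \<Longrightarrow> \<exists>i\<in>Field r. \<not> sat_tuple N (a @ map g (\<beta> i)) (\<phi> i)"
proof -
  define A' where "A' = (\<Union>i\<in>Field r. A i)"
  have A'M: "A' \<subseteq> Dom M" using A(1) by (auto simp: A'_def)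
  have pf: "p \<subseteq> formulas (with_params L A') n" using p(1) by (auto simp: types_def A'_def)
  have wo: "Well_order r" using r(4) by (simp add: limit_ordinal_def)
  have co: "Card_order r" using r(1) by simp
  let ?suc = "\<lambda>i. wo_rel.suc r {i}"
  \<comment> \<open>A stage consists of a finite part of \<open>p\<close>, its formula, the
    parameters, and a map copying all parameters so far into the successor model. Indices outside
    the field carry no demand, so the recursion may run over the whole type.\<close>
  define Good :: "('a \<Rightarrow> ('f + 'm, 'r) fm set \<times> ('f, 'r) fm \<times> 'm list \<times> ('m \<Rightarrow> 'm)) \<Rightarrow> 'a \<Rightarrow>
      ('f + 'm, 'r) fm set \<times> ('f, 'r) fm \<times> 'm list \<times> ('m \<Rightarrow> 'm) \<Rightarrow> bool" where
    "Good f i = (\<lambda>(q, \<phi>, \<beta>, h). i \<in> Field r \<longrightarrow>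
      finite q \<and> q \<subseteq> p \<and> set \<beta> \<subseteq> A' \<and> \<phi> \<in> formulas L (n + length \<beta>) \<and>
      (\<forall>a\<in>tuples M n. sat_tuple M (a @ \<beta>) \<phi> \<longleftrightarrow> (\<forall>\<psi>\<in>q. sat_tuple (expand M id) a \<psi>)) \<and>
      pelem L M (Mc (?suc i)) ((\<Union>j\<in>underS r i. set (fst (snd (snd (f j))))) \<union> set \<beta>) h \<and>
      (\<forall>j\<in>underS r i. \<forall>u\<in>set (fst (snd (snd (f j)))). h u = snd (snd (snd (f j))) u) \<and>
      (\<forall>a\<in>tuples (Mc i) n. \<not> sat_tuple (Mc (?suc i)) (a @ map h \<beta>) \<phi>))" for f i
  have "\<exists>f. \<forall>i. Good f i (f i)"
  proof (rule dependent_wf_choice[of "r - Id"])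
    show "wf (r - Id)" using wo by (simp add: well_order_on_def)
    fix f g :: "'a \<Rightarrow> ('f + 'm, 'r) fm set \<times> ('f, 'r) fm \<times> 'm list \<times> ('m \<Rightarrow> 'm)" and i s
    assume "\<And>j. (j, i) \<in> r - Id \<Longrightarrow> f j = g j"
    then have eq: "\<And>j. j \<in> underS r i \<Longrightarrow> f j = g j" by (auto simp: underS_def)
    have 1: "(\<Union>j\<in>underS r i. set (fst (snd (snd (f j))))) = (\<Union>j\<in>underS r i. set (fst (snd (snd (g j)))))"
      by (intro SUP_cong refl) (simp add: eq)
    have 2: "(\<forall>j\<in>underS r i. \<forall>u\<in>set (fst (snd (snd (f j)))). h u = snd (snd (snd (f j))) u) \<longleftrightarrow>
       (\<forall>j\<in>underS r i. \<forall>u\<in>set (fst (snd (snd (g j)))). h u = snd (snd (snd (g j))) u)" for h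
      by (intro ball_cong refl) (simp_all add: eq)
    show "Good f i s = Good g i s" unfolding Good_def 1 2 ..
  next
    fix i and f :: "'a \<Rightarrow> ('f + 'm, 'r) fm set \<times> ('f, 'r) fm \<times> 'm list \<times> ('m \<Rightarrow> 'm)"
    assume "\<And>j. (j, i) \<in> r - Id \<Longrightarrow> Good f j (f j)"
    then have IH: "\<And>j. j \<in> underS r i \<Longrightarrow> Good f j (f j)" by (auto simp: underS_def)
    show "\<exists>s. Good f i s"
    proof (cases "i \<in> Field r")
      case False
      then show ?thesis by (auto simp: Good_def)
    next
      case i: True
      define B where "B j = set (fst (snd (snd (f j))))" for j
      define h where "h j = snd (snd (snd (f j)))" for j
      have under: "underS r i \<subseteq> Field r" by (auto simp: underS_def Field_def)
      have IH': "B j \<subseteq> A'" "pelem L M (Mc (?suc j)) ((\<Union>k\<in>underS r j. B k) \<union> B j) (h j)"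
        "\<And>k u. k \<in> underS r j \<Longrightarrow> u \<in> B k \<Longrightarrow> h j u = h k u" if "j \<in> underS r i" for j
        using IH[OF that] that under unfolding Good_def B_def h_def by (auto split: prod.splits)
      \<comment> \<open>For \<open>j\<close> below \<open>i\<close> the successor of
        \<open>j\<close> is at most \<open>i\<close>, so the earlier copies already lie in the
        \<open>i\<close>-th model.\<close>
      have hi: "pelem L M (Mc i) ((\<Union>k\<in>underS r j. B k) \<union> B j) (h j)" if "j \<in> underS r i" for j
        by (rule pelem_elem_sub[OF IH'(2)[OF that] Mc(2)])
          (rule limit_suc(3)[OF r(4) _ that], use that under in blast)
      obtain g where g: "pelem L M (Mc i) (\<Union>j\<in>underS r i. B j) g"
        "\<And>j u. j \<in> underS r i \<Longrightarrow> u \<in> B j \<Longrightarrow> g u = h j u"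
        by (rule glue[where B = B and h = h and I = "underS r i", OF wo T M Mc(1)[OF i] under hi])
          (assumption | rule IH'(3) that)+
      \<comment> \<open>Fewer than \<open>r\<close> finite sets have a union smaller than the
        regular \<open>r\<close>, which is thus contained in one \<open>A \<sigma>\<close>. That
        \<open>p\<close> forks over this larger set is what the next stage uses.\<close>
      define U where "U = (\<Union>j\<in>underS r i. B j)"
      have "|U| <o r" unfolding U_def
        by (rule regularCard_UNION_bound[OF r(1,2) card_of_underS[OF co i]])
          (simp add: B_def finite_ordLess[OF r(1)])
      moreover have "U \<subseteq> (\<Union>i\<in>Field r. A i)" using IH'(1) unfolding U_def A'_def by blast
      ultimately obtain \<sigma> where \<sigma>: "\<sigma> \<in> Field r" "U \<subseteq> A \<sigma>"
        using regularCard_UNION[OF co r(2) A(2)] by blast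
      have Ulam: "|U| \<le>o lam" using \<open>|U| <o r\<close> r(3) ordLess_imp_ordLeq ordLeq_transitive by blast
      obtain q \<phi> \<beta> h' where 1: "finite q" "q \<subseteq> p" "set \<beta> \<subseteq> A'" "\<phi> \<in> formulas L (n + length \<beta>)"
        "\<And>a. a \<in> tuples M n \<Longrightarrow> sat_tuple M (a @ \<beta>) \<phi> \<longleftrightarrow> (\<forall>\<psi>\<in>q. sat_tuple (expand M id) a \<psi>)"
        "pelem L M (Mc (?suc i)) (U \<union> set \<beta>) h'" "\<And>u. u \<in> U \<Longrightarrow> h' u = g u"
        "\<And>a. a \<in> tuples (Mc i) n \<Longrightarrow> \<not> sat_tuple (Mc (?suc i)) (a @ map h' \<beta>) \<phi>"
        by (rule forks_step[OF lam big L T stable M A(1)[OF \<sigma>(1)] A'M pf p(2)[OF \<sigma>(1)] \<sigma>(2) Ulam Mc(6)[OF i]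
              g(1)[folded U_def]]) (rule that)
      have "h' u = h j u" if "j \<in> underS r i" "u \<in> B j" for j u
        using 1(7)[of u] g(2)[OF that] that unfolding U_def by auto
      then have "Good f i (q, \<phi>, \<beta>, h')"
        using 1(1-6,8) unfolding Good_def U_def B_def h_def by simp
      then show ?thesis by blast
    qed
  qed
  then obtain f where f: "\<And>i. Good f i (f i)" by blast
  define q where "q i = fst (f i)" for i
  define \<phi> where "\<phi> i = fst (snd (f i))" for i
  define \<beta> where "\<beta> i = fst (snd (snd (f i)))" for i
  define h where "h i = snd (snd (snd (f i)))" for i
  have F: "finite (q i)" "q i \<subseteq> p" "\<phi> i \<in> formulas L (n + length (\<beta> i))"
    "\<And>a. a \<in> tuples M n \<Longrightarrow> sat_tuple M (a @ \<beta> i) (\<phi> i) \<longleftrightarrow> (\<forall>\<psi>\<in>q i. sat_tuple (expand M id) a \<psi>)"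
    "pelem L M (Mc (?suc i)) ((\<Union>j\<in>underS r i. set (\<beta> j)) \<union> set (\<beta> i)) (h i)"
    "\<And>j u. j \<in> underS r i \<Longrightarrow> u \<in> set (\<beta> j) \<Longrightarrow> h i u = h j u"
    "\<And>a. a \<in> tuples (Mc i) n \<Longrightarrow> \<not> sat_tuple (Mc (?suc i)) (a @ map (h i) (\<beta> i)) (\<phi> i)"
    if "i \<in> Field r" for i
    using f[of i] that unfolding Good_def q_def \<phi>_def \<beta>_def h_def by (auto split: prod.splits)
  have hN: "pelem L M N ((\<Union>j\<in>underS r i. set (\<beta> j)) \<union> set (\<beta> i)) (h i)" if "i \<in> Field r" for i
    by (rule pelem_elem_sub[OF F(5)[OF that] Mc(3)[OF limit_suc(1)[OF r(4) that]]])
  obtain g where g: "pelem L M N (\<Union>i\<in>Field r. set (\<beta> i)) g" "\<And>i u. i \<in> Field r \<Longrightarrow> u \<in> set (\<beta> i) \<Longrightarrow> g u = h i u"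
    by (rule glue[where B = "\<lambda>i. set (\<beta> i)" and h = h and I = "Field r", OF wo T M Mc(5) order_refl hN])
      (assumption | rule F(6) that)+
  show thesis
  proof (rule that[OF g(1)])
    show "\<phi> i \<in> formulas L (n + length (\<beta> i))" if "i \<in> Field r" for i by (rule F(3)[OF that])
    show "\<exists>a\<in>tuples M n. \<forall>i\<in>I. sat_tuple M (a @ \<beta> i) (\<phi> i)" if I: "finite I" "I \<subseteq> Field r" for I
    proof -
      have "finite (\<Union>i\<in>I. q i)" using I F(1) by auto
      moreover have "(\<Union>i\<in>I. q i) \<subseteq> p" using I(2) F(2) by (intro UN_least) auto
      moreover have "\<forall>q \<subseteq> p. finite q \<longrightarrow> (\<exists>a \<in> tuples M n. \<forall>\<psi> \<in> q. sat_tuple (expand M id) a \<psi>)"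
        using p(1) unfolding types_def mem_Collect_eq by (elim conjE)
      ultimately obtain a where a: "a \<in> tuples M n" "\<forall>\<psi>\<in>(\<Union>i\<in>I. q i). sat_tuple (expand M id) a \<psi>"
        by meson
      have "sat_tuple M (a @ \<beta> i) (\<phi> i)" if "i \<in> I" for i
      proof -
        have "i \<in> Field r" using that I(2) by auto
        from F(4)[OF this a(1)] show ?thesis using a(2) that by simp
      qed
      then show ?thesis using a(1) by blast
    qed
    show "\<exists>i\<in>Field r. \<not> sat_tuple N (a @ map g (\<beta> i)) (\<phi> i)" if a: "a \<in> tuples N n" for a
    proof -
      \<comment> \<open>A finite tuple of the union already lies in some \<open>Mc i\<close>. Stage
        \<open>i\<close> excludes it in the successor model, and elementarity keeps it excluded in
        \<open>N\<close>.\<close>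
      have "relChain r (\<lambda>i. Dom (Mc i))" unfolding relChain_def using elem_sub_Dom[OF Mc(2)] by blast
      moreover have "set a \<subseteq> (\<Union>i\<in>Field r. Dom (Mc i))" using a Mc(4) by (simp add: tuples_def)
      moreover have "|set a| <o r" by (rule finite_ordLess[OF r(1) finite_set])
      ultimately obtain i where i: "i \<in> Field r" "set a \<subseteq> Dom (Mc i)"
        using regularCard_UNION[OF co r(2)] by blast
      have ai: "a \<in> tuples (Mc i) n" using i(2) a by (simp add: tuples_def)
      have "map (h i) (\<beta> i) \<in> tuples (Mc (?suc i)) (length (\<beta> i))"
        using F(5)[OF i(1)] by (auto simp: pelem_def tuples_def)
      moreover have "a \<in> tuples (Mc (?suc i)) n"
        using elem_sub_tuples[OF Mc(2)[OF limit_suc(2)[OF r(4) i(1)]]] ai by blast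
      ultimately have "a @ map (h i) (\<beta> i) \<in> tuples (Mc (?suc i)) (n + length (\<beta> i))"
        by (intro tuples_append)
      from elem_sub_sat[OF Mc(3)[OF limit_suc(1)[OF r(4) i(1)]] F(3)[OF i(1)] this] F(7)[OF i(1) ai]
      have omitted: "\<not> sat_tuple N (a @ map (h i) (\<beta> i)) (\<phi> i)" by simp
      have eq: "map g (\<beta> i) = map (h i) (\<beta> i)" using g(2)[OF i(1)] by simp
      have "\<not> sat_tuple N (a @ map g (\<beta> i)) (\<phi> i)" unfolding eq by (rule omitted)
      then show ?thesis using i(1) by (rule bexI)
    qed
  qed
qed

section \<open>Realizing small types in limit models\<close>

text \<open>All parameters of the finitely many formulas are collected in one tuple
  \<open>v\<close>, so their joint consistency is a single definable property of
  \<open>v\<close>.\<close>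

lemma finite_sat_transfer:
  fixes M N :: "('f, 'r, 'm) struct"
  assumes g: "pelem L M N U g" and P: "finite P"
    "\<And>\<phi> \<beta>. (\<phi>, \<beta>) \<in> P \<Longrightarrow> \<phi> \<in> formulas L (n + length \<beta>) \<and> set \<beta> \<subseteq> U"
  shows "(\<exists>a\<in>tuples N n. \<forall>(\<phi>, \<beta>)\<in>P. sat_tuple N (a @ map g \<beta>) \<phi>) \<longleftrightarrow>
    (\<exists>a\<in>tuples M n. \<forall>(\<phi>, \<beta>)\<in>P. sat_tuple M (a @ \<beta>) \<phi>)"
proof -
  have "finite (\<Union>(\<phi>, \<beta>)\<in>P. set \<beta>)" using P(1) by auto
  then obtain v where v: "set v = (\<Union>(\<phi>, \<beta>)\<in>P. set \<beta>)" by (rule finite_list[THEN exE])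
  define k where "k = length v"
  define ind where "ind c = (SOME i. i < k \<and> v ! i = c)" for c
  have ind: "ind c < k \<and> v ! ind c = c" if "c \<in> set v" for c
    unfolding ind_def by (rule someI_ex) (use that in \<open>auto simp: k_def in_set_conv_nth\<close>)
  have sub: "set \<beta> \<subseteq> set v" if "(\<phi>, \<beta>) \<in> P" for \<phi> \<beta> using v that by auto
  define R where "R N s \<longleftrightarrow> (\<exists>a\<in>tuples N n. \<forall>d\<in>P.
      sat_tuple N (map ((!) (s @ a)) ([k..<k + n] @ map ind (snd d))) (fst d))" for N :: "('f, 'r, 'm) struct" and s
  have R_eq: "map ((!) (map f v @ a)) ([k..<k + n] @ map ind \<beta>) = a @ map f \<beta>"
    if "(\<phi>, \<beta>) \<in> P" "length a = n" for f :: "'m \<Rightarrow> 'm" and a \<phi> \<beta>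
  proof -
    have "map ((!) (map f v @ a)) [k..<k + n] = a"
      using map_nth_slice[of k n "map f v @ a"] that(2) by (simp add: k_def)
    moreover have "(map f v @ a) ! ind c = f c" if "c \<in> set \<beta>" for c
    proof -
      have "c \<in> set v" using sub[OF \<open>(\<phi>, \<beta>) \<in> P\<close>] that by auto
      from ind[OF this] show ?thesis by (simp add: nth_append k_def)
    qed
    then have "map ((!) (map f v @ a)) (map ind \<beta>) = map f \<beta>"
      unfolding map_map by (intro map_cong refl) simp
    ultimately show ?thesis unfolding map_append by (simp only:)
  qed
  have R: "R N (map f v) \<longleftrightarrow> (\<exists>a\<in>tuples N n. \<forall>(\<phi>, \<beta>)\<in>P. sat_tuple N (a @ map f \<beta>) \<phi>)"
    for N :: "('f, 'r, 'm) struct" and f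
    unfolding R_def
  proof (intro bex_cong ball_cong refl)
    fix a d assume a: "a \<in> tuples N n" and d: "d \<in> P"
    obtain \<phi> \<beta> where dd: "d = (\<phi>, \<beta>)" by (cases d)
    have len: "length a = n" using a by (simp add: tuples_def)
    show "sat_tuple N (map ((!) (map f v @ a)) ([k..<k + n] @ map ind (snd d))) (fst d) \<longleftrightarrow>
        (case d of (\<phi>, \<beta>) \<Rightarrow> sat_tuple N (a @ map f \<beta>) \<phi>)"
      unfolding dd fst_conv snd_conv prod.case R_eq[OF d[unfolded dd] len] ..
  qed
  have "dfn L (k + n) (\<lambda>N s. \<forall>d\<in>P. sat_tuple N (map ((!) s) ([k..<k + n] @ map ind (snd d))) (fst d))"
  proof (rule dfn_ball[OF P(1)])
    fix d assume d: "d \<in> P"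
    then have d': "fst d \<in> formulas L (n + length (snd d))" "set (snd d) \<subseteq> set v"
      using P(2)[of "fst d" "snd d"] sub[of "fst d" "snd d"] by auto
    show "dfn L (k + n) (\<lambda>N s. sat_tuple N (map ((!) s) ([k..<k + n] @ map ind (snd d))) (fst d))"
    proof (rule dfn_map[OF dfn_formula[OF d'(1)]])
      fix i assume "i \<in> set ([k..<k + n] @ map ind (snd d))"
      then consider "i \<in> {k..<k + n}" | c where "c \<in> set (snd d)" "i = ind c" by auto
      then show "i < k + n"
      proof cases
        case 2
        then have "c \<in> set v" using d'(2) by auto
        from ind[OF this] show ?thesis using 2(2) by simp
      qed simp
    qed simp
  qed
  then have dR: "dfn L k R" unfolding R_def by (rule dfn_ex)
  have vU: "set v \<subseteq> U" using v P(2) by auto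
  have "R N (map g v) \<longleftrightarrow> R M v" by (rule pelem_dfn[OF g dR vU]) (simp add: k_def)
  also have "\<dots> \<longleftrightarrow> (\<exists>a\<in>tuples M n. \<forall>(\<phi>, \<beta>)\<in>P. sat_tuple M (a @ \<beta>) \<phi>)"
    using R[of M id] by (simp only: list.map_id)
  finally show ?thesis unfolding R[of N g] .
qed

lemma elem_emb_trans:
  assumes f: "elem_emb L f M N" and g: "elem_emb L g N P"
  shows "elem_emb L (g \<circ> f) M P"
  unfolding elem_emb_def
proof (intro conjI allI impI)
  show "(g \<circ> f) ` Dom M \<subseteq> Dom P" using f g by (force simp: elem_emb_def)
  fix \<phi> and e :: "nat \<Rightarrow> 'c" assume \<phi>: "wf_fm L \<phi>" and e: "range e \<subseteq> Dom M"
  have "sat M e \<phi> \<longleftrightarrow> sat N (f \<circ> e) \<phi>" using f \<phi> e unfolding elem_emb_def by blast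
  also have "range (f \<circ> e) \<subseteq> Dom N" using f e by (force simp: elem_emb_def)
  then have "sat N (f \<circ> e) \<phi> \<longleftrightarrow> sat P (g \<circ> (f \<circ> e)) \<phi>" using g \<phi> unfolding elem_emb_def by blast
  finally show "sat M e \<phi> \<longleftrightarrow> sat P (g \<circ> f \<circ> e) \<phi>" by (simp only: comp_assoc)
qed (use f g in \<open>auto simp: elem_emb_def\<close>)

text \<open>By regularity fewer than \<open>r\<close> parameters lie in one member of the chain. The
  type is realized in an extension of that member of size \<open>lam\<close>, which embeds over it
  into the next member.\<close>

lemma limit_model_realizes:
  fixes N :: "('f, 'r, 'm) struct" and lam :: "'l rel" and r :: "'b rel"
  assumes lam: "Cinfinite lam" and big: "lam <o |UNIV :: 'm set|" and L: "theory_card L \<le>o lam"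
    and T: "T \<subseteq> sentences L" and r: "Cinfinite r" "regularCard r" and lim: "limit_model L T lam r N"
    and \<Gamma>: "\<And>\<phi> \<beta>. (\<phi>, \<beta>) \<in> \<Gamma> \<Longrightarrow> \<phi> \<in> formulas L (n + length \<beta>) \<and> set \<beta> \<subseteq> B"
    and B: "B \<subseteq> Dom N" "|B| <o r"
    and fin: "\<And>P. finite P \<Longrightarrow> P \<subseteq> \<Gamma> \<Longrightarrow> \<exists>a\<in>tuples N n. \<forall>(\<phi>, \<beta>)\<in>P. sat_tuple N (a @ \<beta>) \<phi>"
  shows "\<exists>a\<in>tuples N n. \<forall>(\<phi>, \<beta>)\<in>\<Gamma>. sat_tuple N (a @ \<beta>) \<phi>"
proof -
  obtain Mc where lo: "limit_ordinal r"
    and size: "\<forall>i \<in> Field r. model_of_size L T lam (Mc i)"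
    and sub: "\<forall>(i, j) \<in> r. elem_sub L (Mc i) (Mc j)" and subN: "\<forall>i \<in> Field r. elem_sub L (Mc i) N"
    and DomN: "Dom N = (\<Union>i \<in> Field r. Dom (Mc i))"
    and univ: "\<forall>i \<in> Field r. universal_over L T lam (Mc (wo_rel.suc r {i})) (Mc i)"
    using lim unfolding limit_model_def by (elim conjE exE)
  have "relChain r (\<lambda>i. Dom (Mc i))" unfolding relChain_def using sub elem_sub_Dom by blast
  then obtain i where i: "i \<in> Field r" "B \<subseteq> Dom (Mc i)"
    using regularCard_UNION[of r "\<lambda>i. Dom (Mc i)" B] r B DomN by auto
  have Mi: "model L T (Mc i)" "is_struct L (Mc i)" "|Dom (Mc i)| \<le>o lam"
    using size i(1) by (auto simp: model_of_size_def model_def ordIso_iff_ordLeq)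
  \<comment> \<open>Finite consistency is given in \<open>N\<close>, while compactness starts from
    \<open>Mc i\<close>; the identity on \<open>B\<close> carries it over.\<close>
  have pe: "pelem L (Mc i) N B id"
    using subN i elem_sub_sat[of L "Mc i" N] B(1) by (auto simp: pelem_def tuples_def)
  define C where "C = {..<n}"
  define \<Delta> :: "(('f, 'r) fm \<times> ('m + nat) list) set" where
    "\<Delta> = (\<lambda>(\<phi>, \<beta>). (\<phi>, map Inr [0..<n] @ map Inl \<beta>)) ` \<Gamma>"
  have C: "|C| \<le>o lam" unfolding C_def by (rule finite_ordLeq[OF lam finite_lessThan])
  have wf: "\<phi> \<in> formulas L (length a) \<and> set a \<subseteq> Dom (Mc i) <+> C" if mem: "(\<phi>, a) \<in> \<Delta>" for \<phi> a
  proof -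
    obtain \<beta> where "(\<phi>, \<beta>) \<in> \<Gamma>" "a = map Inr [0..<n] @ map Inl \<beta>" using mem by (auto simp: \<Delta>_def)
    then show ?thesis using \<Gamma>[of \<phi> \<beta>] i(2) by (auto simp: C_def)
  qed
  have eval: "map (case_sum id h) (map Inr [0..<n] @ map Inl \<beta>) = map h [0..<n] @ \<beta>" for h :: "nat \<Rightarrow> 'm" and \<beta>
    by (simp add: comp_def)
  have fin': "\<exists>h. h ` C \<subseteq> Dom (Mc i) \<and> (\<forall>(\<phi>, a)\<in>\<Delta>0. sat_tuple (Mc i) (map (case_sum id h) a) \<phi>)"
    if \<Delta>0: "\<Delta>0 \<subseteq> \<Delta>" "finite \<Delta>0" for \<Delta>0
  proof -
    obtain P where P: "P \<subseteq> \<Gamma>" "finite P" "\<Delta>0 = (\<lambda>(\<phi>, \<beta>). (\<phi>, map Inr [0..<n] @ map Inl \<beta>)) ` P"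
      using finite_subset_image[OF \<Delta>0(2) \<Delta>0(1)[unfolded \<Delta>_def]] by blast
    have "\<exists>a\<in>tuples N n. \<forall>(\<phi>, \<beta>)\<in>P. sat_tuple N (a @ map id \<beta>) \<phi>" using fin[OF P(2,1)] by simp
    moreover have "\<And>\<phi> \<beta>. (\<phi>, \<beta>) \<in> P \<Longrightarrow> \<phi> \<in> formulas L (n + length \<beta>) \<and> set \<beta> \<subseteq> B" using \<Gamma> P(1) by blast
    ultimately have "\<exists>a\<in>tuples (Mc i) n. \<forall>(\<phi>, \<beta>)\<in>P. sat_tuple (Mc i) (a @ \<beta>) \<phi>"
      using finite_sat_transfer[OF pe P(2), of n] by simp
    then obtain a where a: "a \<in> tuples (Mc i) n" "\<And>\<phi> \<beta>. (\<phi>, \<beta>) \<in> P \<Longrightarrow> sat_tuple (Mc i) (a @ \<beta>) \<phi>" by blast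
    have "map ((!) a) [0..<n] = a" using a(1) map_nth[of a] by (simp add: tuples_def)
    then have "sat_tuple (Mc i) (map (case_sum id ((!) a)) (map Inr [0..<n] @ map Inl \<beta>)) \<phi>"
      if "(\<phi>, \<beta>) \<in> P" for \<phi> \<beta> unfolding eval using a(2)[OF that] by simp
    then have "\<forall>(\<phi>, b)\<in>\<Delta>0. sat_tuple (Mc i) (map (case_sum id ((!) a)) b) \<phi>"
      unfolding P(3) by (auto simp del: map_append map_map)
    moreover have "(!) a ` C \<subseteq> Dom (Mc i)" using tuples_nth[OF a(1)] by (auto simp: C_def)
    ultimately show ?thesis by blast
  qed
  obtain N' :: "('f, 'r, 'm) struct" and h where N': "elem_sub L (Mc i) N'" "|Dom N'| \<le>o lam" "h ` C \<subseteq> Dom N'"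
    "\<And>\<phi> a. (\<phi>, a) \<in> \<Delta> \<Longrightarrow> sat_tuple N' (map (case_sum id h) a) \<phi>"
    by (rule compactness[OF Mi(2) lam big L Mi(3) C, of \<Delta>]) (erule wf, erule fin', assumption, rule that)
  let ?s = "wo_rel.suc r {i}"
  have s: "?s \<in> Field r" by (rule limit_suc(1)[OF lo i(1)])
  have univ_i: "universal_over L T lam (Mc ?s) (Mc i)" using univ i(1) by blast
  obtain k where k: "elem_emb L k N' (Mc ?s)" "\<And>a. a \<in> Dom (Mc i) \<Longrightarrow> k a = a"
    by (rule universal_embed[OF univ_i T N'(1,2)]) (rule that)
  have sN: "elem_sub L (Mc ?s) N" using subN s by blast
  have kN: "elem_emb L k N' N"
    using elem_emb_trans[OF k(1) sN[unfolded elem_sub_def]] by simp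
  define a where "a = map (k \<circ> h) [0..<n]"
  have hN': "map h [0..<n] \<in> tuples N' n" using N'(3) by (auto simp: tuples_def C_def)
  have aN: "a \<in> tuples N n" using elem_emb_tuples[OF kN hN'] by (simp add: a_def)
  have "sat_tuple N (a @ \<beta>) \<phi>" if mem: "(\<phi>, \<beta>) \<in> \<Gamma>" for \<phi> \<beta>
  proof -
    have "(\<phi>, map Inr [0..<n] @ map Inl \<beta>) \<in> \<Delta>" unfolding \<Delta>_def using mem by (rule rev_image_eqI) simp
    from N'(4)[OF this] have *: "sat_tuple N' (map h [0..<n] @ \<beta>) \<phi>" unfolding eval .
    have \<beta>: "\<beta> \<in> tuples (Mc i) (length \<beta>)" "\<phi> \<in> formulas L (n + length \<beta>)"
      using \<Gamma>[OF mem] i(2) by (auto simp: tuples_def)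
    have "map h [0..<n] @ \<beta> \<in> tuples N' (n + length \<beta>)"
      by (rule tuples_append[OF hN']) (use elem_sub_tuples[OF N'(1)] \<beta>(1) in blast)
    from elem_emb_sat[OF kN \<beta>(2) this] * have "sat_tuple N (map k (map h [0..<n] @ \<beta>)) \<phi>" by simp
    moreover have "map k \<beta> = \<beta>" using \<beta>(1) k(2) by (auto simp: tuples_def intro!: map_idI)
    ultimately show ?thesis by (simp add: a_def)
  qed
  then show ?thesis using aN by blast
qed

section \<open>Isomorphisms, local character and the comparison\<close>

lemma isomorphic_elem_emb:
  assumes "isomorphic L M N" "is_struct L M" "is_struct L N"
  obtains h where "bij_betw h (Dom M) (Dom N)" "elem_emb L h M N"
proof -
  obtain h where bij: "bij_betw h (Dom M) (Dom N)"
     and Fun: "\<And>f xs. f \<in> Funs L \<Longrightarrow> xs \<in> tuples M (farity L f) \<Longrightarrow> h (Fun M f xs) = Fun N f (map h xs)"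
     and Rel: "\<And>r xs. r \<in> Rels L \<Longrightarrow> xs \<in> tuples M (rarity L r) \<Longrightarrow> Rel M r xs \<longleftrightarrow> Rel N r (map h xs)"
    using assms(1) unfolding isomorphic_def by blast
  have evalD: "eval_tm M e t \<in> Dom M" if "wf_tm L t" "range e \<subseteq> Dom M" for e t
    by (rule eval_tm_in_Dom[OF assms(2) that(1)]) (use that(2) in auto)
  have eval: "eval_tm N (h \<circ> e) t = h (eval_tm M e t)" if "wf_tm L t" "range e \<subseteq> Dom M" for e t
    using that(1)
  proof (induction t)
    case (App f ts)
    have "eval_tm N (h \<circ> e) t = h (eval_tm M e t)" if "t \<in> set ts" for t
      by (rule App.IH[OF that]) (use App.prems that in simp)
    then have "map (eval_tm N (h \<circ> e)) ts = map h (map (eval_tm M e) ts)"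
      unfolding map_map by (intro map_cong refl) simp
    moreover have "map (eval_tm M e) ts \<in> tuples M (farity L f)"
      using App.prems evalD[OF _ that(2)] by (auto simp: tuples_def)
    ultimately show ?case using Fun[of f "map (eval_tm M e) ts"] App.prems by (simp only: eval_tm.simps wf_tm.simps)
  qed simp
  have sat: "sat M e \<phi> \<longleftrightarrow> sat N (h \<circ> e) \<phi>" if "wf_fm L \<phi>" "range e \<subseteq> Dom M" for e \<phi>
    using that
  proof (induction \<phi> arbitrary: e)
    case (Equal s t)
    then have wf: "wf_tm L s" "wf_tm L t" by simp_all
    show ?case unfolding sat.simps eval[OF wf(1) Equal.prems(2)] eval[OF wf(2) Equal.prems(2)]
      by (rule inj_on_eq_iff[OF bij_betw_imp_inj_on[OF bij] evalD evalD, symmetric]) (rule wf Equal.prems(2))+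
  next
    case (Pred r ts)
    have "eval_tm N (h \<circ> e) t = h (eval_tm M e t)" if "t \<in> set ts" for t
      by (rule eval) (use Pred that in simp_all)
    then have "map (eval_tm N (h \<circ> e)) ts = map h (map (eval_tm M e) ts)"
      unfolding map_map by (intro map_cong refl) simp
    moreover have "map (eval_tm M e) ts \<in> tuples M (rarity L r)"
      using Pred evalD[of _ e] by (auto simp: tuples_def)
    ultimately show ?case using Rel[of r "map (eval_tm M e) ts"] Pred by (simp only: sat.simps wf_fm.simps)
  next
    case (Neg \<phi>)
    then show ?case using Neg.IH[of e] by simp
  next
    case (And \<phi> \<psi>)
    then show ?case using And.IH(1)[of e] And.IH(2)[of e] by simp
  next
    case (Exists x \<phi>)
    have "sat M (e(x := a)) \<phi> \<longleftrightarrow> sat N ((h \<circ> e)(x := h a)) \<phi>" if "a \<in> Dom M" for a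
    proof -
      have "sat M (e(x := a)) \<phi> \<longleftrightarrow> sat N (h \<circ> e(x := a)) \<phi>"
        by (rule Exists.IH) (use Exists.prems that in auto)
      also have "h \<circ> e(x := a) = (h \<circ> e)(x := h a)" by (rule ext) simp
      finally show ?thesis .
    qed
    moreover have DomN: "Dom N = h ` Dom M" using bij by (simp add: bij_betw_def)
    ultimately show ?case unfolding sat.simps DomN bex_simps by (intro bex_cong refl)
  qed
  have "elem_emb L h M N" using sat assms(2,3) bij by (simp add: elem_emb_def bij_betw_def)
  then show thesis using that bij by blast
qed

text \<open>Chains are reindexed along the isomorphism. This matters because \<open>kappa\<close>
  ranges over cardinals on \<open>'m\<close>, whereas the given cofinality lives on a type of its
  own.\<close>

lemma local_character_ordIso:
  fixes L :: "('f, 'r) lang" and U :: "'m itself"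
  assumes "\<kappa> =o \<kappa>'" "local_character U L T \<kappa>"
  shows "local_character U L T \<kappa>'"
  unfolding local_character_def
proof (intro allI impI)
  fix M :: "('f, 'r, 'm) struct" and A n p
  assume *: "model L T M" "\<forall>i\<in>Field \<kappa>'. A i \<subseteq> Dom M" "relChain \<kappa>' A" "p \<in> types L M (\<Union>i\<in>Field \<kappa>'. A i) n"
  obtain f where f: "bij_betw f (Field \<kappa>) (Field \<kappa>')"
    "\<And>i j. i \<in> Field \<kappa> \<Longrightarrow> j \<in> Field \<kappa> \<Longrightarrow> (i, j) \<in> \<kappa> \<longleftrightarrow> (f i, f j) \<in> \<kappa>'"
    using assms(1) unfolding ordIso_def iso_iff2 by blast
  have img: "f ` Field \<kappa> = Field \<kappa>'" using f(1) by (simp add: bij_betw_def)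
  have "relChain \<kappa> (A \<circ> f)"
    using *(3) f(2) unfolding relChain_def by (auto simp: Field_def) blast
  moreover have "\<forall>i\<in>Field \<kappa>. (A \<circ> f) i \<subseteq> Dom M" using *(2) img by auto
  moreover have "(\<Union>i\<in>Field \<kappa>. (A \<circ> f) i) = (\<Union>i\<in>Field \<kappa>'. A i)" unfolding img[symmetric] by auto
  then have "p \<in> types L M (\<Union>i\<in>Field \<kappa>. (A \<circ> f) i) n" using *(4) by simp
  ultimately have "\<exists>i\<in>Field \<kappa>. \<not> forks L M n p ((A \<circ> f) i)"
    using assms(2)[unfolded local_character_def, rule_format, OF *(1), where A = "A \<circ> f" and n = n and p = p] by meson
  then show "\<exists>i\<in>Field \<kappa>'. \<not> forks L M n p (A i)" using img by auto
qed

lemma least_card_exists: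
  assumes "Cinfinite \<kappa>" "P \<kappa>"
  obtains \<kappa>0 where "least_card P = Some \<kappa>0" "is_least_card P \<kappa>0" "\<kappa>0 \<le>o \<kappa>"
proof -
  define R where "R = {\<kappa>. Cinfinite \<kappa> \<and> P \<kappa>}"
  have "\<exists>r\<in>R. \<forall>r'\<in>R. r \<le>o r'" by (rule exists_minim_Card_order) (use assms in \<open>auto simp: R_def\<close>)
  then have ex: "\<exists>\<kappa>. is_least_card P \<kappa>" unfolding R_def is_least_card_def by blast
  define \<kappa>0 where "\<kappa>0 = (SOME \<kappa>. is_least_card P \<kappa>)"
  have "is_least_card P \<kappa>0" unfolding \<kappa>0_def by (rule someI_ex[OF ex])
  moreover have "least_card P = Some \<kappa>0" using ex by (simp add: least_card_def \<kappa>0_def)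
  moreover have "\<kappa>0 \<le>o \<kappa>" using calculation(1) assms unfolding is_least_card_def by blast
  ultimately show thesis using that by blast
qed

text \<open>Were \<open>\<kappa>(T) \<le> \<mu>\<close> then \<open>\<kappa>\<^sub>r(T) \<le> \<mu>\<close>, as \<open>\<mu>\<close> is regular.\<close>
lemma below_kappa_r_not_local_character:
  fixes \<mu> :: "'a rel" and L :: "('f, 'r) lang"
  assumes \<mu>: "Cinfinite \<mu>" "regularCard \<mu>" and below: "card_below \<mu> (kappa_r L T :: 'm rel option)"
    and small: "\<mu> \<le>o |UNIV :: 'm set|"
  shows "\<not> local_character TYPE('m) L T \<mu>"
proof
  assume lc: "local_character TYPE('m) L T \<mu>"
  have "|Field \<mu>| =o \<mu>" by (rule card_of_Field_ordIso) (use \<mu>(1) in simp)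
  then have "|Field \<mu>| \<le>o |UNIV :: 'm set|" using small by (rule ordIso_ordLeq_trans)
  then have "\<exists>f :: 'a \<Rightarrow> 'm. inj_on f (Field \<mu>) \<and> f ` Field \<mu> \<subseteq> UNIV"
    using card_of_ordLeq[of "Field \<mu>" "UNIV :: 'm set"] by (simp only:)
  then obtain f :: "'a \<Rightarrow> 'm" where f: "inj_on f (Field \<mu>)" by (elim exE conjE)
  \<comment> \<open>A copy of \<open>\<mu>\<close> on the universe, so that it competes among the
    cardinals over which \<open>kappa\<close> and \<open>kappa_r\<close> are minimized.\<close>
  define \<mu>' where "\<mu>' = dir_image \<mu> f"
  have iso: "\<mu> =o \<mu>'" unfolding \<mu>'_def
    by (rule dir_image_ordIso[OF _ f]) (use \<mu>(1) in \<open>simp add: card_order_on_def\<close>)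
  have \<mu>': "Cinfinite \<mu>'" "regularCard \<mu>'"
    using Cinfinite_cong[OF iso \<mu>(1)] regularCard_ordIso[OF iso \<mu>] by auto
  obtain \<kappa> :: "'m rel" where "least_card (local_character TYPE('m) L T) = Some \<kappa>" and \<kappa>: "\<kappa> \<le>o \<mu>'"
    by (rule least_card_exists[of \<mu>' "local_character TYPE('m) L T", OF \<mu>'(1) local_character_ordIso[OF iso lc]])
      (rule that)
  then have kappa: "kappa L T = Some \<kappa>" by (simp only: kappa_def)
  obtain \<kappa>r :: "'m rel" where "least_card (\<lambda>\<kappa>'. regularCard \<kappa>' \<and> \<kappa> \<le>o \<kappa>') = Some \<kappa>r" and \<kappa>r: "\<kappa>r \<le>o \<mu>'"
    by (rule least_card_exists[of \<mu>' "\<lambda>\<kappa>'. regularCard \<kappa>' \<and> \<kappa> \<le>o \<kappa>'", OF \<mu>'(1) conjI[OF \<mu>'(2) \<kappa>]])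
      (rule that)
  then have "kappa_r L T = Some \<kappa>r" by (simp add: kappa_r_def kappa)
  then have "\<mu> <o \<kappa>r" using below by (simp add: card_below_def)
  then have "\<mu> <o \<mu>'" using \<kappa>r by (rule ordLess_ordLeq_trans)
  then show False using iso not_ordLess_ordIso by auto
qed

theorem theoremA6:
  fixes L :: "('f, 'r) lang" and T :: "('f, 'r) fm set"
    and lam :: "'l rel" and \<mu>1 :: "'a rel" and \<mu>2 :: "'b rel"
    and M1 M2 :: "('f, 'r, 'm) struct"
  assumes "Card_order lam" and "lam <o |UNIV :: 'm set|"
    and "complete_theory TYPE('m) L T"
    and "theory_card L \<le>o lam"
    and "stable_in TYPE('m) L T lam"
    and "\<not> superstable TYPE('m) L T"
    and "Cinfinite \<mu>1" and "regularCard \<mu>1"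
    and "Cinfinite \<mu>2" and "regularCard \<mu>2"
    and "card_below \<mu>1 (kappa_r L T :: 'm rel option)"
    and "\<mu>1 <o \<mu>2" and "\<mu>2 <o cardSuc lam"
    and "limit_model L T lam \<mu>1 M1"
    and "limit_model L T lam \<mu>2 M2"
  shows "\<not> isomorphic L M1 M2"
proof
  assume iso: "isomorphic L M1 M2"
  have TL: "T \<subseteq> sentences L" using assms(3) by (simp add: complete_theory_def)
  have co1: "Card_order \<mu>1" "Card_order \<mu>2" using assms(7,9) by auto
  have "\<mu>2 \<le>o lam" using assms(13) cardSuc_ordLeq_ordLess[OF assms(1) co1(2)] by simp
  then have \<mu>1_lam: "\<mu>1 \<le>o lam" using assms(12) ordLess_imp_ordLeq ordLeq_transitive by blast
  have lam: "Cinfinite lam" using cinfinite_mono[OF \<mu>1_lam] assms(1,7) by blast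
  have "\<mu>1 \<le>o |UNIV :: 'm set|" using \<mu>1_lam assms(2) ordLess_imp_ordLeq ordLeq_transitive by blast
  then have "\<not> local_character TYPE('m) L T \<mu>1"
    by (rule below_kappa_r_not_local_character[OF assms(7,8,11)])
  then obtain M :: "('f, 'r, 'm) struct" and A n p where M: "model L T M"
    and A: "\<forall>i \<in> Field \<mu>1. A i \<subseteq> Dom M" "relChain \<mu>1 A"
    and p: "p \<in> types L M (\<Union>i \<in> Field \<mu>1. A i) n" "\<forall>i \<in> Field \<mu>1. forks L M n p (A i)"
    unfolding local_character_def by blast
  obtain Mc where lo: "limit_ordinal \<mu>1"
    and size: "\<forall>i \<in> Field \<mu>1. model_of_size L T lam (Mc i)" and sizeM1: "model_of_size L T lam M1"
    and sub: "\<forall>(i, j) \<in> \<mu>1. elem_sub L (Mc i) (Mc j)" and subN: "\<forall>i \<in> Field \<mu>1. elem_sub L (Mc i) M1"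
    and DomN: "Dom M1 = (\<Union>i \<in> Field \<mu>1. Dom (Mc i))"
    and univ: "\<forall>i \<in> Field \<mu>1. universal_over L T lam (Mc (wo_rel.suc \<mu>1 {i})) (Mc i)"
    using assms(14) unfolding limit_model_def by (elim conjE exE)
  have M1: "model L T M1" "is_struct L M1" using sizeM1 by (auto simp: model_of_size_def model_def)
  have M2: "is_struct L M2" using assms(15) by (auto simp: limit_model_def model_of_size_def model_def)
  obtain \<phi> \<beta> g where g: "pelem L M M1 (\<Union>i\<in>Field \<mu>1. set (\<beta> i)) g"
    and \<phi>: "\<And>i. i \<in> Field \<mu>1 \<Longrightarrow> \<phi> i \<in> formulas L (n + length (\<beta> i))"
    and fin: "\<And>F. finite F \<Longrightarrow> F \<subseteq> Field \<mu>1 \<Longrightarrow> \<exists>a\<in>tuples M n. \<forall>i\<in>F. sat_tuple M (a @ \<beta> i) (\<phi> i)"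
    and omit: "\<And>a. a \<in> tuples M1 n \<Longrightarrow> \<exists>i\<in>Field \<mu>1. \<not> sat_tuple M1 (a @ map g (\<beta> i)) (\<phi> i)"
  proof (rule omit_along_chain[OF lam assms(2,4,3,5,7,8) \<mu>1_lam lo, of Mc M1 M A p n])
    show "\<And>i. i \<in> Field \<mu>1 \<Longrightarrow> model L T (Mc i)" using size by (simp add: model_of_size_def)
    show "\<And>i j. (i, j) \<in> \<mu>1 \<Longrightarrow> elem_sub L (Mc i) (Mc j)" using sub by blast
    show "\<And>i. i \<in> Field \<mu>1 \<Longrightarrow> elem_sub L (Mc i) M1" using subN by blast
    show "Dom M1 = (\<Union>i \<in> Field \<mu>1. Dom (Mc i))" by (rule DomN)
    show "model L T M1" by (rule M1(1))
    show "\<And>i. i \<in> Field \<mu>1 \<Longrightarrow> universal_over L T lam (Mc (wo_rel.suc \<mu>1 {i})) (Mc i)" using univ by blast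
    show "model L T M" by (rule M)
    show "\<And>i. i \<in> Field \<mu>1 \<Longrightarrow> A i \<subseteq> Dom M" using A(1) by blast
    show "relChain \<mu>1 A" by (rule A(2))
    show "p \<in> types L M (\<Union>i \<in> Field \<mu>1. A i) n" by (rule p(1))
    show "\<And>i. i \<in> Field \<mu>1 \<Longrightarrow> forks L M n p (A i)" using p(2) by blast
  qed (rule that)
  define U where "U = (\<Union>i\<in>Field \<mu>1. set (\<beta> i))"
  obtain h where h: "bij_betw h (Dom M1) (Dom M2)" "elem_emb L h M1 M2"
    by (rule isomorphic_elem_emb[OF iso M1(2) M2]) (rule that)
  have hg: "pelem L M M2 U (h \<circ> g)" unfolding U_def by (rule pelem_comp_emb[OF g h(2)])
  \<comment> \<open>The type omitted by \<open>M1\<close>, moved to \<open>M2\<close> by the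
    isomorphism. It has at most \<open>\<mu>1\<close> parameters, few enough for \<open>M2\<close>
    to realize it.\<close>
  define \<Gamma> where "\<Gamma> = (\<lambda>i. (\<phi> i, map (h \<circ> g) (\<beta> i))) ` Field \<mu>1"
  have "\<exists>b\<in>tuples M2 n. \<forall>(\<phi>, \<beta>)\<in>\<Gamma>. sat_tuple M2 (b @ \<beta>) \<phi>"
  proof (rule limit_model_realizes[OF lam assms(2,4) TL assms(9,10,15)])
    show "\<psi> \<in> formulas L (n + length b) \<and> set b \<subseteq> (h \<circ> g) ` U" if mem: "(\<psi>, b) \<in> \<Gamma>" for \<psi> b
    proof -
      obtain i where i: "\<psi> = \<phi> i" "b = map (h \<circ> g) (\<beta> i)" "i \<in> Field \<mu>1"
        using mem by (auto simp: \<Gamma>_def)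
      have "set b = (h \<circ> g) ` set (\<beta> i)" by (simp only: i set_map)
      also have "\<dots> \<subseteq> (h \<circ> g) ` U" unfolding U_def using i(3) by (intro image_mono) blast
      finally show ?thesis using \<phi>[OF i(3)] i by simp
    qed
    show "(h \<circ> g) ` U \<subseteq> Dom M2" using hg by (simp add: pelem_def)
    have "|Field \<mu>1| \<le>o \<mu>1" using card_of_Field_ordIso[OF co1(1)] by (simp add: ordIso_iff_ordLeq)
    then have "|U| \<le>o \<mu>1" unfolding U_def
      by (rule UNION_ordLeq[OF assms(7)]) (rule finite_ordLeq[OF assms(7) finite_set])
    from image_ordLeq[OF this, of "h \<circ> g"] show "|(h \<circ> g) ` U| <o \<mu>2"
      using assms(12) by (rule ordLeq_ordLess_trans)
    fix P assume P: "finite P" "P \<subseteq> \<Gamma>"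
    obtain F where F: "F \<subseteq> Field \<mu>1" "finite F" "P = (\<lambda>i. (\<phi> i, map (h \<circ> g) (\<beta> i))) ` F"
      using finite_subset_image[OF P(1) P(2)[unfolded \<Gamma>_def]] by blast
    define Q where "Q = (\<lambda>i. (\<phi> i, \<beta> i)) ` F"
    obtain a where "a \<in> tuples M n" "\<forall>i\<in>F. sat_tuple M (a @ \<beta> i) (\<phi> i)" using fin[OF F(2,1)] by blast
    then have "\<exists>a\<in>tuples M n. \<forall>(\<phi>, \<beta>)\<in>Q. sat_tuple M (a @ \<beta>) \<phi>" unfolding Q_def by auto
    moreover have "finite Q" using F(2) by (simp add: Q_def)
    moreover have "\<And>\<psi> b. (\<psi>, b) \<in> Q \<Longrightarrow> \<psi> \<in> formulas L (n + length b) \<and> set b \<subseteq> U"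
      using \<phi> F(1) by (auto simp: Q_def U_def)
    ultimately have "\<exists>a\<in>tuples M2 n. \<forall>(\<phi>, \<beta>)\<in>Q. sat_tuple M2 (a @ map (h \<circ> g) \<beta>) \<phi>"
      using finite_sat_transfer[OF hg, of Q n] by blast
    then show "\<exists>b\<in>tuples M2 n. \<forall>(\<phi>, \<beta>)\<in>P. sat_tuple M2 (b @ \<beta>) \<phi>" unfolding F(3) Q_def by auto
  qed
  then obtain b where b: "b \<in> tuples M2 n" "\<And>i. i \<in> Field \<mu>1 \<Longrightarrow> sat_tuple M2 (b @ map (h \<circ> g) (\<beta> i)) (\<phi> i)"
    unfolding \<Gamma>_def by auto
  \<comment> \<open>As \<open>h\<close> is onto, the realization has a preimage, which would realize
    the omitted type in \<open>M1\<close>.\<close>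
  define a where "a = map (inv_into (Dom M1) h) b"
  have img: "h ` Dom M1 = Dom M2" using h(1) by (simp add: bij_betw_def)
  have a: "a \<in> tuples M1 n" using b(1) inv_into_into[of _ h "Dom M1"] img by (auto simp: a_def tuples_def)
  have "map h a = b" using b(1) img unfolding a_def by (auto simp: tuples_def f_inv_into_f intro!: map_idI)
  have "sat_tuple M1 (a @ map g (\<beta> i)) (\<phi> i)" if i: "i \<in> Field \<mu>1" for i
  proof -
    have "map g (\<beta> i) \<in> tuples M1 (length (\<beta> i))" using g i by (auto simp: pelem_def tuples_def)
    from elem_emb_sat[OF h(2) \<phi>[OF i] tuples_append[OF a this]] b(2)[OF i] \<open>map h a = b\<close>
    show ?thesis by simp
  qed
  then show False using omit[OF a] by blast
qed

end
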